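(* Let $G$ be a locally compact abelian group, let $n\in\mathbb{N}$, and let $1\le p\in\mathbb{R}$ with $p\le 2n/(n-1)$ (no upper bound on $p$ when $n=1$). Suppose $G$ has a closed subgroup of finite index isomorphic, as a locally compact abelian group, to $\mathbb{R}^n$ or to $\mathbb{Z}^n$. Let $H$ be a subgroup of $G$, let $\theta\in\mathbb{C}H$, and let $0\neq f\in L^p(G)$. (a) If $\theta$ is a non-zerodivisor in $\mathbb{C}H$, then $\theta f\neq 0$. (b) If $H$ is torsion-free and $\theta\neq0$, then $\theta f\neq 0$.
   Context: $\mathbb{C}H$ denotes the group ring of $H$, acting on $L^p(G)$ (with respect to Haar measure) by $(\sum_h c_h h)f=\sum_h c_h L(h)f$, where $L(h)f(x)=f(h^{-1}x)$. A non-zerodivisor in $\mathbb{C}H$ is an element $\theta$ with $\theta\beta\neq0$ for all nonzero $\beta\in\mathbb{C}H$. Torsion-free means the only element of finite order is the identity. *)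

theory Defs
  imports "HOL-Analysis.Analysis"
begin

text \<open>Groups are written additively: the LCA group is a type of class
  topological_ab_group_add (continuous addition and negation), Hausdorff.\<close>

definition add_subgroup :: "'g::ab_group_add set \<Rightarrow> bool" where
  "add_subgroup H \<longleftrightarrow> 0 \<in> H \<and> (\<forall>x\<in>H. \<forall>y\<in>H. x + y \<in> H) \<and> (\<forall>x\<in>H. - x \<in> H)"

definition finite_index :: "'g::ab_group_add set \<Rightarrow> bool" where
  "finite_index K \<longleftrightarrow> finite (range (\<lambda>g. (+) g ` K))"

definition additive_map :: "('a::ab_group_add \<Rightarrow> 'g::ab_group_add) \<Rightarrow> bool" where
  "additive_map \<phi> \<longleftrightarrow> (\<forall>x y. \<phi> (x + y) = \<phi> x + \<phi> y)"

definition finite_index_copy :: "'a::{ab_group_add,topological_space} itself \<Rightarrow> 'g::{ab_group_add,topological_space} \<Rightarrow> bool"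
  where "finite_index_copy TYPE('a) (dummy::'g) \<longleftrightarrow>
    (\<exists>K (\<phi>::'a \<Rightarrow> 'g) \<psi>. closed K \<and> add_subgroup K \<and> finite_index K \<and>
        additive_map \<phi> \<and> homeomorphism UNIV K \<phi> \<psi>)"

definition is_haar_measure :: "'g::topological_ab_group_add measure \<Rightarrow> bool" where
  "is_haar_measure M \<longleftrightarrow>
     sets M = sets borel \<and> space M = UNIV \<and>
     (\<forall>C. compact C \<longrightarrow> emeasure M C < \<infinity>) \<and>
     (\<forall>A\<in>sets borel. emeasure M A = (INF U\<in>{U. open U \<and> A \<subseteq> U}. emeasure M U)) \<and>
     (\<forall>U. open U \<longrightarrow> emeasure M U = (SUP C\<in>{C. compact C \<and> C \<subseteq> U}. emeasure M C)) \<and>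
     (\<forall>g. \<forall>A\<in>sets borel. emeasure M ((+) g ` A) = emeasure M A) \<and>
     emeasure M UNIV \<noteq> 0"

definition in_Lp :: "'g::topological_space measure \<Rightarrow> real \<Rightarrow> ('g \<Rightarrow> complex) \<Rightarrow> bool" where
  "in_Lp M p f \<longleftrightarrow> f \<in> borel_measurable M \<and> (\<integral>\<^sup>+ x. ennreal (norm (f x) powr p) \<partial>M) < \<infinity>"

definition supp :: "('g \<Rightarrow> complex) \<Rightarrow> 'g set" where
  "supp \<theta> = {h. \<theta> h \<noteq> 0}"

definition group_ring :: "'g set \<Rightarrow> ('g \<Rightarrow> complex) set" where
  "group_ring H = {\<theta>. finite (supp \<theta>) \<and> supp \<theta> \<subseteq> H}"

definition gr_mult :: "('g::ab_group_add \<Rightarrow> complex) \<Rightarrow> ('g \<Rightarrow> complex) \<Rightarrow> 'g \<Rightarrow> complex" where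
  "gr_mult \<alpha> \<beta> g = (\<Sum>h\<in>supp \<alpha>. \<alpha> h * \<beta> (g - h))"

definition gr_act :: "('g::ab_group_add \<Rightarrow> complex) \<Rightarrow> ('g \<Rightarrow> complex) \<Rightarrow> 'g \<Rightarrow> complex" where
  "gr_act \<theta> f x = (\<Sum>h\<in>supp \<theta>. \<theta> h * f (x - h))"

definition non_zerodivisor :: "'g::ab_group_add set \<Rightarrow> ('g \<Rightarrow> complex) \<Rightarrow> bool" where
  "non_zerodivisor H \<theta> \<longleftrightarrow>
     (\<forall>\<beta>\<in>group_ring H. \<beta> \<noteq> (\<lambda>_. 0) \<longrightarrow> gr_mult \<theta> \<beta> \<noteq> (\<lambda>_. 0))"

definition torsion_free :: "'g::ab_group_add set \<Rightarrow> bool" where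
  "torsion_free H \<longleftrightarrow> (\<forall>h\<in>H. \<forall>n::nat. n > 0 \<longrightarrow> (((+) h) ^^ n) 0 = 0 \<longrightarrow> h = 0)"

end

theory Submission
  imports Defs "HOL-Probability.Probability" "HOL-Computational_Algebra.Polynomial"
    "HOL-Real_Asymp.Real_Asymp"
begin

text \<open>
  Let \<open>K\<close> be the subgroup of finite index. Since finitely generated abelian groups have polynomial
  growth, counting linear equations produces \<open>\<beta>\<close> such that \<open>\<alpha> = \<theta>\<beta>\<close> is supported in \<open>K\<close>; it is
  nonzero because \<open>\<theta>\<close> is a non-zerodivisor. (If \<open>H\<close> is torsion-free, a multiple of the identity embeds it into
  \<open>K\<close>, hence into \<open>\<real>\<^sup>n\<close>, and every nonzero \<open>\<theta>\<close> is a non-zerodivisor by comparison of leading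
  terms.) As \<open>\<alpha>f = 0\<close>, one may argue on each coset of \<open>K\<close>, that is, on \<open>\<real>\<^sup>n\<close>; functions on \<open>\<int>\<^sup>n\<close>
  are extended to \<open>\<real>\<^sup>n\<close> as constants on unit cubes.

  On \<open>\<real>\<^sup>n\<close> the Fourier transform of \<open>f\<close> is supported in the zero set of the exponential sum
  \<open>F(\<xi>) = \<Sum>\<^sub>s \<alpha>(s) e\<^bsup>i s\<xi>\<^esup>\<close>. This support is shown to lie in the locus where \<open>F\<close> vanishes to
  order \<open>k\<close> in a fixed generic direction, by induction on \<open>k\<close>; for large \<open>k\<close> that locus is empty. The
  induction step concerns a piece of a smooth hypersurface, whose \<open>\<epsilon>\<close>-neighbourhood has measure
  \<open>O(\<epsilon>)\<close>. A Bessel inequality bounds the pairing of \<open>f\<close> with a test function cut off to that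
  neighbourhood by \<open>(\<epsilon> \<integral>\<^bsub>|x| < 1/\<epsilon>\<^esub> |f|\<^sup>2)\<^bsup>1/2\<^esup>\<close> up to a constant, and this tends to zero precisely
  because \<open>p \<le> 2n/(n - 1)\<close>.
\<close>

section \<open>Multiples in the group ring\<close>

text \<open>For p \<ge> 2, Hoelder's inequality bounds the integral of |f|^2 over |x| < R by a
  multiple of R^(n(1 - 2/p)), and n(1 - 2/p) \<le> 1 is the condition p \<le> 2n/(n - 1). At the
  endpoint this is only O(R); the required o(R) comes from the small tail of |f|^p. A test function
  needs no more than a Lipschitz bound: the weight 1 + \<epsilon>^2|x|^2 costs one derivative in
  L^2, and a cutoff at distance \<epsilon> has derivatives of order 1/\<epsilon>, so the weighted
  norm only sees the measure of the neighbourhood. The obstacle is that the zero set of F may be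
  singular. A direction v with pairwise distinct values s\<bullet>v takes the place of a
  stratification: the derivatives of F along v multiply its coefficients by powers of distinct
  numbers, so the order of vanishing is smaller than the number of terms. As f is only given almost
  everywhere and may be unbounded, it is first convolved with Lipschitz bumps. The result is
  bounded, continuous and an exact solution; boundedness also reduces p < 2 to p = 2.\<close>

lemma gr_act_eq_sum:
  assumes "finite A" "supp \<theta> \<subseteq> A"
  shows "gr_act \<theta> f x = (\<Sum>h\<in>A. \<theta> h * f (x - h))"
  unfolding gr_act_def using assms by (intro sum.mono_neutral_left) (auto simp: supp_def)

lemma gr_mult_nonzero_imp_sum:
  assumes "gr_mult \<alpha> \<beta> g \<noteq> 0"
  shows "\<exists>a\<in>supp \<alpha>. \<exists>b\<in>supp \<beta>. g = a + b"
proof -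
  obtain h where "h \<in> supp \<alpha>" "\<alpha> h * \<beta> (g - h) \<noteq> 0"
    using assms sum.not_neutral_contains_not_neutral unfolding gr_mult_def by blast
  then show ?thesis by (intro bexI[of _ h] bexI[of _ "g - h"]) (auto simp: supp_def)
qed

lemma supp_gr_mult: "supp (gr_mult \<alpha> \<beta>) \<subseteq> (\<lambda>(a, b). a + b) ` (supp \<alpha> \<times> supp \<beta>)"
  using gr_mult_nonzero_imp_sum by (force simp: supp_def)

text \<open>Associativity of the action. The right-hand side involves only finitely many translates
  of \<alpha>f, so \<alpha>f = 0 almost everywhere carries over to the multiple
  \<alpha>\<beta>.\<close>

lemma gr_act_gr_mult:
  assumes "finite (supp \<alpha>)" "finite (supp \<beta>)"
  shows "gr_act (gr_mult \<alpha> \<beta>) f x = (\<Sum>s\<in>supp \<beta>. \<beta> s * gr_act \<alpha> f (x - s))"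
proof -
  define P where "P = (\<lambda>(a, b). a + b) ` (supp \<alpha> \<times> supp \<beta>)"
  have fP: "finite P" using assms by (simp add: P_def)
  have "gr_act (gr_mult \<alpha> \<beta>) f x = (\<Sum>g\<in>P. gr_mult \<alpha> \<beta> g * f (x - g))"
    by (rule gr_act_eq_sum[OF fP]) (use supp_gr_mult[of \<alpha> \<beta>] in \<open>simp add: P_def\<close>)
  also have "\<dots> = (\<Sum>h\<in>supp \<alpha>. \<Sum>g\<in>P. \<alpha> h * \<beta> (g - h) * f (x - g))"
    unfolding gr_mult_def sum_distrib_right by (rule sum.swap)
  also have "\<dots> = (\<Sum>h\<in>supp \<alpha>. \<Sum>s\<in>supp \<beta>. \<alpha> h * \<beta> s * f (x - (s + h)))"
  proof (rule sum.cong[OF refl])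
    fix h assume h: "h \<in> supp \<alpha>"
    have "(\<Sum>g\<in>P. \<alpha> h * \<beta> (g - h) * f (x - g)) = (\<Sum>g\<in>(\<lambda>s. s + h) ` supp \<beta>. \<alpha> h * \<beta> (g - h) * f (x - g))"
    proof (rule sum.mono_neutral_right[OF fP])
      show "(\<lambda>s. s + h) ` supp \<beta> \<subseteq> P" using h unfolding P_def by (force simp: add.commute[of _ h])
      show "\<forall>i\<in>P - (\<lambda>s. s + h) ` supp \<beta>. \<alpha> h * \<beta> (i - h) * f (x - i) = 0"
      proof
        fix i assume "i \<in> P - (\<lambda>s. s + h) ` supp \<beta>"
        then have "i - h \<notin> supp \<beta>" by (metis DiffE diff_add_cancel rev_image_eqI)
        then show "\<alpha> h * \<beta> (i - h) * f (x - i) = 0" by (simp add: supp_def)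
      qed
    qed
    also have "\<dots> = (\<Sum>s\<in>supp \<beta>. \<alpha> h * \<beta> s * f (x - (s + h)))"
      by (subst sum.reindex) (auto simp: inj_on_def)
    finally show "(\<Sum>g\<in>P. \<alpha> h * \<beta> (g - h) * f (x - g)) = (\<Sum>s\<in>supp \<beta>. \<alpha> h * \<beta> s * f (x - (s + h)))" .
  qed
  also have "\<dots> = (\<Sum>s\<in>supp \<beta>. \<Sum>h\<in>supp \<alpha>. \<alpha> h * \<beta> s * f (x - (s + h)))"
    by (rule sum.swap)
  also have "\<dots> = (\<Sum>s\<in>supp \<beta>. \<beta> s * gr_act \<alpha> f (x - s))"
    unfolding gr_act_def sum_distrib_left
    by (intro sum.cong refl) (simp add: algebra_simps)
  finally show ?thesis .
qed

section \<open>Linear systems and growth of sumsets\<close>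

text \<open>Gaussian elimination, by induction on the set of equations. The solution vanishes off
  \<open>S\<close>, so that it can be read as an element of a group ring.\<close>

lemma underdetermined_system_solution:
  fixes A :: "'e \<Rightarrow> 's \<Rightarrow> complex"
  assumes "finite E" "finite S" "card E < card S"
  shows "\<exists>h. (\<exists>s\<in>S. h s \<noteq> 0) \<and> (\<forall>s. s \<notin> S \<longrightarrow> h s = 0) \<and> (\<forall>e\<in>E. (\<Sum>s\<in>S. A e s * h s) = 0)"
  using assms
proof (induction E arbitrary: S A rule: finite_induct)
  case empty
  then obtain s where s: "s \<in> S" by fastforce
  then show ?case by (intro exI[of _ "\<lambda>x. if x = s then 1 else 0"]) auto
next
  case (insert e E)
  show ?case
  proof (cases "\<forall>s\<in>S. A e s = 0")
    case True
    have "card E < card S" using insert by simp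
    from insert.IH[OF insert.prems(1) this, of A] True show ?thesis by auto
  next
    case False
    then obtain s0 where s0: "s0 \<in> S" "A e s0 \<noteq> 0" by blast
    define S' where "S' = S - {s0}"
    have S': "finite S'" "s0 \<notin> S'" "S = insert s0 S'" using insert.prems s0 by (auto simp: S'_def)
    have "card E < card S'" using insert S' by simp
    \<comment> \<open>These are the remaining equations after equation \<open>e\<close> has been
      used to eliminate the unknown at \<open>s0\<close>.\<close>
    from insert.IH[OF S'(1) this, of "\<lambda>e' s. A e' s - A e' s0 * A e s / A e s0"]
    obtain h where h: "\<exists>s\<in>S'. h s \<noteq> 0" "\<forall>s. s \<notin> S' \<longrightarrow> h s = 0"
      "\<And>e'. e' \<in> E \<Longrightarrow> (\<Sum>s\<in>S'. (A e' s - A e' s0 * A e s / A e s0) * h s) = 0" by blast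
    \<comment> \<open>The value at \<open>s0\<close> that makes equation \<open>e\<close>
      hold.\<close>
    define c where "c = - (\<Sum>s\<in>S'. A e s * h s) / A e s0"
    have *: "(\<Sum>s\<in>S. A e' s * (h(s0 := c)) s) = A e' s0 * c + (\<Sum>s\<in>S'. A e' s * h s)" for e'
    proof -
      have "(\<Sum>s\<in>S'. A e' s * (h(s0 := c)) s) = (\<Sum>s\<in>S'. A e' s * h s)"
        using S' by (intro sum.cong) auto
      then show ?thesis using S' by simp
    qed
    have "(\<Sum>s\<in>S. A e' s * (h(s0 := c)) s) = 0" if "e' \<in> insert e E" for e'
    proof (cases "e' = e")
      case True
      then show ?thesis using s0 unfolding * by (simp add: c_def)
    next
      case False
      then have "0 = (\<Sum>s\<in>S'. A e' s * h s) - A e' s0 * (\<Sum>s\<in>S'. A e s * h s) / A e s0"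
        using h(3)[of e'] that
        by (simp add: left_diff_distrib sum_subtractf sum_distrib_left sum_divide_distrib mult.assoc)
      then show ?thesis unfolding * by (simp add: c_def)
    qed
    moreover have "\<exists>s\<in>S. (h(s0 := c)) s \<noteq> 0" using h(1) S' by auto
    moreover have "\<forall>s. s \<notin> S \<longrightarrow> (h(s0 := c)) s = 0" using h(2) S' by auto
    ultimately show ?thesis by blast
  qed
qed

text \<open>The \<open>j\<close>-fold sumset of a finite set \<open>T\<close> grows polynomially in \<open>j\<close>, hence it cannot
  grow by a factor \<open>c > 1\<close> in each step.\<close>

lemma finite_set_small_sumset:
  fixes T :: "'g::ab_group_add set" and c :: real
  assumes T: "finite T" and c: "1 < c" and H: "add_subgroup H" "T \<subseteq> H"
  shows "\<exists>S. finite S \<and> S \<noteq> {} \<and> S \<subseteq> H \<and> real (card ((\<lambda>(a, b). a + b) ` (S \<times> T))) < c * real (card S)"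
proof (rule ccontr)
  assume neg: "\<not> ?thesis"
  \<comment> \<open>The sums of m(t)t with all multiplicities m(t) \<le> j. Adding an element of
    \<open>T\<close> raises one multiplicity by one, and counting multiplicities bounds the size by
    (j + 1)^|T|.\<close>
  define E where "E j = (\<lambda>m. \<Sum>t\<in>T. ((+) t ^^ m t) 0) ` (T \<rightarrow>\<^sub>E {..j})" for j :: nat
  have fin: "finite (E j)" for j using T by (auto simp: E_def intro!: finite_PiE)
  have funpow: "((+) t ^^ m) 0 \<in> H" if "t \<in> H" for t m
    using H that by (induction m) (auto simp: add_subgroup_def)
  have sumH: "(\<Sum>t\<in>T'. g t) \<in> H" if "finite T'" "\<And>t. t \<in> T' \<Longrightarrow> g t \<in> H" for g :: "'g \<Rightarrow> 'g" and T'
    using that H by (induction T' rule: finite_induct) (auto simp: add_subgroup_def)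
  have EH: "E j \<subseteq> H" for j
  proof -
    have "(\<Sum>t\<in>T. ((+) t ^^ m t) 0) \<in> H" for m
      by (rule sumH[OF T]) (use funpow H(2) in blast)
    then show ?thesis by (auto simp: E_def)
  qed
  have ne: "E j \<noteq> {}" for j by (auto simp: E_def PiE_eq_empty_iff)
  have step: "(\<lambda>(a, b). a + b) ` (E j \<times> T) \<subseteq> E (Suc j)" for j
  proof clarify
    fix a b assume a: "a \<in> E j" and b: "b \<in> T"
    then obtain m where m: "m \<in> T \<rightarrow>\<^sub>E {..j}" "a = (\<Sum>t\<in>T. ((+) t ^^ m t) 0)" by (auto simp: E_def)
    define m' where "m' = m(b := Suc (m b))"
    have "m' \<in> T \<rightarrow>\<^sub>E {..Suc j}" using m b by (auto simp: m'_def PiE_iff extensional_def le_Suc_eq)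
    moreover have "a + b = (\<Sum>t\<in>T. ((+) t ^^ m' t) 0)"
    proof -
      have "(\<Sum>t\<in>T - {b}. ((+) t ^^ m' t) 0) = (\<Sum>t\<in>T - {b}. ((+) t ^^ m t) 0)"
        by (intro sum.cong) (auto simp: m'_def)
      then show ?thesis
        using T b by (simp add: m(2) sum.remove[of T b] m'_def algebra_simps)
    qed
    ultimately show "a + b \<in> E (Suc j)" by (auto simp: E_def)
  qed
  \<comment> \<open>Under the contrary assumption every step from \<open>E j\<close> to
    \<open>E (Suc j)\<close> gains a factor \<open>c\<close>.\<close>
  have low: "c ^ j \<le> real (card (E j))" for j
  proof (induction j)
    case 0 then show ?case using ne[of 0] fin[of 0] by (simp add: Suc_le_eq card_gt_0_iff)
  next
    case (Suc j)
    have "c ^ Suc j \<le> c * real (card (E j))" using Suc c by simp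
    also have "\<dots> \<le> real (card ((\<lambda>(a, b). a + b) ` (E j \<times> T)))"
      using neg fin[of j] ne[of j] EH[of j] by (meson not_less)
    also have "\<dots> \<le> real (card (E (Suc j)))" using card_mono[OF fin step] by simp
    finally show ?case .
  qed
  have up: "real (card (E j)) \<le> real (Suc j) ^ card T" for j
  proof -
    have "card (E j) \<le> card (T \<rightarrow>\<^sub>E {..j})" unfolding E_def using T by (intro card_image_le finite_PiE) auto
    also have "\<dots> = Suc j ^ card T" using T by (simp add: card_PiE)
    finally show ?thesis by (metis of_nat_le_iff of_nat_power)
  qed
  have "(\<lambda>j. real (Suc j) ^ card T / c ^ j) \<longlonglongrightarrow> 0" using c by real_asymp
  then have "eventually (\<lambda>j. real (Suc j) ^ card T / c ^ j < 1) sequentially"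
    by (rule order_tendstoD) simp
  then obtain j where "real (Suc j) ^ card T / c ^ j < 1" by (auto simp: eventually_sequentially)
  then show False using low[of j] up[of j] c by (simp add: field_simps)
qed

text \<open>The substitution s = e - t. It turns a coefficient of a product into a linear equation
  in the values of the second factor on \<open>S\<close>.\<close>

lemma sum_reflect:
  fixes \<theta> h :: "'g::ab_group_add \<Rightarrow> complex"
  assumes "finite S" "finite T" "supp \<theta> \<subseteq> T" "supp h \<subseteq> S"
  shows "(\<Sum>t\<in>T. \<theta> t * h (e - t)) = (\<Sum>s\<in>S. \<theta> (e - s) * h s)"
  by (rule sum.reindex_bij_witness_not_neutral[where i = "\<lambda>s. e - s" and j = "\<lambda>t. e - t"
        and S' = "{t\<in>T. \<theta> t * h (e - t) = 0}" and T' = "{s\<in>S. \<theta> (e - s) * h s = 0}"])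
     (use assms in \<open>auto simp: supp_def\<close>)

lemma add_subgroup_diff: "add_subgroup H \<Longrightarrow> x \<in> H \<Longrightarrow> y \<in> H \<Longrightarrow> x - y \<in> H"
  unfolding add_subgroup_def by (metis add_uminus_conv_diff)

text \<open>Pigeonhole over the cosets of \<open>K\<close>. The representative is taken in
  \<open>P\<close> itself: in the application \<open>P\<close> lies in \<open>H\<close>, so
  translating that coset onto \<open>K\<close> does not leave the group ring of
  \<open>H\<close>.\<close>

lemma popular_coset:
  assumes K: "add_subgroup K" "finite_index K" and P: "finite P" "P \<noteq> {}"
  defines "d \<equiv> card (range (\<lambda>g. (+) g ` K))"
  shows "\<exists>p\<in>P. card P \<le> d * card (P \<inter> (+) p ` K)"
proof (rule ccontr)
  assume neg: "\<not> ?thesis"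
  define Q where "Q = range (\<lambda>g. (+) g ` K)"
  have Q: "finite Q" using K by (simp add: Q_def finite_index_def)
  have coset_eq: "(+) g ` K = (+) p ` K" if p: "p \<in> (+) g ` K" for g p
  proof -
    obtain k where k: "k \<in> K" "p = g + k" using p by auto
    have "g + x \<in> (+) p ` K" if "x \<in> K" for x
      using k that add_subgroup_diff[OF K(1)] by (intro image_eqI[of _ _ "x - k"]) auto
    moreover have "p + x \<in> (+) g ` K" if "x \<in> K" for x
      using k that K(1) by (intro image_eqI[of _ _ "k + x"]) (auto simp: add_subgroup_def add.assoc)
    ultimately show ?thesis by blast
  qed
  have pos: "0 < card P" using P by (simp add: card_gt_0_iff)
  have lt: "d * card (P \<inter> C) < card P" if C: "C \<in> Q" for C
  proof (cases "P \<inter> C = {}")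
    case False
    then obtain p where "p \<in> P" "p \<in> C" by blast
    moreover obtain g where "C = (+) g ` K" using C by (auto simp: Q_def)
    ultimately have "C = (+) p ` K" using coset_eq by blast
    then show ?thesis using neg \<open>p \<in> P\<close> by (meson not_le)
  qed (use pos in simp)
  have "P \<subseteq> (\<Union>C\<in>Q. P \<inter> C)"
  proof
    fix x assume "x \<in> P"
    moreover have "x \<in> (+) x ` K" using K(1) by (auto simp: add_subgroup_def intro: image_eqI[of _ _ 0])
    ultimately show "x \<in> (\<Union>C\<in>Q. P \<inter> C)" by (auto simp: Q_def)
  qed
  then have "card P \<le> card (\<Union>C\<in>Q. P \<inter> C)" using P Q by (intro card_mono) auto
  also have "\<dots> \<le> (\<Sum>C\<in>Q. card (P \<inter> C))" by (rule card_UN_le[OF Q])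
  finally have "d * card P \<le> (\<Sum>C\<in>Q. d * card (P \<inter> C))" by (simp add: sum_distrib_left[symmetric])
  also have "\<dots> < (\<Sum>C\<in>Q. card P)"
    by (rule sum_strict_mono[OF Q]) (use lt in \<open>auto simp: Q_def\<close>)
  also have "\<dots> = d * card P" by (simp add: d_def Q_def)
  finally show False by simp
qed

text \<open>Choose \<open>S\<close> with \<open>S + supp \<theta>\<close> only slightly larger than \<open>S\<close>. The condition that
  \<open>\<theta>\<beta>\<close> vanishes off one well-populated coset of \<open>K\<close> then gives fewer linear equations than
  there are unknowns \<open>\<beta>(s)\<close>, \<open>s \<in> S\<close>.\<close>

lemma non_zerodivisor_multiple_supported_in:
  assumes H: "add_subgroup H" and K: "add_subgroup K" "finite_index K"
    and \<theta>: "\<theta> \<in> group_ring H" "non_zerodivisor H \<theta>"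
  shows "\<exists>\<beta>\<in>group_ring H. gr_mult \<theta> \<beta> \<noteq> (\<lambda>_. 0) \<and> supp (gr_mult \<theta> \<beta>) \<subseteq> K"
proof -
  define T where "T = supp \<theta>"
  have T: "finite T" "T \<subseteq> H" using \<theta> by (auto simp: T_def group_ring_def)
  define d where "d = card (range (\<lambda>g. (+) g ` K))"
  have d: "0 < d" using K by (simp add: d_def finite_index_def card_gt_0_iff)
  \<comment> \<open>The ratio is chosen because (1 - 1/d)(1 + 1/d) < 1: there is one equation for
    each point of S + T outside a popular coset, and these are at most the fraction 1 - 1/d of S +
    T.\<close>
  obtain S where S: "finite S" "S \<noteq> {}" "S \<subseteq> H"
    and small: "real (card ((\<lambda>(a, b). a + b) ` (S \<times> T))) < (1 + 1 / d) * real (card S)"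
    using finite_set_small_sumset[OF T(1) _ H T(2), of "1 + 1 / d"] d by auto
  define P where "P = (\<lambda>(a, b). a + b) ` (S \<times> T)"
  have P: "finite P" using S T by (simp add: P_def)
  \<comment> \<open>If \<theta> were 0, it would annihilate the unit of the group ring, which is the
    indicator function of 0.\<close>
  have "T \<noteq> {}"
  proof
    assume "T = {}"
    then have "gr_mult \<theta> (\<lambda>x. if x = 0 then 1 else 0) = (\<lambda>_. 0)" by (auto simp: gr_mult_def T_def)
    moreover have "(\<lambda>x. if x = 0 then 1 else 0) \<in> group_ring H"
      using H by (auto simp: group_ring_def supp_def add_subgroup_def)
    moreover have "(\<lambda>x::'a. if x = 0 then 1 else 0) \<noteq> (\<lambda>_. 0::complex)" by (metis zero_neq_one)
    ultimately show False using \<theta>(2) unfolding non_zerodivisor_def by blast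
  qed
  then have "P \<noteq> {}" using S by (auto simp: P_def)
  then obtain p where p: "p \<in> P" "card P \<le> d * card (P \<inter> (+) p ` K)"
    using popular_coset[OF K P] d_def by blast
  have pH: "p \<in> H" using p S T H by (auto simp: P_def add_subgroup_def)
  define E where "E = P - (+) p ` K"
  have "real (card E) = real (card P) - real (card (P \<inter> (+) p ` K))"
    unfolding E_def using P card_Diff_subset_Int[of P "(+) p ` K"] card_mono[of P "P \<inter> (+) p ` K"]
    by (simp add: of_nat_diff)
  also have "\<dots> \<le> (1 - 1 / d) * real (card P)"
  proof -
    have "real (card P) \<le> d * real (card (P \<inter> (+) p ` K))" using p(2) by (metis of_nat_le_iff of_nat_mult)
    then show ?thesis using d by (simp add: field_simps)
  qed
  also have "\<dots> \<le> (1 - 1 / d) * ((1 + 1 / d) * real (card S))"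
    using small d by (intro mult_left_mono) (auto simp: P_def)
  also have "\<dots> = (1 - 1 / d ^ 2) * real (card S)" using d by (simp add: power2_eq_square field_simps)
  also have "\<dots> < 1 * real (card S)"
    using d S by (intro mult_strict_right_mono) (auto simp: card_gt_0_iff)
  finally have "card E < card S" by simp
  then obtain h where h: "\<exists>s\<in>S. h s \<noteq> 0" "\<forall>s. s \<notin> S \<longrightarrow> h s = 0"
    "\<forall>e\<in>E. (\<Sum>s\<in>S. \<theta> (e - s) * h s) = 0"
    using underdetermined_system_solution[of E S "\<lambda>e s. \<theta> (e - s)"] P S by (auto simp: E_def)
  \<comment> \<open>The product of \<theta> and \<open>h\<close> lives on \<open>P\<close> and
    vanishes on \<open>E\<close>, hence lives on p + K; the translation by \<open>p\<close> moves it
    into \<open>K\<close>.\<close>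
  define \<beta> where "\<beta> x = h (x + p)" for x
  have sub: "supp \<beta> \<subseteq> (\<lambda>s. s - p) ` S"
  proof
    fix x assume "x \<in> supp \<beta>"
    then have "x + p \<in> S" using h(2) by (auto simp: supp_def \<beta>_def)
    then show "x \<in> (\<lambda>s. s - p) ` S" by (intro image_eqI[of _ _ "x + p"]) auto
  qed
  have "\<beta> \<in> group_ring H"
    using sub S pH add_subgroup_diff[OF H] finite_subset[OF sub] by (auto simp: group_ring_def)
  moreover have "\<beta> \<noteq> (\<lambda>_. 0)"
  proof
    assume "\<beta> = (\<lambda>_. 0)"
    then have "\<beta> (s - p) = 0" for s by simp
    then have "h s = 0" for s by (simp add: \<beta>_def)
    then show False using h(1) by blast
  qed
  moreover have "g \<in> K" if g: "gr_mult \<theta> \<beta> g \<noteq> 0" for g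
  proof -
    have "gr_mult \<theta> \<beta> g = (\<Sum>t\<in>T. \<theta> t * h (g + p - t))"
      by (simp add: gr_mult_def \<beta>_def T_def algebra_simps)
    also have "\<dots> = (\<Sum>s\<in>S. \<theta> (g + p - s) * h s)"
      using h(2) S T by (intro sum_reflect) (auto simp: T_def supp_def)
    finally have "g + p \<notin> E" using g h(3) by auto
    moreover have "g + p \<in> P"
    proof -
      obtain a b where ab: "a \<in> T" "b \<in> supp \<beta>" "g = a + b"
        using gr_mult_nonzero_imp_sum[OF g] by (auto simp: T_def)
      then have "b + p \<in> S" using h(2) by (auto simp: supp_def \<beta>_def)
      then show ?thesis using ab unfolding P_def by (intro image_eqI[of _ _ "(b + p, a)"]) (auto simp: algebra_simps)
    qed
    ultimately show ?thesis by (auto simp: E_def add.commute)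
  qed
  ultimately show ?thesis using \<theta>(2) unfolding non_zerodivisor_def supp_def by blast
qed

section \<open>Leading terms and torsion-free subgroups\<close>

text \<open>Each pair of distinct points forbids one hyperplane of directions, and finitely many
  hyperplanes form a null set.\<close>

lemma exists_separating_vector:
  fixes A :: "'a::euclidean_space set"
  assumes "finite A"
  shows "\<exists>v. inj_on (\<lambda>a. a \<bullet> v) A"
proof (rule ccontr)
  assume neg: "\<not> ?thesis"
  define \<H> where "\<H> = (\<lambda>(a, b). {v. (a - b) \<bullet> v = 0}) ` {(a, b) \<in> A \<times> A. a \<noteq> b}"
  have "finite {(a, b) \<in> A \<times> A. a \<noteq> b}" by (rule finite_subset[of _ "A \<times> A"]) (use assms in auto)
  then have "negligible (\<Union> \<H>)"
    by (intro negligible_Union) (auto simp: \<H>_def negligible_hyperplane)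
  moreover have "\<Union> \<H> = UNIV"
    using neg by (auto simp: \<H>_def inj_on_def inner_diff_left)
  ultimately show False using non_negligible_UNIV by simp
qed

text \<open>A functional that is injective on both supports has a unique maximum on each of them.
  The sum \<open>a + b\<close> of the two maximisers then arises from a single pair, with
  coefficient \<theta>(a)\<beta>(b). Injectivity of \<kappa> is a condition on \<open>H\<close>
  only, because \<kappa> will involve a multiplication by an integer, which may kill torsion
  elements outside \<open>H\<close>.\<close>

lemma non_zerodivisor_if_embeds:
  fixes \<kappa> :: "'g::ab_group_add \<Rightarrow> 'a::euclidean_space"
  assumes H: "add_subgroup H" and \<theta>: "\<theta> \<in> group_ring H" "\<theta> \<noteq> (\<lambda>_. 0)"
    and add: "\<And>x y. \<kappa> (x + y) = \<kappa> x + \<kappa> y" and inj: "inj_on \<kappa> H"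
  shows "non_zerodivisor H \<theta>"
  unfolding non_zerodivisor_def
proof (intro ballI impI)
  fix \<beta> assume \<beta>: "\<beta> \<in> group_ring H" "\<beta> \<noteq> (\<lambda>_. 0)"
  obtain v where v: "inj_on (\<lambda>a. a \<bullet> v) (\<kappa> ` (supp \<theta> \<union> supp \<beta>))"
    using exists_separating_vector[of "\<kappa> ` (supp \<theta> \<union> supp \<beta>)"] \<theta> \<beta> by (auto simp: group_ring_def)
  define w where "w x = \<kappa> x \<bullet> v" for x
  have diff: "w (a + b - c) = w a + w b - w c" for a b c
  proof -
    have "\<kappa> a + \<kappa> b = \<kappa> (a + b - c) + \<kappa> c" using add[of "a + b - c" c] add[of a b] by simp
    then have "(\<kappa> a + \<kappa> b) \<bullet> v = (\<kappa> (a + b - c) + \<kappa> c) \<bullet> v" by simp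
    then show ?thesis by (simp add: w_def inner_add_left)
  qed
  have winj: "x = y" if "w x = w y" "x \<in> supp \<theta> \<union> supp \<beta>" "y \<in> supp \<theta> \<union> supp \<beta>" for x y
  proof -
    have "\<kappa> x = \<kappa> y" using inj_onD[OF v, of "\<kappa> x" "\<kappa> y"] that by (auto simp: w_def)
    moreover have "x \<in> H" "y \<in> H" using that \<theta> \<beta> by (auto simp: group_ring_def)
    ultimately show ?thesis using inj by (auto dest: inj_onD)
  qed
  have max: "\<exists>x\<in>supp \<gamma>. \<forall>y\<in>supp \<gamma>. w y \<le> w x" if "\<gamma> \<in> group_ring H" "\<gamma> \<noteq> (\<lambda>_. 0)" for \<gamma>
  proof -
    have fin: "finite (w ` supp \<gamma>)" "w ` supp \<gamma> \<noteq> {}" using that by (auto simp: group_ring_def supp_def)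
    obtain x where "x \<in> supp \<gamma>" "w x = Max (w ` supp \<gamma>)" using Max_in[OF fin] by auto
    then show ?thesis using fin by (metis Max_ge imageI)
  qed
  obtain a where a: "a \<in> supp \<theta>" "\<And>y. y \<in> supp \<theta> \<Longrightarrow> w y \<le> w a" using max[OF \<theta>] by blast
  obtain b where b: "b \<in> supp \<beta>" "\<And>y. y \<in> supp \<beta> \<Longrightarrow> w y \<le> w b" using max[OF \<beta>] by blast
  have "gr_mult \<theta> \<beta> (a + b) = (\<Sum>h\<in>{a}. \<theta> h * \<beta> (a + b - h))"
    unfolding gr_mult_def
  proof (rule sum.mono_neutral_right)
    show "finite (supp \<theta>)" using \<theta> by (simp add: group_ring_def)
    show "{a} \<subseteq> supp \<theta>" using a by simp
    show "\<forall>h\<in>supp \<theta> - {a}. \<theta> h * \<beta> (a + b - h) = 0"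
    proof
      fix h assume h: "h \<in> supp \<theta> - {a}"
      then have "w h < w a" using a winj[of h a] by fastforce
      then have "w b < w (a + b - h)" by (simp add: diff)
      then have "a + b - h \<notin> supp \<beta>" using b(2) by force
      then show "\<theta> h * \<beta> (a + b - h) = 0" by (simp add: supp_def)
    qed
  qed
  then have "gr_mult \<theta> \<beta> (a + b) \<noteq> 0" using a b by (simp add: supp_def)
  then show "gr_mult \<theta> \<beta> \<noteq> (\<lambda>_. 0)" by metis
qed

lemma funpow_add_mult: "((+) x ^^ (m * n)) (0::'g::ab_group_add) = ((+) (((+) x ^^ m) 0) ^^ n) 0"
proof -
  have plus: "((+) x ^^ (i + j)) 0 = ((+) x ^^ i) 0 + ((+) x ^^ j) (0::'g)" for i j
    by (induction i) (auto simp: algebra_simps)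
  show ?thesis by (induction n) (auto simp: plus)
qed

lemma funpow_add_distrib: "((+) (x + y) ^^ n) (0::'g::ab_group_add) = ((+) x ^^ n) 0 + ((+) y ^^ n) 0"
  by (induction n) (auto simp: algebra_simps)

text \<open>Two of the d + 1 multiples 0, x, ..., dx lie in the same coset, so jx lies in
  \<open>K\<close> for some j between 1 and d. The factorial of d is divisible by every such j and
  does not depend on x.\<close>

lemma finite_index_multiple_in:
  assumes K: "add_subgroup K" "finite_index K"
  shows "\<exists>N>0. \<forall>x. ((+) x ^^ N) 0 \<in> K"
proof -
  define d where "d = card (range (\<lambda>g. (+) g ` K))"
  have memK: "((+) x ^^ n) 0 \<in> K" if "x \<in> K" for x n
    using K(1) that by (induction n) (auto simp: add_subgroup_def)
  have plus: "((+) x ^^ (i + j)) 0 = ((+) x ^^ i) 0 + ((+) x ^^ j) 0" for i j and x :: 'a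
    by (induction i) (auto simp: algebra_simps)
  have "((+) x ^^ fact d) 0 \<in> K" for x
  proof -
    define C where "C n = (+) (((+) x ^^ n) 0) ` K" for n
    have "\<not> inj_on C {..d}"
    proof
      assume "inj_on C {..d}"
      then have "card (C ` {..d}) = Suc d" by (simp add: card_image)
      moreover have "card (C ` {..d}) \<le> d"
        unfolding d_def C_def using K(2) by (intro card_mono) (auto simp: finite_index_def)
      ultimately show False by simp
    qed
    then obtain i j where ij: "i < j" "j \<le> d" "C i = C j"
      unfolding inj_on_def by (metis atMost_iff linorder_neqE_nat)
    have "((+) x ^^ j) 0 \<in> C j"
      unfolding C_def using K(1) by (intro image_eqI[of _ _ 0]) (auto simp: add_subgroup_def)
    then obtain k where k: "k \<in> K" "((+) x ^^ j) 0 = ((+) x ^^ i) 0 + k" using ij by (auto simp: C_def)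
    moreover have "((+) x ^^ j) 0 = ((+) x ^^ i) 0 + ((+) x ^^ (j - i)) 0"
      using plus[of i "j - i" x] ij by simp
    ultimately have "((+) x ^^ (j - i)) 0 \<in> K" by simp
    moreover have "(j - i) dvd fact d" using ij by (intro dvd_fact) auto
    ultimately show ?thesis by (metis dvdE funpow_add_mult memK)
  qed
  then show ?thesis by (intro exI[of _ "fact d"]) auto
qed

section \<open>The Gaussian and a Bessel inequality for the Fourier transform\<close>

lemma lborel_integral_prod:
  fixes f :: "'a::euclidean_space \<Rightarrow> real \<Rightarrow> complex"
  assumes "\<And>b. b \<in> Basis \<Longrightarrow> integrable lborel (f b)"
  shows "integrable lborel (\<lambda>x. \<Prod>b\<in>Basis. f b (x \<bullet> b))"
    and "(LINT x|lborel. (\<Prod>b\<in>Basis. f b (x \<bullet> b))) = (\<Prod>b\<in>Basis. LINT x|lborel. f b x)"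
proof -
  interpret product_sigma_finite "\<lambda>_::'a. lborel :: real measure" ..
  have [measurable]: "f b \<in> borel_measurable borel" if "b \<in> Basis" for b
    using borel_measurable_integrable[OF assms[OF that]] by simp
  have *: "(\<Prod>b\<in>Basis. f b ((\<Sum>b\<in>Basis. y b *\<^sub>R b) \<bullet> b)) = (\<Prod>b\<in>Basis. f b (y b))" for y
    by (intro prod.cong) auto
  have m: "(\<lambda>x::'a. \<Prod>b\<in>Basis. f b (x \<bullet> b)) \<in> borel_measurable borel" by measurable
  show "integrable lborel (\<lambda>x. \<Prod>b\<in>Basis. f b (x \<bullet> b))"
    unfolding lborel_eq[where 'a='a]
    by (subst integrable_distr_eq) (use m in \<open>auto simp: * intro!: product_integrable_prod assms\<close>)
  show "(LINT x|lborel. (\<Prod>b\<in>Basis. f b (x \<bullet> b))) = (\<Prod>b\<in>Basis. LINT x|lborel. f b x)"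
    by (subst lborel_eq, subst integral_distr)
       (use m in \<open>auto simp: * intro!: product_integral_prod assms\<close>)
qed

lemma nn_integral_lborel_reflect:
  fixes f :: "'a::euclidean_space \<Rightarrow> ennreal"
  assumes [measurable]: "f \<in> borel_measurable borel"
  shows "(\<integral>\<^sup>+x. f (t - x) \<partial>lborel) = (\<integral>\<^sup>+x. f x \<partial>lborel)"
  by (subst (2) lborel_affine[of "-1" t]) (simp_all add: nn_integral_density nn_integral_distr)

lemma nn_integral_lborel_shift:
  fixes f :: "'a::euclidean_space \<Rightarrow> ennreal"
  assumes [measurable]: "f \<in> borel_measurable borel"
  shows "(\<integral>\<^sup>+x. f (x + t) \<partial>lborel) = (\<integral>\<^sup>+x. f x \<partial>lborel)"
  by (subst (2) lborel_affine[of 1 t]) (simp_all add: nn_integral_density nn_integral_distr add.commute)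

lemma cis_borel_measurable [measurable]: "cis \<in> borel_measurable borel"
  by (intro borel_measurable_continuous_onI continuous_intros)

lemma cnj_borel_measurable [measurable]: "cnj \<in> borel_measurable borel"
  by (intro borel_measurable_continuous_onI continuous_intros)

text \<open>The characteristic function of the standard normal distribution, rescaled by
  \<delta>.\<close>

lemma gaussian_fourier_real:
  fixes \<delta> t :: real
  assumes \<delta>: "0 < \<delta>"
  shows "integrable lborel (\<lambda>x. complex_of_real (exp (- (\<delta> * x)\<^sup>2 / 2)) * cis (t * x))"
    and "(LINT x|lborel. complex_of_real (exp (- (\<delta> * x)\<^sup>2 / 2)) * cis (t * x))
          = complex_of_real (sqrt (2 * pi) / \<delta> * exp (- (t / \<delta>)\<^sup>2 / 2))"
proof -
  define F where "F s x = complex_of_real (exp (- x\<^sup>2 / 2)) * cis (s * x)" for s x :: real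
  have ind: "integrable lborel (\<lambda>x. sqrt (2 * pi) * std_normal_density x)" by simp
  have [measurable]: "F s \<in> borel_measurable borel" for s unfolding F_def by measurable
  have F: "integrable lborel (F s)" for s
    by (rule Bochner_Integration.integrable_bound[OF ind])
       (auto simp: F_def std_normal_density_def norm_mult)
  have val: "(LINT x|lborel. F s x) = complex_of_real (sqrt (2 * pi) * exp (- s\<^sup>2 / 2))" for s
  proof -
    have "complex_of_real (exp (- s\<^sup>2 / 2)) = (LINT x|lborel. std_normal_density x *\<^sub>R iexp (s * x))"
      using fun_cong[OF char_std_normal_distribution, of s]
      by (simp add: char_def integral_density)
    also have "(\<lambda>x. std_normal_density x *\<^sub>R iexp (s * x)) = (\<lambda>x. F s x / sqrt (2 * pi))"
      by (auto simp: F_def std_normal_density_def cis_conv_exp scaleR_conv_of_real)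
    finally show ?thesis by simp
  qed
  have eq: "complex_of_real (exp (- (\<delta> * x)\<^sup>2 / 2)) * cis (t * x) = F (t / \<delta>) (0 + \<delta> * x)" for x
    using \<delta> by (simp add: F_def)
  show "integrable lborel (\<lambda>x. complex_of_real (exp (- (\<delta> * x)\<^sup>2 / 2)) * cis (t * x))"
    unfolding eq by (rule lborel_integrable_real_affine[OF F]) (use \<delta> in simp)
  have "(LINT x|lborel. F (t / \<delta>) x) = \<bar>\<delta>\<bar> *\<^sub>R (LINT x|lborel. F (t / \<delta>) (0 + \<delta> * x))"
    by (rule lborel_integral_real_affine) (use \<delta> in simp)
  then show "(LINT x|lborel. complex_of_real (exp (- (\<delta> * x)\<^sup>2 / 2)) * cis (t * x))
          = complex_of_real (sqrt (2 * pi) / \<delta> * exp (- (t / \<delta>)\<^sup>2 / 2))"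
    unfolding eq using \<delta> val[of "t / \<delta>"] by (simp add: scaleR_conv_of_real field_simps)
qed

text \<open>This is exp(-\<delta>^2|x|^2/2), kept as a product over the coordinates so that its
  integrals factor into one-dimensional ones.\<close>

definition gauss :: "real \<Rightarrow> 'a::euclidean_space \<Rightarrow> real" where
  "gauss \<delta> x = (\<Prod>b\<in>Basis. exp (- (\<delta> * (x \<bullet> b))\<^sup>2 / 2))"

text \<open>The Fourier transform of \<open>gauss \<delta>\<close> for positive \<delta>: a Gaussian
  that concentrates at 0 as \<delta> tends to 0.\<close>

definition gauss_hat :: "real \<Rightarrow> 'a::euclidean_space \<Rightarrow> real" where
  "gauss_hat \<delta> t = (\<Prod>b\<in>Basis. sqrt (2 * pi) / \<delta> * exp (- ((t \<bullet> b) / \<delta>)\<^sup>2 / 2))"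

lemma gauss_measurable [measurable]: "gauss \<delta> \<in> borel_measurable borel"
  unfolding gauss_def[abs_def] by measurable

lemma gauss_hat_measurable [measurable]: "gauss_hat \<delta> \<in> borel_measurable borel"
  unfolding gauss_hat_def[abs_def] by measurable

lemma gauss_nonneg: "0 \<le> gauss \<delta> x"
  by (auto simp: gauss_def intro!: prod_nonneg)

lemma gauss_hat_nonneg: "0 < \<delta> \<Longrightarrow> 0 \<le> gauss_hat \<delta> x"
  by (auto simp: gauss_hat_def intro!: prod_nonneg)

lemma cis_inner: "cis (x \<bullet> t) = (\<Prod>b\<in>Basis. cis ((t \<bullet> b) * (x \<bullet> b)))"
proof -
  have "cis (\<Sum>b\<in>B. (t \<bullet> b) * (x \<bullet> b)) = (\<Prod>b\<in>B. cis ((t \<bullet> b) * (x \<bullet> b)))" if "finite B" for B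
    using that by (induction B rule: finite_induct) (auto simp: cis_mult[symmetric])
  then show ?thesis by (simp add: euclidean_inner[of x t] mult.commute)
qed

lemma gauss_fourier:
  fixes t :: "'a::euclidean_space"
  assumes "0 < \<delta>"
  shows "integrable lborel (\<lambda>x. complex_of_real (gauss \<delta> x) * cis (x \<bullet> t))"
    and "(LINT x|lborel. complex_of_real (gauss \<delta> x) * cis (x \<bullet> t)) = complex_of_real (gauss_hat \<delta> t)"
proof -
  have eq: "complex_of_real (gauss \<delta> x) * cis (x \<bullet> t) =
      (\<Prod>b\<in>Basis. complex_of_real (exp (- (\<delta> * (x \<bullet> b))\<^sup>2 / 2)) * cis ((t \<bullet> b) * (x \<bullet> b)))" for x
    by (simp add: gauss_def cis_inner prod.distrib)
  show "integrable lborel (\<lambda>x. complex_of_real (gauss \<delta> x) * cis (x \<bullet> t))"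
    unfolding eq
    by (rule lborel_integral_prod(1)[where f = "\<lambda>b y. complex_of_real (exp (- (\<delta> * y)\<^sup>2 / 2)) * cis ((t \<bullet> b) * y)"])
       (rule gaussian_fourier_real[OF assms])
  show "(LINT x|lborel. complex_of_real (gauss \<delta> x) * cis (x \<bullet> t)) = complex_of_real (gauss_hat \<delta> t)"
    unfolding eq
    by (subst lborel_integral_prod(2)[where f = "\<lambda>b y. complex_of_real (exp (- (\<delta> * y)\<^sup>2 / 2)) * cis ((t \<bullet> b) * y)"])
       (simp_all only: gaussian_fourier_real[OF assms] gauss_hat_def of_real_prod)
qed

lemma gauss_integrable: "0 < \<delta> \<Longrightarrow> integrable lborel (gauss \<delta> :: 'a::euclidean_space \<Rightarrow> real)"
  using gauss_fourier(1)[of \<delta> "0::'a"] by (simp add: complex_of_real_integrable_eq)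

text \<open>Each factor is again a one-dimensional Gaussian integral, namely
  \<open>gaussian_fourier_real\<close> at frequency 0 with 1/\<delta> in place of \<delta>.\<close>

lemma gauss_hat_total:
  assumes \<delta>: "0 < \<delta>"
  shows "(\<integral>\<^sup>+t. ennreal (gauss_hat \<delta> t) \<partial>(lborel::'a::euclidean_space measure)) = ennreal ((2 * pi) ^ DIM('a))"
proof -
  have "(\<integral>\<^sup>+t. ennreal (gauss_hat \<delta> t) \<partial>(lborel::'a measure)) =
    (\<integral>\<^sup>+t. (\<Prod>b\<in>Basis. ennreal (sqrt (2 * pi) / \<delta> * exp (- ((t \<bullet> b) / \<delta>)\<^sup>2 / 2))) \<partial>(lborel::'a measure))"
    unfolding gauss_hat_def by (subst prod_ennreal) (use \<delta> in auto)
  also have "\<dots> = (\<Prod>b\<in>(Basis::'a set). (\<integral>\<^sup>+y. ennreal (sqrt (2 * pi) / \<delta> * exp (- (y / \<delta>)\<^sup>2 / 2)) \<partial>lborel))"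
    by (rule nn_integral_lborel_prod[where f = "\<lambda>b y. ennreal (sqrt (2 * pi) / \<delta> * exp (- (y / \<delta>)\<^sup>2 / 2))"]) auto
  also have "(\<integral>\<^sup>+y. ennreal (sqrt (2 * pi) / \<delta> * exp (- (y / \<delta>)\<^sup>2 / 2)) \<partial>lborel) = ennreal (2 * pi)"
  proof -
    have e: "inverse \<delta> * x = x / \<delta>" for x by (simp add: divide_inverse mult.commute)
    have "0 < inverse \<delta>" using \<delta> by simp
    note g = gaussian_fourier_real[OF this, of 0, unfolded e]
    have int: "integrable lborel (\<lambda>x. exp (- (x / \<delta>)\<^sup>2 / 2))"
      using g(1) unfolding mult_zero_left cis_zero mult_1_right complex_of_real_integrable_eq .
    have "complex_of_real (LINT x|lborel. exp (- (x / \<delta>)\<^sup>2 / 2)) = complex_of_real (sqrt (2 * pi) / inverse \<delta> * exp (- (0 / inverse \<delta>)\<^sup>2 / 2))"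
      using g(2) unfolding mult_zero_left cis_zero mult_1_right integral_complex_of_real .
    also have "\<dots> = complex_of_real (sqrt (2 * pi) * \<delta>)"
      by (simp only: divide_inverse inverse_inverse_eq mult_zero_left zero_power2 minus_zero exp_zero mult_1_right)
    finally have "complex_of_real (LINT x|lborel. exp (- (x / \<delta>)\<^sup>2 / 2)) = complex_of_real (sqrt (2 * pi) * \<delta>)" .
    then have "(LINT x|lborel. exp (- (x / \<delta>)\<^sup>2 / 2)) = sqrt (2 * pi) * \<delta>" by (simp only: of_real_eq_iff)
    then show ?thesis
      by (subst nn_integral_eq_integral) (use int \<delta> real_sqrt_mult_self[of "2 * pi"] in \<open>auto simp: mult.assoc simp del: real_sqrt_mult_self\<close>)
  qed
  also have "(\<Prod>b\<in>(Basis::'a set). ennreal (2 * pi)) = ennreal ((2 * pi) ^ DIM('a))"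
    by (simp add: ennreal_power)
  finally show ?thesis .
qed

text \<open>The exponent has a positive sign and there is no normalising factor. Thus a shift of x
  by s corresponds to the multiplier cis(s\<bullet>\<xi>), and the constant in the Bessel inequality
  is (2\<pi>)^n.\<close>

definition fourier :: "('a::euclidean_space \<Rightarrow> complex) \<Rightarrow> 'a \<Rightarrow> complex" where
  "fourier \<phi> x = (LINT \<xi>|lborel. \<phi> \<xi> * cis (x \<bullet> \<xi>))"

lemma integrable_mult_cis:
  fixes \<phi> :: "'a::euclidean_space \<Rightarrow> complex"
  assumes "integrable lborel \<phi>"
  shows "integrable lborel (\<lambda>\<xi>. \<phi> \<xi> * cis (x \<bullet> \<xi>))"
proof -
  have [measurable]: "\<phi> \<in> borel_measurable borel" using borel_measurable_integrable[OF assms] by simp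
  show ?thesis by (rule Bochner_Integration.integrable_bound[OF assms]) (auto simp: norm_mult)
qed

lemma fourier_measurable:
  fixes \<phi> :: "'a::euclidean_space \<Rightarrow> complex"
  assumes [measurable]: "\<phi> \<in> borel_measurable borel"
  shows "fourier \<phi> \<in> borel_measurable borel"
  unfolding fourier_def[abs_def] by measurable

lemma norm_fourier_le:
  assumes "integrable lborel \<phi>"
  shows "norm (fourier \<phi> x) \<le> (LINT \<xi>|lborel. norm (\<phi> \<xi>))"
  unfolding fourier_def
  by (rule order_trans[OF integral_norm_bound]) (simp add: norm_mult)

lemma integrable_lborel_pair_bound:
  fixes f :: "'a::euclidean_space \<times> 'b::euclidean_space \<Rightarrow> complex"
  assumes u: "integrable lborel (u::'a \<Rightarrow> real)" and w: "integrable lborel (w::'b \<Rightarrow> real)"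
    and [measurable]: "f \<in> borel_measurable (borel \<Otimes>\<^sub>M borel)"
    and le: "\<And>x y. norm (f (x, y)) \<le> u x * w y"
  shows "integrable (lborel \<Otimes>\<^sub>M lborel) f"
proof -
  have "integrable (lborel \<Otimes>\<^sub>M lborel) (\<lambda>(x, y). u x * w y)"
    by (rule lborel_pair.Fubini_integrable)
       (use u w borel_measurable_integrable[OF u] borel_measurable_integrable[OF w] in \<open>auto simp: abs_mult\<close>)
  then show ?thesis
    by (rule Bochner_Integration.integrable_bound) (auto simp: order_trans[OF le abs_ge_self])
qed

text \<open>The Gaussian regularises the integral of \<open>|fourier \<phi>|\<^sup>2\<close>; by Fubini it becomes a quadratic
  form in \<open>\<phi>\<close> with kernel \<open>gauss_hat \<delta> (\<xi> - \<eta>)\<close>, whose row integrals do not depend on \<open>\<delta>\<close>.\<close>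

lemma fourier_gauss_weighted:
  fixes \<phi> :: "'a::euclidean_space \<Rightarrow> complex"
  assumes \<phi>: "integrable lborel \<phi>" and \<delta>: "0 < \<delta>"
  shows "(\<integral>\<^sup>+x. ennreal (gauss \<delta> x * (norm (fourier \<phi> x))\<^sup>2) \<partial>lborel)
      \<le> ennreal ((2 * pi) ^ DIM('a)) * (\<integral>\<^sup>+\<xi>. ennreal ((norm (\<phi> \<xi>))\<^sup>2) \<partial>lborel)"
proof -
  have [measurable]: "\<phi> \<in> borel_measurable borel" using borel_measurable_integrable[OF \<phi>] by simp
  have [measurable]: "fourier \<phi> \<in> borel_measurable borel" by (rule fourier_measurable) simp
  define B where "B = (LINT \<xi>|lborel. norm (\<phi> \<xi>))"
  have B: "norm (fourier \<phi> x) \<le> B" for x unfolding B_def by (rule norm_fourier_le[OF \<phi>])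
  have B0: "0 \<le> B" by (rule order_trans[OF norm_ge_zero B])
  have g: "integrable lborel (gauss \<delta> :: 'a \<Rightarrow> real)" by (rule gauss_integrable[OF \<delta>])
  have n\<phi>: "integrable lborel (\<lambda>\<xi>. norm (\<phi> \<xi>))" using \<phi> by simp
  \<comment> \<open>Integrating over x first turns the Gaussian into its transform at \<xi> -
    \<eta>.\<close>
  have inner: "(LINT x|lborel. gauss \<delta> x * cnj (fourier \<phi> x) * cis (x \<bullet> \<xi>))
      = (LINT \<eta>|lborel. cnj (\<phi> \<eta>) * gauss_hat \<delta> (\<xi> - \<eta>))" for \<xi>
  proof -
    have "integrable (lborel \<Otimes>\<^sub>M lborel) (\<lambda>(x, \<eta>). gauss \<delta> x * cis (x \<bullet> (\<xi> - \<eta>)) * cnj (\<phi> \<eta>))"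
      by (rule integrable_lborel_pair_bound[OF g n\<phi>])
         (auto simp: norm_mult gauss_nonneg)
    note sw = lborel_pair.Fubini_integral[OF this]
    have cj: "cnj (fourier \<phi> x) = (LINT \<eta>|lborel. cnj (\<phi> \<eta>) * cis (- (x \<bullet> \<eta>)))" for x
      unfolding fourier_def by (simp add: Bochner_Integration.integral_cnj[symmetric] cis_cnj)
    have "gauss \<delta> x * cnj (fourier \<phi> x) * cis (x \<bullet> \<xi>) =
        (LINT \<eta>|lborel. gauss \<delta> x * cis (x \<bullet> (\<xi> - \<eta>)) * cnj (\<phi> \<eta>))" for x
    proof -
      have "gauss \<delta> x * cnj (fourier \<phi> x) * cis (x \<bullet> \<xi>)
        = (gauss \<delta> x * cis (x \<bullet> \<xi>)) * (LINT \<eta>|lborel. cnj (\<phi> \<eta>) * cis (- (x \<bullet> \<eta>)))"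
        by (simp add: cj)
      also have "\<dots> = (LINT \<eta>|lborel. (gauss \<delta> x * cis (x \<bullet> \<xi>)) * (cnj (\<phi> \<eta>) * cis (- (x \<bullet> \<eta>))))"
        by (rule integral_mult_right_zero[symmetric])
      also have "\<dots> = (LINT \<eta>|lborel. gauss \<delta> x * cis (x \<bullet> (\<xi> - \<eta>)) * cnj (\<phi> \<eta>))"
      proof (rule Bochner_Integration.integral_cong[OF refl])
        fix \<eta>
        have "cis (x \<bullet> (\<xi> - \<eta>)) = cis (x \<bullet> \<xi>) * cis (- (x \<bullet> \<eta>))" by (simp add: inner_diff_right cis_mult)
        then show "(gauss \<delta> x * cis (x \<bullet> \<xi>)) * (cnj (\<phi> \<eta>) * cis (- (x \<bullet> \<eta>))) = gauss \<delta> x * cis (x \<bullet> (\<xi> - \<eta>)) * cnj (\<phi> \<eta>)"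
          by simp
      qed
      finally show ?thesis .
    qed
    then have "(LINT x|lborel. gauss \<delta> x * cnj (fourier \<phi> x) * cis (x \<bullet> \<xi>))
      = (LINT \<eta>|lborel. LINT x|lborel. gauss \<delta> x * cis (x \<bullet> (\<xi> - \<eta>)) * cnj (\<phi> \<eta>))"
      using sw by simp
    also have "\<dots> = (LINT \<eta>|lborel. cnj (\<phi> \<eta>) * gauss_hat \<delta> (\<xi> - \<eta>))"
      by (simp add: gauss_fourier[OF \<delta>] mult.commute)
    finally show ?thesis .
  qed
  have le: "norm (gauss \<delta> x * cnj (fourier \<phi> x) * cis (x \<bullet> \<xi>) * \<phi> \<xi>) \<le> (B * gauss \<delta> x) * norm (\<phi> \<xi>)" for x \<xi>
    using mult_left_mono[OF B[of x], of "gauss \<delta> x * norm (\<phi> \<xi>)"] by (simp add: norm_mult gauss_nonneg mult_ac)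
  have "integrable (lborel \<Otimes>\<^sub>M lborel) (\<lambda>(x, \<xi>). gauss \<delta> x * cnj (fourier \<phi> x) * cis (x \<bullet> \<xi>) * \<phi> \<xi>)"
    by (rule integrable_lborel_pair_bound[OF integrable_mult_right[OF g, of B] n\<phi>])
       (use le in auto)
  note sw = lborel_pair.Fubini_integral[OF this]
  have "complex_of_real (gauss \<delta> x * (norm (fourier \<phi> x))\<^sup>2) =
      (LINT \<xi>|lborel. gauss \<delta> x * cnj (fourier \<phi> x) * cis (x \<bullet> \<xi>) * \<phi> \<xi>)" for x
  proof -
    have "complex_of_real (gauss \<delta> x * (norm (fourier \<phi> x))\<^sup>2) =
      gauss \<delta> x * cnj (fourier \<phi> x) * (LINT \<xi>|lborel. \<phi> \<xi> * cis (x \<bullet> \<xi>))"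
      using complex_norm_square[of "fourier \<phi> x"] by (simp add: fourier_def mult_ac)
    then show ?thesis by (simp add: integral_mult_right_zero[symmetric] mult_ac)
  qed
  then have "complex_of_real (LINT x|lborel. gauss \<delta> x * (norm (fourier \<phi> x))\<^sup>2) =
    (LINT \<xi>|lborel. LINT x|lborel. gauss \<delta> x * cnj (fourier \<phi> x) * cis (x \<bullet> \<xi>) * \<phi> \<xi>)"
    using sw by (simp add: integral_complex_of_real[symmetric] del: integral_complex_of_real of_real_mult of_real_power)
  also have "\<dots> = (LINT \<xi>|lborel. \<phi> \<xi> * (LINT \<eta>|lborel. cnj (\<phi> \<eta>) * gauss_hat \<delta> (\<xi> - \<eta>)))"
    unfolding integral_mult_left_zero inner by (simp add: mult.commute)
  finally have eq: "complex_of_real (LINT x|lborel. gauss \<delta> x * (norm (fourier \<phi> x))\<^sup>2) =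
     (LINT \<xi>|lborel. \<phi> \<xi> * (LINT \<eta>|lborel. cnj (\<phi> \<eta>) * gauss_hat \<delta> (\<xi> - \<eta>)))" .
  \<comment> \<open>If \<open>u\<close> is not integrable, its integral has the default value 0 and
    the bound is trivial.\<close>
  have nb: "ennreal (norm (LINT x|M. u x)) \<le> (\<integral>\<^sup>+x. ennreal (norm (u x)) \<partial>M)" for M :: "'a measure" and u :: "'a \<Rightarrow> complex"
    by (cases "integrable M u") (auto simp: integral_norm_bound_ennreal not_integrable_integral_eq)
  have int: "integrable lborel (\<lambda>x. gauss \<delta> x * (norm (fourier \<phi> x))\<^sup>2)"
    by (rule Bochner_Integration.integrable_bound[OF integrable_mult_right[OF g, of "B\<^sup>2"]])
       (auto simp: abs_mult gauss_nonneg mult.commute intro!: mult_left_mono power_mono B)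
  have "(\<integral>\<^sup>+x. ennreal (gauss \<delta> x * (norm (fourier \<phi> x))\<^sup>2) \<partial>lborel) =
     ennreal (LINT x|lborel. gauss \<delta> x * (norm (fourier \<phi> x))\<^sup>2)"
    by (rule nn_integral_eq_integral[OF int]) (auto simp: gauss_nonneg)
  also have "\<dots> \<le> ennreal (norm (LINT \<xi>|lborel. \<phi> \<xi> * (LINT \<eta>|lborel. cnj (\<phi> \<eta>) * gauss_hat \<delta> (\<xi> - \<eta>))))"
    unfolding eq[symmetric] by (auto intro!: ennreal_leI)
  also have "\<dots> \<le> (\<integral>\<^sup>+\<xi>. ennreal (norm (\<phi> \<xi> * (LINT \<eta>|lborel. cnj (\<phi> \<eta>) * gauss_hat \<delta> (\<xi> - \<eta>)))) \<partial>lborel)"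
    by (rule nb)
  also have "\<dots> \<le> (\<integral>\<^sup>+\<xi>. (\<integral>\<^sup>+\<eta>. ennreal (norm (\<phi> \<xi>) * norm (\<phi> \<eta>) * gauss_hat \<delta> (\<xi> - \<eta>)) \<partial>lborel) \<partial>lborel)"
  proof (rule nn_integral_mono)
    fix \<xi> :: 'a
    have "ennreal (norm (\<phi> \<xi> * (LINT \<eta>|lborel. cnj (\<phi> \<eta>) * gauss_hat \<delta> (\<xi> - \<eta>))))
      = ennreal (norm (\<phi> \<xi>)) * ennreal (norm (LINT \<eta>|lborel. cnj (\<phi> \<eta>) * gauss_hat \<delta> (\<xi> - \<eta>)))"
      by (simp add: norm_mult ennreal_mult)
    also have "\<dots> \<le> ennreal (norm (\<phi> \<xi>)) * (\<integral>\<^sup>+\<eta>. ennreal (norm (cnj (\<phi> \<eta>) * gauss_hat \<delta> (\<xi> - \<eta>))) \<partial>lborel)"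
      by (intro mult_left_mono nb) auto
    also have "\<dots> = (\<integral>\<^sup>+\<eta>. ennreal (norm (\<phi> \<xi>) * norm (\<phi> \<eta>) * gauss_hat \<delta> (\<xi> - \<eta>)) \<partial>lborel)"
      by (subst nn_integral_cmult[symmetric])
         (auto simp: norm_mult ennreal_mult' gauss_hat_nonneg[OF \<delta>] mult.assoc)
    finally show "ennreal (norm (\<phi> \<xi> * (LINT \<eta>|lborel. cnj (\<phi> \<eta>) * gauss_hat \<delta> (\<xi> - \<eta>))))
       \<le> (\<integral>\<^sup>+\<eta>. ennreal (norm (\<phi> \<xi>) * norm (\<phi> \<eta>) * gauss_hat \<delta> (\<xi> - \<eta>)) \<partial>lborel)" .
  qed
  \<comment> \<open>Schur's test: the product is split by the inequality between arithmetic and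
    geometric mean, and in each half the kernel is then integrated over the variable that does not
    occur in \<phi>.\<close>
  also have "\<dots> \<le> (\<integral>\<^sup>+\<xi>. (\<integral>\<^sup>+\<eta>. ennreal ((norm (\<phi> \<xi>))\<^sup>2 / 2) * ennreal (gauss_hat \<delta> (\<xi> - \<eta>))
         + ennreal ((norm (\<phi> \<eta>))\<^sup>2 / 2) * ennreal (gauss_hat \<delta> (\<xi> - \<eta>)) \<partial>lborel) \<partial>lborel)"
  proof (intro nn_integral_mono)
    fix \<xi> \<eta> :: 'a
    have "norm (\<phi> \<xi>) * norm (\<phi> \<eta>) \<le> (norm (\<phi> \<xi>))\<^sup>2 / 2 + (norm (\<phi> \<eta>))\<^sup>2 / 2"
      using sum_squares_bound[of "norm (\<phi> \<xi>)" "norm (\<phi> \<eta>)"] by simp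
    then have "norm (\<phi> \<xi>) * norm (\<phi> \<eta>) * gauss_hat \<delta> (\<xi> - \<eta>) \<le>
      ((norm (\<phi> \<xi>))\<^sup>2 / 2 + (norm (\<phi> \<eta>))\<^sup>2 / 2) * gauss_hat \<delta> (\<xi> - \<eta>)"
      by (rule mult_right_mono) (rule gauss_hat_nonneg[OF \<delta>])
    then show "ennreal (norm (\<phi> \<xi>) * norm (\<phi> \<eta>) * gauss_hat \<delta> (\<xi> - \<eta>)) \<le>
      ennreal ((norm (\<phi> \<xi>))\<^sup>2 / 2) * ennreal (gauss_hat \<delta> (\<xi> - \<eta>)) + ennreal ((norm (\<phi> \<eta>))\<^sup>2 / 2) * ennreal (gauss_hat \<delta> (\<xi> - \<eta>))"
      using gauss_hat_nonneg[OF \<delta>, of "\<xi> - \<eta>"]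
      by (simp add: ennreal_mult[symmetric] ennreal_plus[symmetric] distrib_right ennreal_leI del: ennreal_plus)
  qed
  also have "\<dots> = (\<integral>\<^sup>+\<xi>. (\<integral>\<^sup>+\<eta>. ennreal ((norm (\<phi> \<xi>))\<^sup>2 / 2) * ennreal (gauss_hat \<delta> (\<xi> - \<eta>)) \<partial>lborel) \<partial>lborel)
     + (\<integral>\<^sup>+\<xi>. (\<integral>\<^sup>+\<eta>. ennreal ((norm (\<phi> \<eta>))\<^sup>2 / 2) * ennreal (gauss_hat \<delta> (\<xi> - \<eta>)) \<partial>lborel) \<partial>lborel)"
    by (simp add: nn_integral_add)
  also have "(\<integral>\<^sup>+\<xi>. (\<integral>\<^sup>+\<eta>. ennreal ((norm (\<phi> \<eta>))\<^sup>2 / 2) * ennreal (gauss_hat \<delta> (\<xi> - \<eta>)) \<partial>lborel) \<partial>lborel) =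
     (\<integral>\<^sup>+\<eta>. (\<integral>\<^sup>+\<xi>. ennreal ((norm (\<phi> \<eta>))\<^sup>2 / 2) * ennreal (gauss_hat \<delta> (\<xi> - \<eta>)) \<partial>lborel) \<partial>lborel)"
    by (rule lborel_pair.Fubini') simp
  also have "\<dots> = (\<integral>\<^sup>+\<eta>. ennreal ((norm (\<phi> \<eta>))\<^sup>2 / 2) * ennreal ((2 * pi) ^ DIM('a)) \<partial>lborel)"
    using nn_integral_lborel_shift[of "\<lambda>t::'a. ennreal (gauss_hat \<delta> t)" "- \<eta>" for \<eta>]
    by (simp add: nn_integral_cmult gauss_hat_total[OF \<delta>])
  also have "(\<integral>\<^sup>+\<xi>. (\<integral>\<^sup>+\<eta>. ennreal ((norm (\<phi> \<xi>))\<^sup>2 / 2) * ennreal (gauss_hat \<delta> (\<xi> - \<eta>)) \<partial>lborel) \<partial>lborel)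
     = (\<integral>\<^sup>+\<eta>. ennreal ((norm (\<phi> \<eta>))\<^sup>2 / 2) * ennreal ((2 * pi) ^ DIM('a)) \<partial>lborel)"
    using nn_integral_lborel_reflect[of "\<lambda>t::'a. ennreal (gauss_hat \<delta> t)"]
    by (simp add: nn_integral_cmult gauss_hat_total[OF \<delta>])
  also have "\<dots> + \<dots> = (\<integral>\<^sup>+\<eta>. ennreal ((2 * pi) ^ DIM('a)) * ennreal ((norm (\<phi> \<eta>))\<^sup>2) \<partial>lborel)"
  proof (subst nn_integral_add[symmetric])
    have "ennreal (y / 2) * c + ennreal (y / 2) * c = c * ennreal y" if "0 \<le> y" for y c
      using ennreal_plus[of "y / 2" "y / 2"] that by (metis distrib_right field_sum_of_halves half_gt_zero_iff le_less mult.commute zero_le_divide_iff zero_le_numeral)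
    then show "(\<integral>\<^sup>+x. ennreal ((norm (\<phi> x))\<^sup>2 / 2) * ennreal ((2 * pi) ^ DIM('a)) + ennreal ((norm (\<phi> x))\<^sup>2 / 2) * ennreal ((2 * pi) ^ DIM('a)) \<partial>lborel)
      = (\<integral>\<^sup>+\<eta>. ennreal ((2 * pi) ^ DIM('a)) * ennreal ((norm (\<phi> \<eta>))\<^sup>2) \<partial>lborel)" by simp
  qed simp_all
  also have "\<dots> = ennreal ((2 * pi) ^ DIM('a)) * (\<integral>\<^sup>+\<xi>. ennreal ((norm (\<phi> \<xi>))\<^sup>2) \<partial>lborel)"
    by (rule nn_integral_cmult) simp
  finally show ?thesis .
qed

text \<open>Fatou's lemma: with \<delta> = 1/(k + 1) the Gaussian factor tends to 1 pointwise, while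
  the bound stays the same.\<close>

lemma fourier_bessel:
  fixes \<phi> :: "'a::euclidean_space \<Rightarrow> complex"
  assumes \<phi>: "integrable lborel \<phi>"
  shows "(\<integral>\<^sup>+x. ennreal ((norm (fourier \<phi> x))\<^sup>2) \<partial>lborel)
      \<le> ennreal ((2 * pi) ^ DIM('a)) * (\<integral>\<^sup>+\<xi>. ennreal ((norm (\<phi> \<xi>))\<^sup>2) \<partial>lborel)" (is "_ \<le> ?R")
proof -
  have [measurable]: "\<phi> \<in> borel_measurable borel" using borel_measurable_integrable[OF \<phi>] by simp
  have [measurable]: "fourier \<phi> \<in> borel_measurable borel" by (rule fourier_measurable) simp
  define u where "u k x = ennreal (gauss (1 / real (Suc k)) x * (norm (fourier \<phi> x))\<^sup>2)" for k x
  have lim: "(\<lambda>k. u k x) \<longlonglongrightarrow> ennreal ((norm (fourier \<phi> x))\<^sup>2)" for x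
  proof -
    have "(\<lambda>k. exp (- (1 / real (Suc k) * c)\<^sup>2 / 2)) \<longlonglongrightarrow> exp (- (0 * c)\<^sup>2 / 2)" for c :: real
      by (intro tendsto_intros LIMSEQ_Suc lim_const_over_n) auto
    then have "(\<lambda>k. exp (- (1 / real (Suc k) * c)\<^sup>2 / 2)) \<longlonglongrightarrow> 1" for c :: real by simp
    then have "(\<lambda>k. gauss (1 / real (Suc k)) x) \<longlonglongrightarrow> (\<Prod>b\<in>(Basis::'a set). 1)"
      unfolding gauss_def by (intro tendsto_prod)
    then have "(\<lambda>k. gauss (1 / real (Suc k)) x * (norm (fourier \<phi> x))\<^sup>2) \<longlonglongrightarrow> 1 * (norm (fourier \<phi> x))\<^sup>2"
      by (intro tendsto_mult tendsto_const) simp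
    then show ?thesis unfolding u_def by (intro tendsto_ennrealI) simp
  qed
  have "(\<integral>\<^sup>+x. ennreal ((norm (fourier \<phi> x))\<^sup>2) \<partial>lborel) = (\<integral>\<^sup>+x. liminf (\<lambda>k. u k x) \<partial>lborel)"
    using lim_imp_Liminf[OF _ lim] by simp
  also have "\<dots> \<le> liminf (\<lambda>k. \<integral>\<^sup>+x. u k x \<partial>lborel)"
    by (rule nn_integral_liminf) (simp add: u_def)
  also have "\<dots> \<le> liminf (\<lambda>k::nat. ?R)"
    unfolding u_def by (intro Liminf_mono always_eventually allI fourier_gauss_weighted[OF \<phi>]) simp
  also have "\<dots> = ?R" by (simp add: Liminf_const)
  finally show ?thesis .
qed

section \<open>Lipschitz functions with bounded support\<close>

lemma lborel_integral_shift:
  fixes f :: "'a::euclidean_space \<Rightarrow> complex"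
  assumes [measurable]: "f \<in> borel_measurable borel"
  shows "(LINT x|lborel. f (x + t)) = (LINT x|lborel. f x)"
  by (subst lborel_distr_plus[of t, symmetric], subst integral_distr) (simp_all add: add.commute)

lemma lborel_integrable_shift:
  fixes f :: "'a::euclidean_space \<Rightarrow> complex"
  assumes "integrable lborel f"
  shows "integrable lborel (\<lambda>x. f (x + t))"
proof -
  have "integrable (distr lborel borel ((+) t)) f" using assms by (simp add: lborel_distr_plus)
  then show ?thesis by (subst (asm) integrable_distr_eq) (use borel_measurable_integrable[OF assms] in \<open>simp_all add: add.commute\<close>)
qed

lemma emeasure_lborel_shift:
  fixes A :: "'a::euclidean_space set"
  assumes [measurable]: "A \<in> sets borel"
  shows "emeasure lborel {x. x + t \<in> A} = emeasure lborel A"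
proof -
  have "emeasure lborel A = emeasure (distr lborel borel ((+) t)) A" by (simp add: lborel_distr_plus)
  also have "\<dots> = emeasure lborel ((+) t -` A)" by (subst emeasure_distr) auto
  also have "(+) t -` A = {x. x + t \<in> A}" by (auto simp: add.commute)
  finally show ?thesis by simp
qed

text \<open>The test functions on the frequency side. This class is closed under the two operations
  that occur, multiplication by a cutoff built from a distance function and division by F away from
  its zeros, and its transforms still have a finite second moment in L^2.\<close>

definition lip_cs :: "('a::euclidean_space \<Rightarrow> complex) \<Rightarrow> bool" where
  "lip_cs \<phi> \<longleftrightarrow> (\<exists>L. L-lipschitz_on UNIV \<phi>) \<and> bounded {\<xi>. \<phi> \<xi> \<noteq> 0}"

lemma lipschitz_measurable:
  fixes \<phi> :: "'a::euclidean_space \<Rightarrow> complex"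
  assumes "L-lipschitz_on UNIV \<phi>"
  shows "\<phi> \<in> borel_measurable borel"
  by (intro borel_measurable_continuous_onI lipschitz_on_continuous_on[OF assms])

lemma open_nonzero:
  fixes \<phi> :: "'a::euclidean_space \<Rightarrow> complex"
  assumes "L-lipschitz_on UNIV \<phi>"
  shows "open {\<xi>. \<phi> \<xi> \<noteq> 0}"
  using lipschitz_on_continuous_on[OF assms] by (intro open_Collect_neq continuous_on_const)

lemma integrable_bounded_support:
  fixes \<phi> :: "'a::euclidean_space \<Rightarrow> complex"
  assumes [measurable]: "\<phi> \<in> borel_measurable borel" and B: "\<And>\<xi>. norm (\<phi> \<xi>) \<le> B"
    and bdd: "bounded {\<xi>. \<phi> \<xi> \<noteq> 0}"
  shows "integrable lborel \<phi>"
proof -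
  have "{\<xi>. \<phi> \<xi> \<noteq> 0} \<in> sets lborel" by measurable
  moreover have "emeasure lborel {\<xi>. \<phi> \<xi> \<noteq> 0} < \<infinity>" by (rule emeasure_bounded_finite[OF bdd])
  ultimately have "integrable lborel (\<lambda>\<xi>. B * indicator {\<xi>. \<phi> \<xi> \<noteq> 0} \<xi>)" by simp
  then show ?thesis
    by (rule Bochner_Integration.integrable_bound)
       (auto simp: indicator_def intro!: AE_I2 order_trans[OF B])
qed

lemma lip_cs_bounded:
  fixes \<phi> :: "'a::euclidean_space \<Rightarrow> complex"
  assumes "lip_cs \<phi>"
  shows "\<exists>B>0. \<forall>\<xi>. norm (\<phi> \<xi>) \<le> B"
proof -
  obtain L where L: "L-lipschitz_on UNIV \<phi>" using assms by (auto simp: lip_cs_def)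
  have c: "compact (closure {\<xi>. \<phi> \<xi> \<noteq> 0})" using assms by (simp add: lip_cs_def compact_closure)
  have "bounded (\<phi> ` closure {\<xi>. \<phi> \<xi> \<noteq> 0})"
    by (intro compact_imp_bounded compact_continuous_image c continuous_on_subset[OF lipschitz_on_continuous_on[OF L]]) simp
  then obtain B where B: "0 < B" "\<And>\<xi>. \<xi> \<in> closure {\<xi>. \<phi> \<xi> \<noteq> 0} \<Longrightarrow> norm (\<phi> \<xi>) \<le> B"
    unfolding bounded_pos by blast
  have "norm (\<phi> \<xi>) \<le> B" for \<xi>
  proof (cases "\<phi> \<xi> = 0")
    case False
    then have "\<xi> \<in> closure {\<xi>. \<phi> \<xi> \<noteq> 0}" by (intro subsetD[OF closure_subset]) simp
    then show ?thesis by (rule B(2))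
  qed (use B in simp)
  then show ?thesis using B(1) by blast
qed

lemma lip_cs_integrable: "lip_cs \<phi> \<Longrightarrow> integrable lborel \<phi>"
  using lip_cs_bounded[of \<phi>] unfolding lip_cs_def
  by (auto intro: integrable_bounded_support lipschitz_measurable)

text \<open>The factor \<open>m\<close> is controlled only where \<phi> \<noteq> 0, as 1/F will be.
  If exactly one of two points lies in that set, the difference is estimated through \<phi> alone,
  since \<phi> vanishes at the other point.\<close>

lemma lipschitz_mult_on_support:
  fixes \<phi> m :: "'a::euclidean_space \<Rightarrow> complex"
  assumes \<phi>: "L-lipschitz_on UNIV \<phi>" "\<And>\<xi>. norm (\<phi> \<xi>) \<le> B"
    and m: "L'-lipschitz_on {\<xi>. \<phi> \<xi> \<noteq> 0} m" "\<And>\<xi>. \<phi> \<xi> \<noteq> 0 \<Longrightarrow> norm (m \<xi>) \<le> B'" and B': "0 \<le> B'"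
  shows "(B * L' + B' * L)-lipschitz_on UNIV (\<lambda>\<xi>. \<phi> \<xi> * m \<xi>)"
proof (rule lipschitz_onI)
  have L: "0 \<le> L" "0 \<le> L'" using \<phi> m lipschitz_on_nonneg by blast+
  have B: "0 \<le> B" using \<phi>(2) norm_ge_zero order_trans by blast
  show "0 \<le> B * L' + B' * L" using L B B' by simp
  have one: "norm (\<phi> x * m x - \<phi> y * m y) \<le> (B * L' + B' * L) * dist x y" if x: "\<phi> x \<noteq> 0" for x y
  proof (cases "\<phi> y = 0")
    case True
    have "norm (\<phi> x * m x - \<phi> y * m y) = norm (\<phi> x - \<phi> y) * norm (m x)" using True by (simp add: norm_mult)
    also have "\<dots> \<le> (L * dist x y) * B'"
      using lipschitz_onD[OF \<phi>(1), of x y] m(2)[OF x] L by (intro mult_mono) (auto simp: dist_norm)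
    also have "\<dots> = 0 + B' * L * dist x y" by simp
    also have "\<dots> \<le> B * L' * dist x y + B' * L * dist x y" using B L by (intro add_right_mono) simp
    also have "\<dots> = (B * L' + B' * L) * dist x y" by (simp add: distrib_right)
    finally show ?thesis .
  next
    case False
    have "\<phi> x * m x - \<phi> y * m y = (\<phi> x - \<phi> y) * m x + \<phi> y * (m x - m y)" by (simp add: algebra_simps)
    then have "norm (\<phi> x * m x - \<phi> y * m y) \<le> norm (\<phi> x - \<phi> y) * norm (m x) + norm (\<phi> y) * norm (m x - m y)"
      by (metis norm_mult norm_triangle_ineq)
    also have "\<dots> \<le> (L * dist x y) * B' + B * (L' * dist x y)"
      using lipschitz_onD[OF \<phi>(1), of x y] lipschitz_onD[OF m(1), of x y] m(2)[OF x] \<phi>(2)[of y] L B x False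
      by (intro add_mono mult_mono) (auto simp: dist_norm)
    also have "\<dots> = (B * L' + B' * L) * dist x y" by (simp add: algebra_simps)
    finally show ?thesis .
  qed
  show "dist (\<phi> x * m x) (\<phi> y * m y) \<le> (B * L' + B' * L) * dist x y" for x y
  proof (cases "\<phi> x = 0")
    case False then show ?thesis using one by (simp add: dist_norm)
  next
    case True
    show ?thesis
    proof (cases "\<phi> y = 0")
      case False then show ?thesis using one[of y x] by (simp add: dist_norm norm_minus_commute)
    next
      case T: True
      then show ?thesis using True L B B' by simp
    qed
  qed
qed

lemma lip_cs_mult:
  assumes \<phi>: "lip_cs \<phi>" and m: "L'-lipschitz_on {\<xi>. \<phi> \<xi> \<noteq> 0} m" "\<And>\<xi>. \<phi> \<xi> \<noteq> 0 \<Longrightarrow> norm (m \<xi>) \<le> B'"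
  shows "lip_cs (\<lambda>\<xi>. \<phi> \<xi> * m \<xi>)"
proof -
  obtain L B where "L-lipschitz_on UNIV \<phi>" "\<And>\<xi>. norm (\<phi> \<xi>) \<le> B"
    using \<phi> lip_cs_bounded[OF \<phi>] by (auto simp: lip_cs_def)
  \<comment> \<open>On an empty support the bound \<open>B'\<close> may be negative, hence the
    maximum with 0.\<close>
  then have "(B * L' + max 0 B' * L)-lipschitz_on UNIV (\<lambda>\<xi>. \<phi> \<xi> * m \<xi>)"
    by (rule lipschitz_mult_on_support[OF _ _ m(1)]) (use m(2) in \<open>auto simp: le_max_iff_disj\<close>)
  moreover have "bounded {\<xi>. \<phi> \<xi> * m \<xi> \<noteq> 0}"
    by (rule bounded_subset[of "{\<xi>. \<phi> \<xi> \<noteq> 0}"]) (use \<phi> in \<open>auto simp: lip_cs_def\<close>)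
  ultimately show ?thesis by (auto simp: lip_cs_def)
qed

section \<open>Decay of the transforms of Lipschitz functions\<close>

lemma norm_cis_minus_one_sq: "(norm (cis a - 1))\<^sup>2 = 4 * (sin (a / 2))\<^sup>2"
proof -
  have "(norm (cis a - 1))\<^sup>2 = (cos a - 1)\<^sup>2 + (sin a)\<^sup>2" by (simp add: cmod_power2)
  also have "\<dots> = 2 - 2 * cos a" using sin_cos_squared_add[of a] by (simp add: power2_eq_square algebra_simps)
  also have "cos a = 1 - 2 * (sin (a / 2))\<^sup>2" using cos_double_sin[of "a / 2"] by simp
  finally show ?thesis by simp
qed

lemma norm_cis_diff_le: "norm (cis a - cis b) \<le> \<bar>a - b\<bar>"
proof -
  have "cis a - cis b = cis b * (cis (a - b) - 1)" by (simp add: algebra_simps cis_mult)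
  then have "(norm (cis a - cis b))\<^sup>2 = (2 * sin ((a - b) / 2))\<^sup>2"
    using norm_cis_minus_one_sq[of "a - b"] by (simp add: norm_mult power_mult_distrib)
  also have "\<dots> \<le> \<bar>a - b\<bar>\<^sup>2"
    using abs_sin_x_le_abs_x[of "(a - b) / 2"] by (subst abs_le_square_iff[symmetric]) (simp add: abs_mult)
  finally show ?thesis by (rule power2_le_imp_le) simp
qed

text \<open>The terms are |(cis(-ty) - 1)/t|^2 for t = 1/(k + 1), the squared moduli of difference
  quotients at 0.\<close>

lemma difference_quotient_sin:
  fixes y :: real
  shows "(\<lambda>k. (2 * sin (- (1 / real (Suc k)) * y / 2) * real (Suc k))\<^sup>2) \<longlonglongrightarrow> y\<^sup>2"
proof -
  have "((\<lambda>t. sin (- t * y / 2)) has_field_derivative - y / 2) (at 0)"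
    by (auto intro!: derivative_eq_intros)
  then have "((\<lambda>h. sin (- h * y / 2) / h) \<longlongrightarrow> - y / 2) (at 0)" by (simp add: DERIV_def)
  moreover have "filterlim (\<lambda>k. 1 / real (Suc k)) (at 0) sequentially"
    by (rule filterlim_atI) (use LIMSEQ_Suc[OF lim_const_over_n[of "1::real"]] in auto)
  ultimately have "(\<lambda>k. sin (- (1 / real (Suc k)) * y / 2) / (1 / real (Suc k))) \<longlonglongrightarrow> - y / 2"
    by (rule filterlim_compose)
  then have "(\<lambda>k. (2 * (sin (- (1 / real (Suc k)) * y / 2) / (1 / real (Suc k))))\<^sup>2) \<longlonglongrightarrow> (2 * (- y / 2))\<^sup>2"
    by (intro tendsto_power tendsto_mult[OF tendsto_const])
  then show ?thesis by (simp add: mult.assoc)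
qed

text \<open>Instead of a derivative of \<phi>, the increment \<phi>(\<xi> + tb) - \<phi>(\<xi>) is
  put into the Bessel inequality. Its transform is (cis(-t x\<bullet>b) - 1) times that of \<phi>,
  and its modulus is at most L|t|. Dividing by t^2 and letting t tend to 0 in Fatou's lemma gives
  the claim.\<close>

lemma fourier_first_moment:
  fixes \<phi> :: "'a::euclidean_space \<Rightarrow> complex"
  assumes L: "L-lipschitz_on UNIV \<phi>" and bdd: "bounded {\<xi>. \<phi> \<xi> \<noteq> 0}" and b: "b \<in> Basis"
  shows "(\<integral>\<^sup>+x. ennreal ((x \<bullet> b)\<^sup>2 * (norm (fourier \<phi> x))\<^sup>2) \<partial>lborel)
      \<le> ennreal ((2 * pi) ^ DIM('a) * (2 * L\<^sup>2)) * emeasure lborel {\<xi>. \<phi> \<xi> \<noteq> 0}" (is "_ \<le> ?R")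
proof -
  note [measurable] = lipschitz_measurable[OF L]
  have int: "integrable lborel \<phi>" using L bdd lip_cs_integrable by (auto simp: lip_cs_def)
  have [measurable]: "fourier \<phi> \<in> borel_measurable borel" by (rule fourier_measurable) simp
  define E where "E = {\<xi>. \<phi> \<xi> \<noteq> 0}"
  have E[measurable]: "E \<in> sets borel" unfolding E_def using open_nonzero[OF L] by simp
  have *: "(\<integral>\<^sup>+x. ennreal ((norm (cis (- t * (x \<bullet> b)) - 1))\<^sup>2 * (norm (fourier \<phi> x))\<^sup>2) \<partial>lborel)
      \<le> ennreal (t\<^sup>2) * ?R" for t
  proof -
    define \<psi> where "\<psi> \<xi> = \<phi> (\<xi> + t *\<^sub>R b) - \<phi> \<xi>" for \<xi>
    have sh: "integrable lborel (\<lambda>\<xi>. \<phi> (\<xi> + t *\<^sub>R b))" by (rule lborel_integrable_shift[OF int])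
    have \<psi>: "integrable lborel \<psi>" unfolding \<psi>_def using sh int by simp
    have four: "fourier \<psi> x = (cis (- t * (x \<bullet> b)) - 1) * fourier \<phi> x" for x
    proof -
      have "fourier \<psi> x = (LINT \<xi>|lborel. \<phi> (\<xi> + t *\<^sub>R b) * cis (x \<bullet> \<xi>) - \<phi> \<xi> * cis (x \<bullet> \<xi>))"
        by (simp add: fourier_def \<psi>_def left_diff_distrib)
      also have "\<dots> = (LINT \<xi>|lborel. \<phi> (\<xi> + t *\<^sub>R b) * cis (x \<bullet> \<xi>)) - fourier \<phi> x"
        unfolding fourier_def by (rule Bochner_Integration.integral_diff) (intro integrable_mult_cis sh int)+
      also have "(LINT \<xi>|lborel. \<phi> (\<xi> + t *\<^sub>R b) * cis (x \<bullet> \<xi>))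
         = (LINT \<xi>|lborel. \<phi> (\<xi> + t *\<^sub>R b) * cis (x \<bullet> (\<xi> + t *\<^sub>R b)) * cis (- t * (x \<bullet> b)))"
        by (intro Bochner_Integration.integral_cong refl) (simp add: inner_add_right mult.assoc cis_mult)
      also have "\<dots> = (LINT \<xi>|lborel. \<phi> \<xi> * cis (x \<bullet> \<xi>) * cis (- t * (x \<bullet> b)))"
        by (rule lborel_integral_shift[where f = "\<lambda>\<xi>. \<phi> \<xi> * cis (x \<bullet> \<xi>) * cis (- t * (x \<bullet> b))"]) simp
      also have "\<dots> = fourier \<phi> x * cis (- t * (x \<bullet> b))" by (simp add: fourier_def)
      finally show ?thesis by (simp add: algebra_simps)
    qed
    have L0: "0 \<le> L" using L by (rule lipschitz_on_nonneg)
    have \<psi>le: "norm (\<psi> \<xi>) \<le> L * \<bar>t\<bar>" for \<xi>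
      using lipschitz_onD[OF L, of "\<xi> + t *\<^sub>R b" \<xi>] b by (simp add: \<psi>_def dist_norm)
    \<comment> \<open>The increment lives on the set where \<phi> is nonzero and on a translate of
      it, two sets of equal measure; this is the origin of the factor 2.\<close>
    have "ennreal ((norm (\<psi> \<xi>))\<^sup>2) \<le> ennreal ((L * \<bar>t\<bar>)\<^sup>2) * indicator ({\<xi>. \<xi> + t *\<^sub>R b \<in> E} \<union> E) \<xi>" for \<xi>
    proof (cases "\<psi> \<xi> = 0")
      case False
      then have "\<xi> \<in> {\<xi>. \<xi> + t *\<^sub>R b \<in> E} \<union> E" by (auto simp: \<psi>_def E_def)
      then show ?thesis using power_mono[OF \<psi>le[of \<xi>], of 2] by (simp add: ennreal_leI)
    qed simp
    then have "(\<integral>\<^sup>+\<xi>. ennreal ((norm (\<psi> \<xi>))\<^sup>2) \<partial>lborel) \<le>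
       (\<integral>\<^sup>+\<xi>. ennreal ((L * \<bar>t\<bar>)\<^sup>2) * indicator ({\<xi>. \<xi> + t *\<^sub>R b \<in> E} \<union> E) \<xi> \<partial>lborel)"
      by (rule nn_integral_mono)
    also have "\<dots> = ennreal ((L * \<bar>t\<bar>)\<^sup>2) * emeasure lborel ({\<xi>. \<xi> + t *\<^sub>R b \<in> E} \<union> E)"
      by (rule nn_integral_cmult_indicator) simp
    also have "\<dots> \<le> ennreal ((L * \<bar>t\<bar>)\<^sup>2) * (emeasure lborel {\<xi>. \<xi> + t *\<^sub>R b \<in> E} + emeasure lborel E)"
      by (intro mult_left_mono emeasure_subadditive) auto
    also have "\<dots> = ennreal ((L * \<bar>t\<bar>)\<^sup>2) * (2 * emeasure lborel E)"
      by (simp add: emeasure_lborel_shift mult_2)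
    finally have "(\<integral>\<^sup>+x. ennreal ((norm (fourier \<psi> x))\<^sup>2) \<partial>lborel) \<le>
       ennreal ((2 * pi) ^ DIM('a)) * (ennreal ((L * \<bar>t\<bar>)\<^sup>2) * (2 * emeasure lborel E))"
      using fourier_bessel[OF \<psi>] by (meson mult_left_mono order_trans zero_le)
    also have "\<dots> = ennreal (t\<^sup>2) * (ennreal ((2 * pi) ^ DIM('a) * (2 * L\<^sup>2)) * emeasure lborel E)"
      by (simp add: ennreal_mult power_mult_distrib mult_ac)
    finally show ?thesis by (simp add: four norm_mult power_mult_distrib E_def)
  qed
  define u where "u k x = ennreal ((2 * sin (- (1 / real (Suc k)) * (x \<bullet> b) / 2) * real (Suc k))\<^sup>2 * (norm (fourier \<phi> x))\<^sup>2)" for k x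
  have u: "(\<integral>\<^sup>+x. u k x \<partial>lborel) \<le> ?R" for k
  proof -
    have "u k x = ennreal ((real (Suc k))\<^sup>2) *
      ennreal ((norm (cis (- (1 / real (Suc k)) * (x \<bullet> b)) - 1))\<^sup>2 * (norm (fourier \<phi> x))\<^sup>2)" for x
      unfolding u_def norm_cis_minus_one_sq
      by (subst ennreal_mult[symmetric]) (simp_all add: power_mult_distrib mult_ac del: of_nat_Suc)
    then have "(\<integral>\<^sup>+x. u k x \<partial>lborel) = ennreal ((real (Suc k))\<^sup>2) *
      (\<integral>\<^sup>+x. ennreal ((norm (cis (- (1 / real (Suc k)) * (x \<bullet> b)) - 1))\<^sup>2 * (norm (fourier \<phi> x))\<^sup>2) \<partial>lborel)"
      by (simp add: nn_integral_cmult del: of_nat_Suc)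
    also have "\<dots> \<le> ennreal ((real (Suc k))\<^sup>2) * (ennreal ((1 / real (Suc k))\<^sup>2) * ?R)"
      by (intro mult_left_mono *) simp
    also have "\<dots> = ennreal ((real (Suc k))\<^sup>2 * (1 / real (Suc k))\<^sup>2) * ?R"
      by (subst ennreal_mult) (auto simp: mult.assoc)
    also have "(real (Suc k))\<^sup>2 * (1 / real (Suc k))\<^sup>2 = 1" by (simp add: power_divide)
    finally show ?thesis by simp
  qed
  have lim: "(\<lambda>k. u k x) \<longlonglongrightarrow> ennreal ((x \<bullet> b)\<^sup>2 * (norm (fourier \<phi> x))\<^sup>2)" for x
    unfolding u_def by (intro tendsto_ennrealI tendsto_mult difference_quotient_sin tendsto_const)
  have "(\<integral>\<^sup>+x. ennreal ((x \<bullet> b)\<^sup>2 * (norm (fourier \<phi> x))\<^sup>2) \<partial>lborel) = (\<integral>\<^sup>+x. liminf (\<lambda>k. u k x) \<partial>lborel)"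
    using lim_imp_Liminf[OF _ lim] by simp
  also have "\<dots> \<le> liminf (\<lambda>k. \<integral>\<^sup>+x. u k x \<partial>lborel)"
    by (rule nn_integral_liminf) (simp add: u_def)
  also have "\<dots> \<le> liminf (\<lambda>k::nat. ?R)"
    by (intro Liminf_mono always_eventually allI u)
  also have "\<dots> = ?R" by (simp add: Liminf_const)
  finally show ?thesis .
qed

text \<open>Zeroth and first moments together. For \<open>L\<close> of order 1/\<epsilon> the
  constant stays bounded, and smallness comes from the measure of the support alone.\<close>

lemma fourier_weighted_bound:
  fixes \<phi> :: "'a::euclidean_space \<Rightarrow> complex" and B L \<epsilon> :: real
  assumes L: "L-lipschitz_on UNIV \<phi>" and B: "\<And>\<xi>. norm (\<phi> \<xi>) \<le> B" and bdd: "bounded {\<xi>. \<phi> \<xi> \<noteq> 0}"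
  shows "(\<integral>\<^sup>+x. ennreal ((1 + \<epsilon>\<^sup>2 * (norm x)\<^sup>2) * (norm (fourier \<phi> x))\<^sup>2) \<partial>lborel)
      \<le> ennreal ((2 * pi) ^ DIM('a) * (B\<^sup>2 + 2 * DIM('a) * (\<epsilon> * L)\<^sup>2)) * emeasure lborel {\<xi>. \<phi> \<xi> \<noteq> 0}"
proof -
  note [measurable] = lipschitz_measurable[OF L]
  have int: "integrable lborel \<phi>" using L bdd lip_cs_integrable by (auto simp: lip_cs_def)
  have [measurable]: "fourier \<phi> \<in> borel_measurable borel" by (rule fourier_measurable) simp
  define E where "E = {\<xi>. \<phi> \<xi> \<noteq> 0}"
  have E[measurable]: "E \<in> sets borel" unfolding E_def using open_nonzero[OF L] by simp
  define P where "P = (2 * pi) ^ DIM('a)"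
  have P: "0 \<le> P" by (simp add: P_def)
  have "ennreal ((norm (\<phi> \<xi>))\<^sup>2) \<le> ennreal (B\<^sup>2) * indicator E \<xi>" for \<xi>
    using power_mono[OF B[of \<xi>], of 2] by (cases "\<phi> \<xi> = 0") (auto simp: E_def ennreal_leI)
  then have "(\<integral>\<^sup>+\<xi>. ennreal ((norm (\<phi> \<xi>))\<^sup>2) \<partial>lborel) \<le> (\<integral>\<^sup>+\<xi>. ennreal (B\<^sup>2) * indicator E \<xi> \<partial>lborel)"
    by (rule nn_integral_mono)
  also have "\<dots> = ennreal (B\<^sup>2) * emeasure lborel E" by (rule nn_integral_cmult_indicator) simp
  finally have zero: "(\<integral>\<^sup>+x. ennreal ((norm (fourier \<phi> x))\<^sup>2) \<partial>lborel) \<le> ennreal P * (ennreal (B\<^sup>2) * emeasure lborel E)"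
    using fourier_bessel[OF int] unfolding P_def by (meson mult_left_mono order_trans zero_le)
  have "(1 + \<epsilon>\<^sup>2 * (norm x)\<^sup>2) * (norm (fourier \<phi> x))\<^sup>2 =
     (norm (fourier \<phi> x))\<^sup>2 + (\<Sum>b\<in>Basis. \<epsilon>\<^sup>2 * ((x \<bullet> b)\<^sup>2 * (norm (fourier \<phi> x))\<^sup>2))" for x
  proof -
    have "(norm x)\<^sup>2 = (\<Sum>b\<in>Basis. (x \<bullet> b)\<^sup>2)"
      unfolding power2_norm_eq_inner by (subst euclidean_inner) (simp add: power2_eq_square)
    then show ?thesis by (simp add: distrib_right sum_distrib_right sum_distrib_left mult.assoc)
  qed
  then have "(\<integral>\<^sup>+x. ennreal ((1 + \<epsilon>\<^sup>2 * (norm x)\<^sup>2) * (norm (fourier \<phi> x))\<^sup>2) \<partial>lborel) =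
     (\<integral>\<^sup>+x. ennreal ((norm (fourier \<phi> x))\<^sup>2) + (\<Sum>b\<in>Basis. ennreal (\<epsilon>\<^sup>2) * ennreal ((x \<bullet> b)\<^sup>2 * (norm (fourier \<phi> x))\<^sup>2)) \<partial>lborel)"
    by (intro nn_integral_cong) (simp add: ennreal_plus sum_nonneg sum_ennreal[symmetric] ennreal_mult)
  also have "\<dots> = (\<integral>\<^sup>+x. ennreal ((norm (fourier \<phi> x))\<^sup>2) \<partial>lborel) +
     (\<Sum>b\<in>Basis. ennreal (\<epsilon>\<^sup>2) * (\<integral>\<^sup>+x. ennreal ((x \<bullet> b)\<^sup>2 * (norm (fourier \<phi> x))\<^sup>2) \<partial>lborel))"
    by (simp add: nn_integral_add nn_integral_sum nn_integral_cmult)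
  also have "\<dots> \<le> ennreal P * (ennreal (B\<^sup>2) * emeasure lborel E) +
     (\<Sum>b\<in>(Basis::'a set). ennreal (\<epsilon>\<^sup>2) * (ennreal (P * (2 * L\<^sup>2)) * emeasure lborel E))"
    unfolding P_def E_def
    by (intro add_mono zero[unfolded P_def E_def] sum_mono mult_left_mono fourier_first_moment L bdd) auto
  also have "\<dots> = ennreal (P * B\<^sup>2) * emeasure lborel E + ennreal (DIM('a) * (\<epsilon>\<^sup>2 * (P * (2 * L\<^sup>2)))) * emeasure lborel E"
    using P by (simp add: ennreal_mult ennreal_of_nat_eq_real_of_nat mult.assoc)
  also have "\<dots> = ennreal (P * B\<^sup>2 + DIM('a) * (\<epsilon>\<^sup>2 * (P * (2 * L\<^sup>2)))) * emeasure lborel E"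
    using P by (simp add: ennreal_plus distrib_right)
  also have "P * B\<^sup>2 + DIM('a) * (\<epsilon>\<^sup>2 * (P * (2 * L\<^sup>2))) = P * (B\<^sup>2 + 2 * DIM('a) * (\<epsilon> * L)\<^sup>2)"
    by (simp add: algebra_simps power_mult_distrib)
  finally show ?thesis by (simp add: P_def E_def)
qed

section \<open>Thin sets\<close>

text \<open>Finite upper Minkowski content in codimension one. The Borel set \<open>A\<close> stands
  for the closed \<epsilon>-neighbourhood, so that unions and subsets are handled without any
  measurability question.\<close>

definition thin :: "'a::euclidean_space set \<Rightarrow> bool" where
  "thin E \<longleftrightarrow> (\<exists>C \<epsilon>0. 0 \<le> C \<and> 0 < \<epsilon>0 \<and> (\<forall>\<epsilon>. 0 < \<epsilon> \<and> \<epsilon> < \<epsilon>0 \<longrightarrow>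
     (\<exists>A\<in>sets borel. {\<xi>. \<exists>e\<in>E. dist e \<xi> \<le> \<epsilon>} \<subseteq> A \<and> emeasure lborel A \<le> ennreal (C * \<epsilon>))))"

lemma thin_empty: "thin {}"
  unfolding thin_def by (intro exI[of _ 0] exI[of _ 1]) auto

lemma thin_subset: "thin E \<Longrightarrow> E' \<subseteq> E \<Longrightarrow> thin E'"
proof -
  assume "thin E" and sub: "E' \<subseteq> E"
  then obtain C \<epsilon>0 where C: "0 \<le> C" "0 < \<epsilon>0" "\<And>\<epsilon>. 0 < \<epsilon> \<Longrightarrow> \<epsilon> < \<epsilon>0 \<Longrightarrow>
     \<exists>A\<in>sets borel. {\<xi>. \<exists>e\<in>E. dist e \<xi> \<le> \<epsilon>} \<subseteq> A \<and> emeasure lborel A \<le> ennreal (C * \<epsilon>)"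
    unfolding thin_def by blast
  have "{\<xi>. \<exists>e\<in>E'. dist e \<xi> \<le> \<epsilon>} \<subseteq> {\<xi>. \<exists>e\<in>E. dist e \<xi> \<le> \<epsilon>}" for \<epsilon> using sub by blast
  then show "thin E'"
    unfolding thin_def using C by (intro exI[of _ C] exI[of _ \<epsilon>0]) (meson order_trans)
qed

lemma thin_Un:
  assumes "thin E" "thin E'"
  shows "thin (E \<union> E')"
proof -
  obtain C \<epsilon>0 where C: "0 \<le> C" "0 < \<epsilon>0" "\<And>\<epsilon>. 0 < \<epsilon> \<Longrightarrow> \<epsilon> < \<epsilon>0 \<Longrightarrow>
     \<exists>A\<in>sets borel. {\<xi>. \<exists>e\<in>E. dist e \<xi> \<le> \<epsilon>} \<subseteq> A \<and> emeasure lborel A \<le> ennreal (C * \<epsilon>)"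
    using assms(1) unfolding thin_def by blast
  obtain C' \<epsilon>0' where C': "0 \<le> C'" "0 < \<epsilon>0'" "\<And>\<epsilon>. 0 < \<epsilon> \<Longrightarrow> \<epsilon> < \<epsilon>0' \<Longrightarrow>
     \<exists>A\<in>sets borel. {\<xi>. \<exists>e\<in>E'. dist e \<xi> \<le> \<epsilon>} \<subseteq> A \<and> emeasure lborel A \<le> ennreal (C' * \<epsilon>)"
    using assms(2) unfolding thin_def by blast
  show ?thesis
    unfolding thin_def
  proof (rule exI[of _ "C + C'"], rule exI[of _ "min \<epsilon>0 \<epsilon>0'"], intro conjI allI impI)
    fix \<epsilon> :: real assume \<epsilon>: "0 < \<epsilon> \<and> \<epsilon> < min \<epsilon>0 \<epsilon>0'"
    obtain A where A: "A \<in> sets borel" "{\<xi>. \<exists>e\<in>E. dist e \<xi> \<le> \<epsilon>} \<subseteq> A" "emeasure lborel A \<le> ennreal (C * \<epsilon>)"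
      using C(3)[of \<epsilon>] \<epsilon> by auto
    obtain A' where A': "A' \<in> sets borel" "{\<xi>. \<exists>e\<in>E'. dist e \<xi> \<le> \<epsilon>} \<subseteq> A'" "emeasure lborel A' \<le> ennreal (C' * \<epsilon>)"
      using C'(3)[of \<epsilon>] \<epsilon> by auto
    have "emeasure lborel (A \<union> A') \<le> emeasure lborel A + emeasure lborel A'"
      using A A' by (intro emeasure_subadditive) auto
    also have "\<dots> \<le> ennreal (C * \<epsilon>) + ennreal (C' * \<epsilon>)" by (intro add_mono A A')
    also have "\<dots> = ennreal ((C + C') * \<epsilon>)"
      using C C' \<epsilon> by (simp add: ennreal_plus[symmetric] distrib_right del: ennreal_plus)
    finally show "\<exists>A\<in>sets borel. {\<xi>. \<exists>e\<in>E \<union> E'. dist e \<xi> \<le> \<epsilon>} \<subseteq> A \<and> emeasure lborel A \<le> ennreal ((C + C') * \<epsilon>)"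
      using A A' by (intro bexI[of _ "A \<union> A'"]) auto
  qed (use C C' in auto)
qed

lemma thin_compact:
  assumes "compact E" and loc: "\<And>x. x \<in> E \<Longrightarrow> \<exists>r>0. thin (E \<inter> ball x r)"
  shows "thin E"
proof -
  obtain r where r: "\<And>x. x \<in> E \<Longrightarrow> 0 < r x \<and> thin (E \<inter> ball x (r x))" using loc by metis
  then have "E \<subseteq> (\<Union>x\<in>E. ball x (r x))" by force
  then obtain T where T: "T \<subseteq> E" "finite T" "E \<subseteq> (\<Union>x\<in>T. ball x (r x))"
    using compactE_image[OF \<open>compact E\<close>, of E "\<lambda>x. ball x (r x)"] by auto
  have "thin (\<Union>x\<in>T. E \<inter> ball x (r x))"
    using T(2,1) by (induction T rule: finite_induct) (use r in \<open>auto intro!: thin_empty thin_Un\<close>)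
  then show ?thesis by (rule thin_subset) (use T in blast)
qed

text \<open>The slab \<open>|G| \<le> L\<epsilon>\<close> meets none of its translates by multiples of \<open>\<tau> v\<close>, \<open>\<tau> \<sim> \<epsilon>\<close>; about
  \<open>1/\<tau>\<close> of these fit into a fixed ball.\<close>

lemma thin_level_set:
  fixes G :: "'a::euclidean_space \<Rightarrow> real"
  assumes L: "L-lipschitz_on UNIV G" and c: "0 < c" and r: "0 < r"
    and grow: "\<And>\<xi> t. 0 \<le> t \<Longrightarrow> \<xi> \<in> ball x r \<Longrightarrow> \<xi> + t *\<^sub>R v \<in> ball x r \<Longrightarrow> G \<xi> + c * t \<le> G (\<xi> + t *\<^sub>R v)"
  shows "thin ({\<xi>. G \<xi> = 0} \<inter> ball x (r / 2))"
proof -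
  have L0: "0 \<le> L" using L by (rule lipschitz_on_nonneg)
  have [measurable]: "G \<in> borel_measurable borel"
    by (intro borel_measurable_continuous_onI lipschitz_on_continuous_on[OF L])
  \<comment> \<open>With \<tau> = K\<epsilon> the function gains c\<tau> = 3(L + 1)\<epsilon> along
    one step, more than the width 2L\<epsilon> of the slab; the summand 1 keeps this strict when L =
    0.\<close>
  define K where "K = 3 * (L + 1) / c"
  have K: "0 < K" using L0 c by (simp add: K_def)
  \<comment> \<open>The translations used are by at most (1 + K)|v|, so all copies stay in this
    ball.\<close>
  define R where "R = r + (1 + K) * norm v"
  define V where "V = measure lborel (cball x R)"
  show ?thesis
    unfolding thin_def
  proof (rule exI[of _ "V * K"], rule exI[of _ "min 1 (r / 2)"], intro conjI allI impI)
    show "0 \<le> V * K" using K by (simp add: V_def)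
    show "0 < min 1 (r / 2)" using r by simp
    fix \<epsilon> :: real assume \<epsilon>: "0 < \<epsilon> \<and> \<epsilon> < min 1 (r / 2)"
    \<comment> \<open>\<open>A\<close> contains the \<epsilon>-neighbourhood in question:
      \<open>G\<close> changes by at most L\<epsilon>, and \<epsilon> < r/2 keeps the point in the
      ball of radius \<open>r\<close>.\<close>
    define A where "A = {\<xi> \<in> ball x r. \<bar>G \<xi>\<bar> \<le> L * \<epsilon>}"
    have A[measurable]: "A \<in> sets borel" unfolding A_def by measurable
    define \<tau> where "\<tau> = K * \<epsilon>"
    have \<tau>: "0 < \<tau>" "\<tau> \<le> K" using K \<epsilon> by (auto simp: \<tau>_def)
    define J where "J = nat \<lceil>1 / \<tau>\<rceil>"
    have J: "1 / \<tau> \<le> real J" "real J \<le> 1 / \<tau> + 1"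
      using \<tau> by (auto simp: J_def)
    have J\<tau>: "real J * \<tau> \<le> 1 + K"
      using mult_right_mono[OF J(2), of \<tau>] \<tau> by (simp add: distrib_right)
    define S where "S j = {\<xi>. \<xi> + (real j * \<tau>) *\<^sub>R v \<in> A}" for j :: nat
    have S[measurable]: "S j \<in> sets borel" for j unfolding S_def by measurable
    have Sm: "emeasure lborel (S j) = emeasure lborel A" for j
      unfolding S_def by (rule emeasure_lborel_shift) simp
    have disj: "S i \<inter> S j = {}" if "i < j" for i j
    proof (rule ccontr)
      assume "S i \<inter> S j \<noteq> {}"
      then obtain \<xi> where \<xi>: "\<xi> + (real i * \<tau>) *\<^sub>R v \<in> A" "\<xi> + (real j * \<tau>) *\<^sub>R v \<in> A" by (auto simp: S_def)
      define y where "y = \<xi> + (real i * \<tau>) *\<^sub>R v"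
      define t where "t = (real j - real i) * \<tau>"
      have eq: "\<xi> + (real j * \<tau>) *\<^sub>R v = y + t *\<^sub>R v"
        by (simp add: y_def t_def algebra_simps)
      have "1 * \<tau> \<le> t" unfolding t_def using \<open>i < j\<close> \<tau> by (intro mult_right_mono) auto
      then have t: "0 \<le> t" "c * \<tau> \<le> c * t" using \<tau> c by auto
      have "G y + c * t \<le> G (y + t *\<^sub>R v)"
        using \<xi> t unfolding eq by (intro grow) (auto simp: A_def y_def)
      moreover have "\<bar>G y\<bar> \<le> L * \<epsilon>" "\<bar>G (y + t *\<^sub>R v)\<bar> \<le> L * \<epsilon>"
        using \<xi> unfolding eq by (auto simp: A_def y_def)
      moreover have "c * \<tau> = 3 * (L * \<epsilon>) + 3 * \<epsilon>" using c by (simp add: \<tau>_def K_def field_simps)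
      ultimately show False using t \<epsilon> mult_nonneg_nonneg[OF L0, of \<epsilon>] by linarith
    qed
    have sub: "(\<Union>j<J. S j) \<subseteq> cball x R"
    proof
      fix \<xi> assume "\<xi> \<in> (\<Union>j<J. S j)"
      then obtain j where j: "j < J" "\<xi> + (real j * \<tau>) *\<^sub>R v \<in> ball x r" by (auto simp: S_def A_def)
      have "real j * \<tau> \<le> real J * \<tau>" using j \<tau> by (intro mult_right_mono) auto
      then have "real j * \<tau> \<le> 1 + K" using J\<tau> by linarith
      from mult_right_mono[OF this norm_ge_zero[of v]]
      have "norm ((real j * \<tau>) *\<^sub>R v) \<le> (1 + K) * norm v" using \<tau> by (simp add: abs_mult)
      moreover have "dist x \<xi> \<le> dist x (\<xi> + (real j * \<tau>) *\<^sub>R v) + norm ((real j * \<tau>) *\<^sub>R v)"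
        by (metis add_diff_cancel_left' dist_norm dist_triangle)
      ultimately show "\<xi> \<in> cball x R" using j by (simp add: R_def)
    qed
    have fin: "emeasure lborel (cball x R) < \<infinity>" by (rule emeasure_lborel_cball_finite)
    have "disjoint_family_on S {..<J}"
      unfolding disjoint_family_on_def using disj by (metis Int_commute linorder_neqE_nat)
    then have "(\<Sum>j<J. emeasure lborel (S j)) = emeasure lborel (\<Union>j<J. S j)"
      by (intro sum_emeasure) auto
    also have "\<dots> \<le> emeasure lborel (cball x R)" by (rule emeasure_mono[OF sub]) simp
    also have "\<dots> = ennreal V" unfolding V_def using fin by (simp add: emeasure_eq_ennreal_measure top.not_eq_extremum)
    finally have JA: "of_nat J * emeasure lborel A \<le> ennreal V" by (simp add: Sm)
    \<comment> \<open>\<open>J\<close> disjoint copies of \<open>A\<close> have total measure at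
      most \<open>V\<close>, and 1/J \<le> \<tau>.\<close>
    have "emeasure lborel A = ennreal \<tau> * (ennreal (1 / \<tau>) * emeasure lborel A)"
      using \<tau> by (simp add: mult.assoc[symmetric] ennreal_mult[symmetric])
    also have "\<dots> \<le> ennreal \<tau> * (of_nat J * emeasure lborel A)"
      using J by (intro mult_left_mono mult_right_mono) (auto simp: ennreal_of_nat_eq_real_of_nat ennreal_leI)
    also have "\<dots> \<le> ennreal \<tau> * ennreal V" by (intro mult_left_mono JA) simp
    also have "\<dots> = ennreal (V * K * \<epsilon>)"
      using \<tau> by (simp add: ennreal_mult[symmetric] V_def \<tau>_def mult_ac)
    finally have meas: "emeasure lborel A \<le> ennreal (V * K * \<epsilon>)" .
    have "{\<xi>. \<exists>e\<in>{\<xi>. G \<xi> = 0} \<inter> ball x (r / 2). dist e \<xi> \<le> \<epsilon>} \<subseteq> A"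
    proof clarify
      fix \<xi> e assume e: "e \<in> ball x (r / 2)" "G e = 0" "dist e \<xi> \<le> \<epsilon>"
      have "\<bar>G \<xi>\<bar> \<le> L * dist e \<xi>" using lipschitz_onD[OF L, of e \<xi>] e by (simp add: dist_real_def)
      also have "\<dots> \<le> L * \<epsilon>" using e L0 by (intro mult_left_mono) auto
      finally have "\<bar>G \<xi>\<bar> \<le> L * \<epsilon>" .
      moreover have "dist x \<xi> < r" using e \<epsilon> dist_triangle[of x \<xi> e] by auto
      ultimately show "\<xi> \<in> A" by (simp add: A_def)
    qed
    then show "\<exists>A\<in>sets borel. {\<xi>. \<exists>e\<in>{\<xi>. G \<xi> = 0} \<inter> ball x (r / 2). dist e \<xi> \<le> \<epsilon>} \<subseteq> A \<and> emeasure lborel A \<le> ennreal (V * K * \<epsilon>)"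
      using meas A by blast
  qed
qed

section \<open>The spectrum of a solution\<close>

text \<open>This encodes that the integral of \<open>|f|\<^sup>2\<close> over the ball of radius \<open>R = 1/\<epsilon>\<close> is \<open>o(R)\<close>.\<close>

definition slow :: "('a::euclidean_space \<Rightarrow> complex) \<Rightarrow> bool" where
  "slow f \<longleftrightarrow> f \<in> borel_measurable borel \<and> (\<forall>\<eta>>0. \<exists>\<epsilon>0>0. \<forall>\<epsilon>. 0 < \<epsilon> \<and> \<epsilon> < \<epsilon>0 \<longrightarrow>
     (\<integral>\<^sup>+x. ennreal ((norm (f x))\<^sup>2 / (1 + \<epsilon>\<^sup>2 * (norm x)\<^sup>2)) \<partial>lborel) \<le> ennreal (\<eta> / \<epsilon>))"

lemma slowD:
  assumes "slow f" "0 < \<eta>"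
  obtains \<epsilon>0 where "0 < \<epsilon>0" "\<And>\<epsilon>. 0 < \<epsilon> \<Longrightarrow> \<epsilon> < \<epsilon>0 \<Longrightarrow>
     (\<integral>\<^sup>+x. ennreal ((norm (f x))\<^sup>2 / (1 + \<epsilon>\<^sup>2 * (norm x)\<^sup>2)) \<partial>lborel) \<le> ennreal (\<eta> / \<epsilon>)"
  using assms unfolding slow_def by blast

text \<open>The Fourier transform of f, defined weakly through its values on test functions. That
  these vanish on all test functions off a closed set says that the spectrum of f lies in that
  set.\<close>

definition pairing :: "('a::euclidean_space \<Rightarrow> complex) \<Rightarrow> ('a \<Rightarrow> complex) \<Rightarrow> complex" where
  "pairing f \<phi> = (LINT x|lborel. f x * fourier \<phi> x)"

text \<open>Cauchy-Schwarz with the weight split between the two factors, in the additive form with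
  a free parameter \<open>s\<close>. This yields integrability and the estimate at once, and leaves
  the balancing to the application.\<close>

lemma weighted_pairing_bound:
  fixes f g :: "'a::euclidean_space \<Rightarrow> complex"
  assumes [measurable]: "f \<in> borel_measurable borel" "g \<in> borel_measurable borel"
    and a: "(\<integral>\<^sup>+x. ennreal ((norm (f x))\<^sup>2 / (1 + \<epsilon>\<^sup>2 * (norm x)\<^sup>2)) \<partial>lborel) \<le> ennreal a" "0 \<le> a"
    and w: "(\<integral>\<^sup>+x. ennreal ((1 + \<epsilon>\<^sup>2 * (norm x)\<^sup>2) * (norm (g x))\<^sup>2) \<partial>lborel) \<le> ennreal w" "0 \<le> w"
    and s: "0 < s"
  shows "integrable lborel (\<lambda>x. f x * g x)" "norm (LINT x|lborel. f x * g x) \<le> s * a + w / s"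
proof -
  define W where "W x = 1 + \<epsilon>\<^sup>2 * (norm x)\<^sup>2" for x :: 'a
  have W: "0 < W x" for x unfolding W_def by (intro add_pos_nonneg) auto
  have [measurable]: "W \<in> borel_measurable borel" unfolding W_def by measurable
  have "norm (f x * g x) \<le> s * ((norm (f x))\<^sup>2 / W x) + (1 / s) * (W x * (norm (g x))\<^sup>2)" for x
  proof -
    define p where "p = sqrt (s / W x) * norm (f x)"
    define q where "q = sqrt (W x / s) * norm (g x)"
    have "p * q = sqrt ((s / W x) * (W x / s)) * (norm (f x) * norm (g x))"
      unfolding p_def q_def by (simp only: real_sqrt_mult mult_ac)
    also have "(s / W x) * (W x / s) = 1" using W[of x] s by simp
    finally have pq: "p * q = norm (f x * g x)" by (simp add: norm_mult)
    have "p\<^sup>2 = s * ((norm (f x))\<^sup>2 / W x)" "q\<^sup>2 = (1 / s) * (W x * (norm (g x))\<^sup>2)"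
      using W[of x] s by (simp_all add: p_def q_def power_mult_distrib)
    moreover have "p * q \<le> p\<^sup>2 + q\<^sup>2"
      using sum_squares_bound[of p q] norm_ge_zero[of "f x * g x"] unfolding pq[symmetric] mult.assoc
      by linarith
    ultimately show ?thesis using pq by simp
  qed
  then have "ennreal (norm (f x * g x)) \<le> ennreal s * ennreal ((norm (f x))\<^sup>2 / W x) + ennreal (1 / s) * ennreal (W x * (norm (g x))\<^sup>2)" for x
    using W[of x] s by (simp add: ennreal_mult[symmetric] ennreal_plus[symmetric] ennreal_leI del: ennreal_plus)
  then have "(\<integral>\<^sup>+x. ennreal (norm (f x * g x)) \<partial>lborel) \<le>
     (\<integral>\<^sup>+x. ennreal s * ennreal ((norm (f x))\<^sup>2 / W x) + ennreal (1 / s) * ennreal (W x * (norm (g x))\<^sup>2) \<partial>lborel)"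
    by (rule nn_integral_mono)
  also have "\<dots> = ennreal s * (\<integral>\<^sup>+x. ennreal ((norm (f x))\<^sup>2 / W x) \<partial>lborel) + ennreal (1 / s) * (\<integral>\<^sup>+x. ennreal (W x * (norm (g x))\<^sup>2) \<partial>lborel)"
    by (simp add: nn_integral_add nn_integral_cmult)
  also have "\<dots> \<le> ennreal s * ennreal a + ennreal (1 / s) * ennreal w"
    using a(1) w(1) unfolding W_def by (intro add_mono mult_left_mono) auto
  also have "\<dots> = ennreal (s * a + w / s)"
    using a w s by (simp add: ennreal_mult[symmetric] ennreal_plus[symmetric] del: ennreal_plus)
  finally have le: "(\<integral>\<^sup>+x. ennreal (norm (f x * g x)) \<partial>lborel) \<le> ennreal (s * a + w / s)" .
  show int: "integrable lborel (\<lambda>x. f x * g x)"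
    unfolding integrable_iff_bounded using le by (auto simp: le_less_trans[OF le])
  have "ennreal (norm (LINT x|lborel. f x * g x)) \<le> ennreal (s * a + w / s)"
    using integral_norm_bound_ennreal[OF int] le by (rule order_trans)
  then show "norm (LINT x|lborel. f x * g x) \<le> s * a + w / s"
    by (subst (asm) ennreal_le_iff) (use a w s in auto)
qed

lemma pairing_integrable:
  assumes f: "slow f" and \<phi>: "lip_cs \<phi>"
  shows "integrable lborel (\<lambda>x. f x * fourier \<phi> x)"
proof -
  obtain \<epsilon>0 where \<epsilon>0: "0 < \<epsilon>0" "\<And>\<epsilon>. 0 < \<epsilon> \<Longrightarrow> \<epsilon> < \<epsilon>0 \<Longrightarrow>
     (\<integral>\<^sup>+x. ennreal ((norm (f x))\<^sup>2 / (1 + \<epsilon>\<^sup>2 * (norm x)\<^sup>2)) \<partial>lborel) \<le> ennreal (1 / \<epsilon>)"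
    using slowD[OF f zero_less_one] by blast
  obtain L B where L: "L-lipschitz_on UNIV \<phi>" and B: "\<And>\<xi>. norm (\<phi> \<xi>) \<le> B"
    using \<phi> lip_cs_bounded[OF \<phi>] by (auto simp: lip_cs_def)
  have bdd: "bounded {\<xi>. \<phi> \<xi> \<noteq> 0}" using \<phi> by (simp add: lip_cs_def)
  define \<epsilon> where "\<epsilon> = \<epsilon>0 / 2"
  have "emeasure lborel {\<xi>. \<phi> \<xi> \<noteq> 0} < \<infinity>" by (rule emeasure_bounded_finite[OF bdd])
  then obtain m where m: "emeasure lborel {\<xi>. \<phi> \<xi> \<noteq> 0} = ennreal m" "0 \<le> m" by (cases "emeasure lborel {\<xi>. \<phi> \<xi> \<noteq> 0}") auto
  have \<epsilon>: "0 < \<epsilon>" "\<epsilon> < \<epsilon>0" using \<epsilon>0(1) by (auto simp: \<epsilon>_def)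
  have w: "(\<integral>\<^sup>+x. ennreal ((1 + \<epsilon>\<^sup>2 * (norm x)\<^sup>2) * (norm (fourier \<phi> x))\<^sup>2) \<partial>lborel)
    \<le> ennreal ((2 * pi) ^ DIM('a) * (B\<^sup>2 + 2 * DIM('a) * (\<epsilon> * L)\<^sup>2) * m)"
    using fourier_weighted_bound[OF L B bdd, of \<epsilon>] m by (simp add: ennreal_mult[symmetric])
  show ?thesis
    by (rule weighted_pairing_bound(1)[OF _ _ \<epsilon>0(2)[OF \<epsilon>] _ w _ zero_less_one])
       (use f \<epsilon> m lipschitz_measurable[OF L] in \<open>auto simp: slow_def intro!: fourier_measurable\<close>)
qed

lemma lip_cs_cis:
  assumes "lip_cs \<phi>"
  shows "lip_cs (\<lambda>\<xi>. \<phi> \<xi> * cis (s \<bullet> \<xi>))"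
proof (rule lip_cs_mult[OF assms])
  show "(norm s)-lipschitz_on {\<xi>. \<phi> \<xi> \<noteq> 0} (\<lambda>\<xi>. cis (s \<bullet> \<xi>))"
  proof (rule lipschitz_onI)
    fix x y
    have "dist (cis (s \<bullet> x)) (cis (s \<bullet> y)) \<le> \<bar>s \<bullet> (x - y)\<bar>"
      unfolding dist_norm inner_diff_right by (rule norm_cis_diff_le)
    also have "\<dots> \<le> norm s * dist x y" unfolding dist_norm by (rule Cauchy_Schwarz_ineq2)
    finally show "dist (cis (s \<bullet> x)) (cis (s \<bullet> y)) \<le> norm s * dist x y" .
  qed simp
  show "norm (cis (s \<bullet> \<xi>)) \<le> 1" for \<xi> by simp
qed

lemma fourier_mult_cis: "fourier (\<lambda>\<xi>. \<phi> \<xi> * cis (s \<bullet> \<xi>)) x = fourier \<phi> (x + s)"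
  by (simp add: fourier_def inner_add_left cis_mult mult.assoc add.commute)

lemma pairing_add:
  assumes f: "slow f" and "lip_cs \<phi>" "lip_cs \<psi>"
  shows "pairing f (\<lambda>\<xi>. \<phi> \<xi> + \<psi> \<xi>) = pairing f \<phi> + pairing f \<psi>"
proof -
  have "fourier (\<lambda>\<xi>. \<phi> \<xi> + \<psi> \<xi>) x = fourier \<phi> x + fourier \<psi> x" for x
    unfolding fourier_def distrib_right
    by (intro Bochner_Integration.integral_add integrable_mult_cis lip_cs_integrable assms)
  then show ?thesis
    unfolding pairing_def
    by (simp add: distrib_left Bochner_Integration.integral_add pairing_integrable assms)
qed

text \<open>Off the zeros of \<open>F\<close> the test function \<open>\<phi>\<close> is \<open>F\<close> times another test function \<open>\<rho>\<close>, and
  multiplication by \<open>F\<close> is dual to the action of \<open>\<theta>\<close>.\<close>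

lemma pairing_zero_off_zeros:
  fixes f :: "'a::euclidean_space \<Rightarrow> complex"
  assumes f: "slow f" and \<theta>: "finite (supp \<theta>)" and zero: "\<And>x. gr_act \<theta> f x = 0" and \<phi>: "lip_cs \<phi>"
    and F: "F = (\<lambda>\<xi>. \<Sum>s\<in>supp \<theta>. \<theta> s * cis (s \<bullet> \<xi>))" and L: "L-lipschitz_on UNIV F"
    and off: "closure {\<xi>. \<phi> \<xi> \<noteq> 0} \<inter> {\<xi>. F \<xi> = 0} = {}"
  shows "pairing f \<phi> = 0"
proof -
  define D where "D = {\<xi>. \<phi> \<xi> \<noteq> 0}"
  have comp: "compact (closure D)" using \<phi> by (simp add: lip_cs_def compact_closure D_def)
  \<comment> \<open>The closed support is compact and F has no zero on it.\<close>
  have "\<exists>c>0. \<forall>\<xi>\<in>closure D. c \<le> norm (F \<xi>)"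
  proof (cases "closure D = {}")
    case False
    have "continuous_on (closure D) (\<lambda>\<xi>. norm (F \<xi>))"
      by (intro continuous_on_norm continuous_on_subset[OF lipschitz_on_continuous_on[OF L]]) simp
    then obtain z where "z \<in> closure D" "\<And>\<xi>. \<xi> \<in> closure D \<Longrightarrow> norm (F z) \<le> norm (F \<xi>)"
      using continuous_attains_inf[OF comp False] by blast
    then show ?thesis using off by (intro exI[of _ "norm (F z)"]) (auto simp: D_def)
  qed (auto intro: exI[of _ 1])
  then obtain c where c: "0 < c" "\<And>\<xi>. \<xi> \<in> closure D \<Longrightarrow> c \<le> norm (F \<xi>)" by blast
  have cD: "c \<le> norm (F \<xi>)" if "\<phi> \<xi> \<noteq> 0" for \<xi>
    using c(2)[of \<xi>] subsetD[OF closure_subset, of \<xi> D] that by (simp add: D_def)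
  \<comment> \<open>The lower bound \<open>c\<close> makes 1/F bounded and Lipschitz where \<phi>
    \<noteq> 0, which is all that \<open>lip_cs_mult\<close> asks for.\<close>
  define \<rho> where "\<rho> \<xi> = \<phi> \<xi> * inverse (F \<xi>)" for \<xi>
  have L0: "0 \<le> L" using L by (rule lipschitz_on_nonneg)
  have \<rho>: "lip_cs \<rho>"
    unfolding \<rho>_def
  proof (rule lip_cs_mult[OF \<phi>])
    show "(L / c\<^sup>2)-lipschitz_on {\<xi>. \<phi> \<xi> \<noteq> 0} (\<lambda>\<xi>. inverse (F \<xi>))"
    proof (rule lipschitz_onI)
      fix x y assume xy: "x \<in> {\<xi>. \<phi> \<xi> \<noteq> 0}" "y \<in> {\<xi>. \<phi> \<xi> \<noteq> 0}"
      then have n: "F x \<noteq> 0" "F y \<noteq> 0" using cD c(1) by force+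
      have "inverse (F x) - inverse (F y) = (F y - F x) * (inverse (F x) * inverse (F y))"
        using n by (simp add: field_simps)
      then have "dist (inverse (F x)) (inverse (F y)) = dist (F x) (F y) * (inverse (norm (F x)) * inverse (norm (F y)))"
        by (simp add: dist_norm norm_mult norm_inverse norm_minus_commute)
      also have "\<dots> \<le> (L * dist x y) * (inverse c * inverse c)"
        using c(1) cD xy lipschitz_onD[OF L, of x y] L0
        by (intro mult_mono le_imp_inverse_le) auto
      also have "\<dots> = L / c\<^sup>2 * dist x y" by (simp add: power2_eq_square field_simps)
      finally show "dist (inverse (F x)) (inverse (F y)) \<le> L / c\<^sup>2 * dist x y" .
    qed (use L0 in simp)
    show "norm (inverse (F \<xi>)) \<le> inverse c" if "\<phi> \<xi> \<noteq> 0" for \<xi>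
      using cD[OF that] c(1) by (simp add: norm_inverse le_imp_inverse_le)
  qed
  have \<phi>eq: "\<phi> \<xi> = (\<Sum>s\<in>supp \<theta>. \<theta> s * (\<rho> \<xi> * cis (s \<bullet> \<xi>)))" for \<xi>
  proof -
    have "F \<xi> \<noteq> 0" if "\<phi> \<xi> \<noteq> 0" using cD[OF that] c(1) by auto
    then have "\<phi> \<xi> = \<rho> \<xi> * F \<xi>" by (cases "\<phi> \<xi> = 0") (auto simp: \<rho>_def)
    then show ?thesis by (simp add: F sum_distrib_left mult_ac)
  qed
  have four: "fourier \<phi> x = (\<Sum>s\<in>supp \<theta>. \<theta> s * fourier \<rho> (x + s))" for x
  proof -
    have "fourier \<phi> x = (LINT \<xi>|lborel. (\<Sum>s\<in>supp \<theta>. \<theta> s * (\<rho> \<xi> * cis (s \<bullet> \<xi>) * cis (x \<bullet> \<xi>))))"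
      unfolding fourier_def by (subst \<phi>eq) (simp add: sum_distrib_right mult.assoc)
    also have "\<dots> = (\<Sum>s\<in>supp \<theta>. LINT \<xi>|lborel. \<theta> s * (\<rho> \<xi> * cis (s \<bullet> \<xi>) * cis (x \<bullet> \<xi>)))"
      by (intro Bochner_Integration.integral_sum integrable_mult_right integrable_mult_cis lip_cs_integrable lip_cs_cis \<rho>)
    also have "\<dots> = (\<Sum>s\<in>supp \<theta>. \<theta> s * fourier \<rho> (x + s))"
      unfolding fourier_mult_cis[symmetric] by (simp add: fourier_def)
    finally show ?thesis .
  qed
  have [measurable]: "f \<in> borel_measurable borel" using f by (simp add: slow_def)
  have [measurable]: "fourier \<rho> \<in> borel_measurable borel"
    using borel_measurable_integrable[OF lip_cs_integrable[OF \<rho>]] by (intro fourier_measurable) simp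
  have int: "integrable lborel (\<lambda>x. f x * fourier \<rho> (x + s))" for s
    using pairing_integrable[OF f lip_cs_cis[OF \<rho>, of s]] by (simp add: fourier_mult_cis)
  have int': "integrable lborel (\<lambda>x. f (x - s) * fourier \<rho> x)" for s
    using lborel_integrable_shift[OF int[of s], of "- s"] by simp
  have "pairing f \<phi> = (LINT x|lborel. (\<Sum>s\<in>supp \<theta>. \<theta> s * (f x * fourier \<rho> (x + s))))"
    unfolding pairing_def by (simp add: four sum_distrib_left mult_ac)
  also have "\<dots> = (\<Sum>s\<in>supp \<theta>. \<theta> s * (LINT x|lborel. f x * fourier \<rho> (x + s)))"
    by (simp add: Bochner_Integration.integral_sum int)
  \<comment> \<open>Translation invariance moves the shift from the test function to f, where the
    sum over s becomes the action of \<theta>.\<close>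
  also have "\<dots> = (\<Sum>s\<in>supp \<theta>. \<theta> s * (LINT x|lborel. f (x - s) * fourier \<rho> x))"
  proof (intro sum.cong refl arg_cong2[where f = "(*)"])
    fix s
    show "(LINT x|lborel. f x * fourier \<rho> (x + s)) = (LINT x|lborel. f (x - s) * fourier \<rho> x)"
      using lborel_integral_shift[of "\<lambda>x. f x * fourier \<rho> (x + s)" "- s"] by simp
  qed
  also have "\<dots> = (LINT x|lborel. (\<Sum>s\<in>supp \<theta>. \<theta> s * (f (x - s) * fourier \<rho> x)))"
    by (simp add: Bochner_Integration.integral_sum int')
  also have "\<dots> = (LINT x|lborel. gr_act \<theta> f x * fourier \<rho> x)"
    by (simp add: gr_act_def sum_distrib_right mult.assoc)
  finally show ?thesis by (simp add: zero)
qed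

text \<open>Cutting \<open>\<phi>\<close> off at distance \<open>\<epsilon>\<close> from the thin set costs \<open>\<epsilon>\<^sup>1\<^sup>/\<^sup>2\<close> in the weighted \<open>L\<^sup>2\<close> norm, which
  the growth condition on \<open>f\<close> beats.\<close>

lemma pairing_zero_thin:
  fixes f :: "'a::euclidean_space \<Rightarrow> complex"
  assumes f: "slow f" and Z: "closed Z"
    and off: "\<And>\<psi>. lip_cs \<psi> \<Longrightarrow> closure {\<xi>. \<psi> \<xi> \<noteq> 0} \<inter> Z = {} \<Longrightarrow> pairing f \<psi> = 0"
    and \<phi>: "lip_cs \<phi>" and thin: "thin (closure {\<xi>. \<phi> \<xi> \<noteq> 0} \<inter> Z)"
  shows "pairing f \<phi> = 0"
proof (cases "closure {\<xi>. \<phi> \<xi> \<noteq> 0} \<inter> Z = {}")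
  case True then show ?thesis by (rule off[OF \<phi>])
next
  case ne: False
  define E where "E = closure {\<xi>. \<phi> \<xi> \<noteq> 0} \<inter> Z"
  have E: "E \<noteq> {}" "closed E" using ne Z by (auto simp: E_def)
  obtain C \<epsilon>1 where C: "0 \<le> C" "0 < \<epsilon>1" "\<And>\<epsilon>. 0 < \<epsilon> \<Longrightarrow> \<epsilon> < \<epsilon>1 \<Longrightarrow>
     \<exists>A\<in>sets borel. {\<xi>. \<exists>e\<in>E. dist e \<xi> \<le> \<epsilon>} \<subseteq> A \<and> emeasure lborel A \<le> ennreal (C * \<epsilon>)"
    using thin unfolding thin_def E_def[symmetric] by blast
  obtain L B where L: "L-lipschitz_on UNIV \<phi>" and B: "0 < B" "\<And>\<xi>. norm (\<phi> \<xi>) \<le> B"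
    using \<phi> lip_cs_bounded[OF \<phi>] by (auto simp: lip_cs_def)
  have L0: "0 \<le> L" using L by (rule lipschitz_on_nonneg)
  \<comment> \<open>The constant of \<open>fourier_weighted_bound\<close> for the cut-off function:
    \<open>B\<close> bounds its modulus, B + L bounds \<epsilon> times its Lipschitz constant, and
    2C\<epsilon> bounds the measure of its support.\<close>
  define M where "M = (2 * pi) ^ DIM('a) * (B\<^sup>2 + 2 * DIM('a) * (B + L)\<^sup>2) * (2 * C)"
  have M: "0 \<le> M" using C by (simp add: M_def)
  have bound: "norm (pairing f \<phi>) \<le> (1 + M) * \<eta>" if \<eta>: "0 < \<eta>" for \<eta>
  proof -
    obtain \<epsilon>0 where \<epsilon>0: "0 < \<epsilon>0" "\<And>\<epsilon>. 0 < \<epsilon> \<Longrightarrow> \<epsilon> < \<epsilon>0 \<Longrightarrow>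
     (\<integral>\<^sup>+x. ennreal ((norm (f x))\<^sup>2 / (1 + \<epsilon>\<^sup>2 * (norm x)\<^sup>2)) \<partial>lborel) \<le> ennreal (\<eta>\<^sup>2 / \<epsilon>)"
      using slowD[OF f zero_less_power[OF \<eta>]] by blast
    \<comment> \<open>The cutoff reaches out to distance 2\<epsilon>, so 2\<epsilon> has to stay
      below \<open>\<epsilon>1\<close>; \<epsilon> \<le> 1 is used to absorb \<epsilon>L into
      \<open>L\<close>.\<close>
    define \<epsilon> where "\<epsilon> = min 1 (min \<epsilon>0 (\<epsilon>1 / 2)) / 2"
    have \<epsilon>: "0 < \<epsilon>" "\<epsilon> \<le> 1" "\<epsilon> < \<epsilon>0" "2 * \<epsilon> < \<epsilon>1" using \<epsilon>0 C by (auto simp: \<epsilon>_def min_def)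
    \<comment> \<open>Equal to 1 within distance \<epsilon> of \<open>E\<close>, equal to 0 from
      distance 2\<epsilon> on, and linear in the distance in between.\<close>
    define \<kappa> where "\<kappa> \<xi> = max 0 (min 1 (2 - infdist \<xi> E / \<epsilon>))" for \<xi>
    have \<kappa>01: "0 \<le> \<kappa> \<xi>" "\<kappa> \<xi> \<le> 1" for \<xi> by (auto simp: \<kappa>_def)
    have \<kappa>lip: "\<bar>\<kappa> x - \<kappa> y\<bar> \<le> (1 / \<epsilon>) * dist x y" for x y
    proof -
      have "\<bar>\<kappa> x - \<kappa> y\<bar> \<le> \<bar>infdist x E / \<epsilon> - infdist y E / \<epsilon>\<bar>" by (auto simp: \<kappa>_def max_def min_def)
      also have "\<dots> = \<bar>infdist x E - infdist y E\<bar> / \<epsilon>" using \<epsilon> by (simp add: diff_divide_distrib[symmetric])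
      also have "\<dots> \<le> dist x y / \<epsilon>"
        using infdist_triangle_abs[of x E y] \<epsilon> by (intro divide_right_mono) auto
      finally show ?thesis by simp
    qed
    have near: "lip_cs (\<lambda>\<xi>. \<phi> \<xi> * complex_of_real (\<kappa> \<xi>))"
      by (rule lip_cs_mult[OF \<phi>, of "1 / \<epsilon>" _ 1])
         (use \<kappa>lip \<kappa>01 \<epsilon> in \<open>auto intro!: lipschitz_onI simp: dist_norm of_real_diff[symmetric] simp del: of_real_diff\<close>)
    have far: "lip_cs (\<lambda>\<xi>. \<phi> \<xi> * complex_of_real (1 - \<kappa> \<xi>))"
      by (rule lip_cs_mult[OF \<phi>, of "1 / \<epsilon>" _ 1])
         (use \<kappa>lip \<kappa>01 \<epsilon> in \<open>auto intro!: lipschitz_onI simp: dist_norm of_real_diff[symmetric] abs_minus_commute simp del: of_real_diff\<close>)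
    \<comment> \<open>The far part vanishes within distance \<epsilon> of \<open>E\<close>, so even
      its closed support misses \<open>Z\<close>.\<close>
    have "pairing f (\<lambda>\<xi>. \<phi> \<xi> * complex_of_real (1 - \<kappa> \<xi>)) = 0"
    proof (rule off[OF far])
      have "{\<xi>. \<phi> \<xi> * complex_of_real (1 - \<kappa> \<xi>) \<noteq> 0} \<subseteq> closure {\<xi>. \<phi> \<xi> \<noteq> 0} \<inter> {\<xi>. \<epsilon> \<le> infdist \<xi> E}"
      proof
        fix \<xi> assume "\<xi> \<in> {\<xi>. \<phi> \<xi> * complex_of_real (1 - \<kappa> \<xi>) \<noteq> 0}"
        then have \<xi>: "\<phi> \<xi> \<noteq> 0" "\<kappa> \<xi> \<noteq> 1" by auto
        have "\<epsilon> \<le> infdist \<xi> E"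
        proof (rule ccontr)
          assume "\<not> \<epsilon> \<le> infdist \<xi> E"
          then have "infdist \<xi> E / \<epsilon> \<le> 1" using \<epsilon> by simp
          then show False using \<xi>(2) by (simp add: \<kappa>_def)
        qed
        then show "\<xi> \<in> closure {\<xi>. \<phi> \<xi> \<noteq> 0} \<inter> {\<xi>. \<epsilon> \<le> infdist \<xi> E}"
          using \<xi>(1) subsetD[OF closure_subset, of \<xi> "{\<xi>. \<phi> \<xi> \<noteq> 0}"] by simp
      qed
      moreover have "closed (closure {\<xi>. \<phi> \<xi> \<noteq> 0} \<inter> {\<xi>. \<epsilon> \<le> infdist \<xi> E})"
        by (intro closed_Int closed_closure closed_Collect_le continuous_intros)
      ultimately have sub: "closure {\<xi>. \<phi> \<xi> * complex_of_real (1 - \<kappa> \<xi>) \<noteq> 0}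
          \<subseteq> closure {\<xi>. \<phi> \<xi> \<noteq> 0} \<inter> {\<xi>. \<epsilon> \<le> infdist \<xi> E}"
        by (rule closure_minimal)
      have "infdist \<xi> E = 0" if "\<xi> \<in> E" for \<xi> using that by simp
      then show "closure {\<xi>. \<phi> \<xi> * complex_of_real (1 - \<kappa> \<xi>) \<noteq> 0} \<inter> Z = {}"
        using sub \<epsilon>(1) unfolding E_def by fastforce
    qed
    then have eq: "pairing f \<phi> = pairing f (\<lambda>\<xi>. \<phi> \<xi> * complex_of_real (\<kappa> \<xi>))"
      using pairing_add[OF f near far] by (simp add: algebra_simps)
    obtain A where A: "A \<in> sets borel" "{\<xi>. \<exists>e\<in>E. dist e \<xi> \<le> 2 * \<epsilon>} \<subseteq> A" "emeasure lborel A \<le> ennreal (C * (2 * \<epsilon>))"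
      using C(3)[of "2 * \<epsilon>"] \<epsilon> by auto
    have "{\<xi>. \<phi> \<xi> * complex_of_real (\<kappa> \<xi>) \<noteq> 0} \<subseteq> A"
    proof
      fix \<xi> assume "\<xi> \<in> {\<xi>. \<phi> \<xi> * complex_of_real (\<kappa> \<xi>) \<noteq> 0}"
      then have "\<kappa> \<xi> \<noteq> 0" by auto
      then have "infdist \<xi> E / \<epsilon> < 2" by (auto simp: \<kappa>_def max_def min_def split: if_splits)
      then have "infdist \<xi> E \<le> 2 * \<epsilon>" using \<epsilon> by (simp add: field_simps)
      moreover obtain e where "e \<in> E" "infdist \<xi> E = dist \<xi> e" using infdist_attains_inf[OF E(2,1)] by blast
      ultimately show "\<xi> \<in> A" using A(2) by (auto simp: dist_commute)
    qed
    then have "emeasure lborel {\<xi>. \<phi> \<xi> * complex_of_real (\<kappa> \<xi>) \<noteq> 0} \<le> emeasure lborel A"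
      by (rule emeasure_mono) (use A in simp)
    then have meas: "emeasure lborel {\<xi>. \<phi> \<xi> * complex_of_real (\<kappa> \<xi>) \<noteq> 0} \<le> ennreal (C * (2 * \<epsilon>))"
      using A(3) by (rule order_trans)
    have lip: "(B * (1 / \<epsilon>) + 1 * L)-lipschitz_on UNIV (\<lambda>\<xi>. \<phi> \<xi> * complex_of_real (\<kappa> \<xi>))"
      by (rule lipschitz_mult_on_support[OF L B(2)])
         (use \<kappa>lip \<kappa>01 \<epsilon> in \<open>auto intro!: lipschitz_onI simp: dist_norm of_real_diff[symmetric] simp del: of_real_diff\<close>)
    have nB: "norm (\<phi> \<xi> * complex_of_real (\<kappa> \<xi>)) \<le> B" for \<xi>
      using mult_mono[OF B(2)[of \<xi>] \<kappa>01(2)[of \<xi>]] \<kappa>01 B(1) by (simp add: norm_mult)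
    have \<epsilon>L: "(\<epsilon> * (B * (1 / \<epsilon>) + 1 * L))\<^sup>2 \<le> (B + L)\<^sup>2"
    proof (rule power_mono)
      have "\<epsilon> * (B * (1 / \<epsilon>) + 1 * L) = B + \<epsilon> * L" using \<epsilon> by (simp add: field_simps)
      also have "\<dots> \<le> B + L" using \<epsilon> L0 by (simp add: mult_left_le_one_le)
      finally show "\<epsilon> * (B * (1 / \<epsilon>) + 1 * L) \<le> B + L" .
      show "0 \<le> \<epsilon> * (B * (1 / \<epsilon>) + 1 * L)" using \<epsilon> B L0 by simp
    qed
    have "(\<integral>\<^sup>+x. ennreal ((1 + \<epsilon>\<^sup>2 * (norm x)\<^sup>2) * (norm (fourier (\<lambda>\<xi>. \<phi> \<xi> * complex_of_real (\<kappa> \<xi>)) x))\<^sup>2) \<partial>lborel)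
      \<le> ennreal ((2 * pi) ^ DIM('a) * (B\<^sup>2 + 2 * DIM('a) * (\<epsilon> * (B * (1 / \<epsilon>) + 1 * L))\<^sup>2)) *
          emeasure lborel {\<xi>. \<phi> \<xi> * complex_of_real (\<kappa> \<xi>) \<noteq> 0}"
      by (rule fourier_weighted_bound[OF lip nB]) (use near in \<open>simp add: lip_cs_def\<close>)
    also have "\<dots> \<le> ennreal ((2 * pi) ^ DIM('a) * (B\<^sup>2 + 2 * DIM('a) * (B + L)\<^sup>2)) * ennreal (C * (2 * \<epsilon>))"
      by (intro mult_mono ennreal_leI mult_left_mono add_left_mono \<epsilon>L meas) auto
    also have "\<dots> = ennreal (M * \<epsilon>)" using C(1) \<epsilon> by (simp add: M_def ennreal_mult[symmetric] mult_ac)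
    finally have w: "(\<integral>\<^sup>+x. ennreal ((1 + \<epsilon>\<^sup>2 * (norm x)\<^sup>2) * (norm (fourier (\<lambda>\<xi>. \<phi> \<xi> * complex_of_real (\<kappa> \<xi>)) x))\<^sup>2) \<partial>lborel)
       \<le> ennreal (M * \<epsilon>)" .
    \<comment> \<open>The parameter \<epsilon>/\<eta> balances the growth \<eta>^2/\<epsilon> of f
      against the norm M\<epsilon> of the test function; both terms become multiples of \<eta>, and
      \<epsilon> cancels.\<close>
    have "norm (pairing f \<phi>) \<le> (\<epsilon> / \<eta>) * (\<eta>\<^sup>2 / \<epsilon>) + (M * \<epsilon>) / (\<epsilon> / \<eta>)"
      unfolding eq unfolding pairing_def
      by (rule weighted_pairing_bound(2)[OF _ _ \<epsilon>0(2)[OF \<epsilon>(1,3)] _ w])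
         (use f M \<epsilon> \<eta> lipschitz_measurable[OF lip] in \<open>auto simp: slow_def intro!: fourier_measurable\<close>)
    also have "\<dots> = (1 + M) * \<eta>" using \<epsilon> \<eta> by (simp add: field_simps power2_eq_square)
    finally show ?thesis .
  qed
  show ?thesis
  proof (rule ccontr)
    assume "pairing f \<phi> \<noteq> 0"
    then have "norm (pairing f \<phi>) \<le> (1 + M) * (norm (pairing f \<phi>) / (2 * (1 + M)))"
      using M by (intro bound) simp
    also have "\<dots> = norm (pairing f \<phi>) / 2" using M by (simp add: field_simps)
    finally show False using \<open>pairing f \<phi> \<noteq> 0\<close> by simp
  qed
qed

lemma exp_sum_lipschitz:
  fixes c :: "'a::euclidean_space \<Rightarrow> complex"
  shows "(\<Sum>s\<in>T. norm (c s) * norm s)-lipschitz_on UNIV (\<lambda>\<xi>. \<Sum>s\<in>T. c s * cis (s \<bullet> \<xi>))"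
proof (rule lipschitz_onI)
  fix x y :: 'a
  have "dist (\<Sum>s\<in>T. c s * cis (s \<bullet> x)) (\<Sum>s\<in>T. c s * cis (s \<bullet> y)) = norm (\<Sum>s\<in>T. c s * (cis (s \<bullet> x) - cis (s \<bullet> y)))"
    by (simp add: dist_norm sum_subtractf right_diff_distrib)
  also have "\<dots> \<le> (\<Sum>s\<in>T. norm (c s * (cis (s \<bullet> x) - cis (s \<bullet> y))))" by (rule norm_sum)
  also have "\<dots> \<le> (\<Sum>s\<in>T. norm (c s) * (norm s * dist x y))"
  proof (rule sum_mono)
    fix s
    have "norm (cis (s \<bullet> x) - cis (s \<bullet> y)) \<le> \<bar>s \<bullet> (x - y)\<bar>"
      unfolding inner_diff_right by (rule norm_cis_diff_le)
    also have "\<dots> \<le> norm s * dist x y" unfolding dist_norm by (rule Cauchy_Schwarz_ineq2)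
    finally show "norm (c s * (cis (s \<bullet> x) - cis (s \<bullet> y))) \<le> norm (c s) * (norm s * dist x y)"
      unfolding norm_mult by (rule mult_left_mono) simp
  qed
  also have "\<dots> = (\<Sum>s\<in>T. norm (c s) * norm s) * dist x y" by (simp add: sum_distrib_right mult.assoc)
  finally show "dist (\<Sum>s\<in>T. c s * cis (s \<bullet> x)) (\<Sum>s\<in>T. c s * cis (s \<bullet> y)) \<le> (\<Sum>s\<in>T. norm (c s) * norm s) * dist x y" .
qed (auto intro!: sum_nonneg)

text \<open>Vandermonde: pair the vanishing power sums with the coefficients of
  \<open>\<Prod>\<^sub>s\<^sub>\<noteq>\<^sub>t (X - \<mu> s)\<close>.\<close>

lemma power_sums_not_all_zero:
  fixes c \<mu> :: "'a \<Rightarrow> complex"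
  assumes T: "finite T" "t \<in> T" and c: "c t \<noteq> 0" and inj: "inj_on \<mu> T"
  shows "\<exists>j<card T. (\<Sum>s\<in>T. c s * \<mu> s ^ j) \<noteq> 0"
proof (rule ccontr)
  assume neg: "\<not> ?thesis"
  define q where "q = (\<Prod>s\<in>T - {t}. [:- \<mu> s, 1:])"
  have "degree q = card (T - {t})" unfolding q_def by (subst degree_prod_eq_sum_degree) auto
  moreover have "0 < card T" using T by (auto simp: card_gt_0_iff)
  ultimately have deg: "degree q < card T" using T by simp
  have "(\<Sum>s\<in>T. c s * poly q (\<mu> s)) = (\<Sum>s\<in>T. \<Sum>j\<le>degree q. coeff q j * (c s * \<mu> s ^ j))"
    by (simp add: poly_altdef sum_distrib_left mult_ac)
  also have "\<dots> = (\<Sum>j\<le>degree q. coeff q j * (\<Sum>s\<in>T. c s * \<mu> s ^ j))"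
    by (subst sum.swap) (simp add: sum_distrib_left)
  also have "\<dots> = 0" using neg deg by (intro sum.neutral) auto
  finally have "(\<Sum>s\<in>T. c s * poly q (\<mu> s)) = 0" .
  moreover have "(\<Sum>s\<in>T. c s * poly q (\<mu> s)) = (\<Sum>s\<in>{t}. c s * poly q (\<mu> s))"
    by (rule sum.mono_neutral_right) (use T in \<open>auto simp: q_def poly_prod\<close>)
  ultimately have "poly q (\<mu> t) = 0" using c by simp
  then show False using inj T by (auto simp: q_def poly_prod inj_on_def)
qed

text \<open>\<open>S k\<close> consists of the frequencies where \<open>F\<close> vanishes to order at least \<open>k\<close> in the direction
  \<open>v\<close>. Away from \<open>S (k + 1)\<close>, the set \<open>S k\<close> lies on a smooth hypersurface \<open>F (k - 1) = 0\<close> transversal to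
  \<open>v\<close>.\<close>

lemma pairing_zero:
  fixes f :: "'a::euclidean_space \<Rightarrow> complex"
  assumes f: "slow f" and \<theta>: "finite (supp \<theta>)" "supp \<theta> \<noteq> {}" and zero: "\<And>x. gr_act \<theta> f x = 0" and \<phi>: "lip_cs \<phi>"
  shows "pairing f \<phi> = 0"
proof -
  obtain v where v: "inj_on (\<lambda>a. a \<bullet> v) (supp \<theta>)" using exists_separating_vector[OF \<theta>(1)] by blast
  \<comment> \<open>The coefficients of the k-th derivative of F in the direction
    \<open>v\<close>.\<close>
  define c where "c k s = \<theta> s * (\<i> * complex_of_real (s \<bullet> v)) ^ k" for k s
  define F where "F k \<xi> = (\<Sum>s\<in>supp \<theta>. c k s * cis (s \<bullet> \<xi>))" for k \<xi>
  define L where "L k = (\<Sum>s\<in>supp \<theta>. norm (c k s) * norm s)" for k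
  have L: "(L k)-lipschitz_on UNIV (F k)" for k
    unfolding F_def[abs_def] L_def by (rule exp_sum_lipschitz)
  have cont: "continuous_on UNIV (F k)" for k by (rule lipschitz_on_continuous_on[OF L])
  define S where "S k = {\<xi>. \<forall>j<k. F j \<xi> = 0}" for k
  have closed: "closed (S k)" for k
  proof -
    have "S k = (\<Inter>j\<in>{..<k}. {\<xi>. F j \<xi> = 0})" by (auto simp: S_def)
    then show ?thesis using cont by (auto intro!: closed_INT closed_Collect_eq continuous_on_const)
  qed
  have deriv: "((\<lambda>t. F k (\<xi> + t *\<^sub>R v)) has_vector_derivative F (Suc k) (\<xi> + t *\<^sub>R v)) (at t)" for k \<xi> t
  proof -
    have "((\<lambda>t. c k s * cis (s \<bullet> (\<xi> + t *\<^sub>R v))) has_vector_derivative c (Suc k) s * cis (s \<bullet> (\<xi> + t *\<^sub>R v))) (at t)" for s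
    proof -
      have "((\<lambda>t. c k s * exp (\<i> * complex_of_real (s \<bullet> \<xi>) + complex_of_real t * (\<i> * complex_of_real (s \<bullet> v)))) has_vector_derivative
          c k s * (exp (\<i> * complex_of_real (s \<bullet> \<xi>) + complex_of_real t * (\<i> * complex_of_real (s \<bullet> v))) * (\<i> * complex_of_real (s \<bullet> v)))) (at t)"
        by (rule has_vector_derivative_real_field) (auto intro!: derivative_eq_intros)
      moreover have "cis (s \<bullet> (\<xi> + t *\<^sub>R v)) = exp (\<i> * complex_of_real (s \<bullet> \<xi>) + complex_of_real t * (\<i> * complex_of_real (s \<bullet> v)))" for t
        by (simp add: cis_conv_exp inner_add_right algebra_simps)
      ultimately show ?thesis by (simp add: c_def mult_ac)
    qed
    then show ?thesis unfolding F_def by (intro has_vector_derivative_sum)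
  qed
  \<comment> \<open>The induction enlarges the class of admissible test functions: as k grows,
    \<open>S (Suc k)\<close> shrinks and the support condition becomes weaker.\<close>
  have main: "pairing f \<psi> = 0" if "lip_cs \<psi>" "closure {\<xi>. \<psi> \<xi> \<noteq> 0} \<inter> S (Suc k) = {}" for k \<psi>
    using that
  proof (induction k arbitrary: \<psi>)
    case 0
    have "F 0 = (\<lambda>\<xi>. \<Sum>s\<in>supp \<theta>. \<theta> s * cis (s \<bullet> \<xi>))" by (auto simp: F_def c_def)
    moreover have "S (Suc 0) = {\<xi>. F 0 \<xi> = 0}" by (auto simp: S_def)
    ultimately show ?case using pairing_zero_off_zeros[OF f \<theta>(1) zero 0(1) _ L[of 0]] 0(2) by simp
  next
    case (Suc k)
    define E where "E = closure {\<xi>. \<psi> \<xi> \<noteq> 0} \<inter> S (Suc k)"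
    have comp: "compact E"
      unfolding E_def using Suc.prems(1) by (intro compact_Int_closed closed) (simp add: lip_cs_def compact_closure)
    have "thin E"
    proof (rule thin_compact[OF comp])
      fix x assume x: "x \<in> E"
      have "F (Suc k) x \<noteq> 0"
      proof
        assume "F (Suc k) x = 0"
        then have "x \<in> S (Suc (Suc k))" using x by (auto simp: E_def S_def less_Suc_eq)
        then show False using x Suc.prems(2) by (auto simp: E_def)
      qed
      \<comment> \<open>Multiplying by this conjugate makes the derivative along \<open>v\<close>
        real and positive at \<open>x\<close>. Of the two real equations contained in F = 0 only the
        real part is kept, since one of them suffices for a hypersurface; \<open>d\<close> is half
        of the derivative at \<open>x\<close>.\<close>
      define \<alpha> where "\<alpha> = cnj (F (Suc k) x)"
      define G where "G \<xi> = Re (\<alpha> * F k \<xi>)" for \<xi>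
      define d where "d = (norm (F (Suc k) x))\<^sup>2 / 2"
      have d: "0 < d" using \<open>F (Suc k) x \<noteq> 0\<close> by (simp add: d_def)
      have "Re (\<alpha> * F (Suc k) x) = (norm (F (Suc k) x))\<^sup>2"
        using complex_norm_square[of "F (Suc k) x"] by (metis Re_complex_of_real \<alpha>_def mult.commute)
      then have dx: "d < Re (\<alpha> * F (Suc k) x)" using d by (simp add: d_def)
      have "open {\<xi>. d < Re (\<alpha> * F (Suc k) \<xi>)}"
        by (intro open_Collect_less continuous_intros cont)
      then obtain r where r: "0 < r" "ball x r \<subseteq> {\<xi>. d < Re (\<alpha> * F (Suc k) \<xi>)}"
        using dx by (meson mem_Collect_eq open_contains_ball)
      have lipG: "(norm \<alpha> * L k)-lipschitz_on UNIV G"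
      proof (rule lipschitz_onI)
        fix x y
        have "dist (G x) (G y) = \<bar>Re (\<alpha> * (F k x - F k y))\<bar>" by (simp add: G_def dist_real_def right_diff_distrib)
        also have "\<dots> \<le> norm (\<alpha> * (F k x - F k y))" by (rule abs_Re_le_cmod)
        also have "\<dots> \<le> norm \<alpha> * (L k * dist x y)"
          using lipschitz_onD[OF L, of x y k] by (simp add: norm_mult dist_norm mult_left_mono)
        finally show "dist (G x) (G y) \<le> norm \<alpha> * L k * dist x y" by simp
      qed (use lipschitz_on_nonneg[OF L] in simp)
      have "thin ({\<xi>. G \<xi> = 0} \<inter> ball x (r / 2))"
      proof (rule thin_level_set[OF lipG d r(1)])
        fix \<xi> t assume t: "0 \<le> t" "\<xi> \<in> ball x r" "\<xi> + t *\<^sub>R v \<in> ball x r"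
        show "G \<xi> + d * t \<le> G (\<xi> + t *\<^sub>R v)"
        proof (cases "t = 0")
          case False
          then have "0 < t" using t by simp
          have dG: "((\<lambda>t. G (\<xi> + t *\<^sub>R v)) has_real_derivative Re (\<alpha> * F (Suc k) (\<xi> + u *\<^sub>R v))) (at u)" for u
          proof -
            have "((\<lambda>t. \<alpha> * F k (\<xi> + t *\<^sub>R v)) has_vector_derivative \<alpha> * F (Suc k) (\<xi> + u *\<^sub>R v)) (at u)"
              by (rule bounded_linear.has_vector_derivative[OF bounded_linear_mult_right deriv])
            then show ?thesis
              unfolding G_def has_real_derivative_iff_has_vector_derivative
              by (rule bounded_linear.has_vector_derivative[OF bounded_linear_Re])
          qed
          obtain z where z: "0 < z" "z < t" "G (\<xi> + t *\<^sub>R v) - G (\<xi> + 0 *\<^sub>R v) = (t - 0) * Re (\<alpha> * F (Suc k) (\<xi> + z *\<^sub>R v))"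
            using MVT2[OF \<open>0 < t\<close>, of "\<lambda>t. G (\<xi> + t *\<^sub>R v)" "\<lambda>u. Re (\<alpha> * F (Suc k) (\<xi> + u *\<^sub>R v))"] dG by blast
          \<comment> \<open>The intermediate point lies between two points of the ball, where the
            derivative exceeds \<open>d\<close>.\<close>
          have "(1 - z / t) *\<^sub>R \<xi> + (z / t) *\<^sub>R (\<xi> + t *\<^sub>R v) \<in> ball x r"
            by (rule convexD[OF convex_ball t(2,3)]) (use z in auto)
          moreover have "(1 - z / t) *\<^sub>R \<xi> + (z / t) *\<^sub>R (\<xi> + t *\<^sub>R v) = \<xi> + z *\<^sub>R v"
            using \<open>0 < t\<close> by (simp add: algebra_simps)
          ultimately have "d < Re (\<alpha> * F (Suc k) (\<xi> + z *\<^sub>R v))" using r(2) by auto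
          then have "t * d \<le> t * Re (\<alpha> * F (Suc k) (\<xi> + z *\<^sub>R v))" using \<open>0 < t\<close> by simp
          then show ?thesis using z(3) by (simp add: mult.commute)
        qed simp
      qed
      moreover have "E \<inter> ball x (r / 2) \<subseteq> {\<xi>. G \<xi> = 0} \<inter> ball x (r / 2)" by (auto simp: E_def S_def G_def)
      ultimately show "\<exists>r>0. thin (E \<inter> ball x r)" using r(1) thin_subset by (metis half_gt_zero)
    qed
    then show ?case
      by (intro pairing_zero_thin[OF f closed[of "Suc k"] _ Suc.prems(1)] Suc.IH) (simp_all add: E_def)
  qed
  \<comment> \<open>At a point of this set the coefficients \<theta>(s)cis(s\<bullet>\<xi>), none of
    them 0, would have vanishing power sums with respect to the distinct numbers
    i(s\<bullet>v).\<close>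
  have "S (Suc (card (supp \<theta>))) = {}"
  proof (rule ccontr)
    assume "S (Suc (card (supp \<theta>))) \<noteq> {}"
    then obtain \<xi> where \<xi>: "\<And>j. j \<le> card (supp \<theta>) \<Longrightarrow> F j \<xi> = 0" by (auto simp: S_def less_Suc_eq_le)
    obtain t where t: "t \<in> supp \<theta>" using \<theta>(2) by blast
    have "inj_on (\<lambda>s. \<i> * complex_of_real (s \<bullet> v)) (supp \<theta>)" using v by (simp add: inj_on_def)
    then obtain j where "j < card (supp \<theta>)" "(\<Sum>s\<in>supp \<theta>. (\<theta> s * cis (s \<bullet> \<xi>)) * (\<i> * complex_of_real (s \<bullet> v)) ^ j) \<noteq> 0"
      using power_sums_not_all_zero[OF \<theta>(1) t, of "\<lambda>s. \<theta> s * cis (s \<bullet> \<xi>)"] t by (auto simp: supp_def)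
    then show False using \<xi>[of j] by (simp add: F_def c_def mult_ac)
  qed
  then show ?thesis using main[OF \<phi>] by blast
qed

section \<open>Approximate identity\<close>

lemma lborel_integral_affine:
  fixes f :: "'a::euclidean_space \<Rightarrow> complex"
  assumes [measurable]: "f \<in> borel_measurable borel" and c: "0 < c"
  shows "(LINT x|lborel. f x) = c ^ DIM('a) * (LINT x|lborel. f (t + c *\<^sub>R x))"
proof -
  have "(LINT x|lborel. f x) = (LINT x|density (distr lborel borel (\<lambda>x. t + c *\<^sub>R x)) (\<lambda>_. ennreal (c ^ DIM('a))). f x)"
    by (subst lborel_affine[of c t]) (use c in \<open>simp_all add: ennreal_power\<close>)
  also have "\<dots> = (LINT x|distr lborel borel (\<lambda>x. t + c *\<^sub>R x). (c ^ DIM('a)) *\<^sub>R f x)"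
    by (rule integral_density) (use c in auto)
  also have "\<dots> = (LINT x|lborel. (c ^ DIM('a)) *\<^sub>R f (t + c *\<^sub>R x))"
    by (rule integral_distr) auto
  finally show ?thesis by (simp add: scaleR_conv_of_real)
qed

definition tent :: "'a::euclidean_space \<Rightarrow> complex" where
  "tent \<xi> = complex_of_real (max 0 (1 - norm \<xi>))"

text \<open>The autocorrelation of \<open>tent\<close>. It is still a test function, and its
  transform is a squared modulus, hence non-negative and, by the Bessel inequality,
  integrable.\<close>

definition tent2 :: "'a::euclidean_space \<Rightarrow> complex" where
  "tent2 \<xi> = (LINT \<eta>|lborel. tent (\<xi> + \<eta>) * tent \<eta>)"

lemma tent_lipschitz: "1-lipschitz_on UNIV tent"
proof (rule lipschitz_onI)
  fix x y :: 'a
  have "dist (tent x) (tent y) = \<bar>max 0 (1 - norm x) - max 0 (1 - norm y)\<bar>"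
    by (simp only: tent_def dist_norm of_real_diff[symmetric] norm_of_real)
  also have "\<dots> \<le> \<bar>norm x - norm y\<bar>" by (auto simp: max_def)
  also have "\<dots> \<le> 1 * dist x y" by (simp add: dist_norm norm_triangle_ineq3)
  finally show "dist (tent x) (tent y) \<le> 1 * dist x y" .
qed simp

lemma tent_support: "tent \<xi> \<noteq> 0 \<Longrightarrow> norm \<xi> < 1"
  by (auto simp: tent_def max_def split: if_splits)

lemma tent_le_one: "norm (tent \<xi>) \<le> 1"
  by (auto simp: tent_def)

lemma lip_cs_tent: "lip_cs tent"
  unfolding lip_cs_def
  by (intro conjI exI[of _ 1] tent_lipschitz bounded_subset[OF bounded_ball[of 0 1]])
     (use tent_support in auto)

lemma tent_measurable [measurable]: "tent \<in> borel_measurable borel"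
  by (rule lipschitz_measurable[OF tent_lipschitz])

lemma integrable_tent_mult: "integrable lborel (\<lambda>\<eta>. tent (\<xi> + \<eta>) * tent \<eta>)"
  by (rule Bochner_Integration.integrable_bound[OF lip_cs_integrable[OF lip_cs_tent]])
     (auto simp: norm_mult mult_left_le_one_le tent_le_one)

lemma lip_cs_tent2: "lip_cs (tent2 :: 'a::euclidean_space \<Rightarrow> complex)"
  unfolding lip_cs_def
proof
  define A where "A = (LINT \<eta>|lborel. norm (tent (\<eta>::'a)))"
  have int: "integrable lborel (\<lambda>\<eta>::'a. norm (tent \<eta>))"
    by (rule integrable_norm[OF lip_cs_integrable[OF lip_cs_tent]])
  have "A-lipschitz_on UNIV (tent2 :: 'a \<Rightarrow> complex)"
  proof (rule lipschitz_onI)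
    fix x y :: 'a
    have "tent2 x - tent2 y = (LINT \<eta>|lborel. (tent (x + \<eta>) - tent (y + \<eta>)) * tent \<eta>)"
      unfolding tent2_def left_diff_distrib
      by (rule Bochner_Integration.integral_diff[symmetric]) (rule integrable_tent_mult)+
    also have "norm \<dots> \<le> (LINT \<eta>|lborel. norm ((tent (x + \<eta>) - tent (y + \<eta>)) * tent \<eta>))"
      by (rule integral_norm_bound)
    also have "\<dots> \<le> (LINT \<eta>|lborel. dist x y * norm (tent (\<eta>::'a)))"
    proof (rule Bochner_Integration.integral_mono)
      have "integrable lborel (\<lambda>\<eta>. (tent (x + \<eta>) - tent (y + \<eta>)) * tent \<eta>)"
        unfolding left_diff_distrib by (intro Bochner_Integration.integrable_diff integrable_tent_mult)
      then show "integrable lborel (\<lambda>\<eta>. norm ((tent (x + \<eta>) - tent (y + \<eta>)) * tent \<eta>))" by simp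
      show "integrable lborel (\<lambda>\<eta>::'a. dist x y * norm (tent \<eta>))" using int by simp
      show "norm ((tent (x + \<eta>) - tent (y + \<eta>)) * tent \<eta>) \<le> dist x y * norm (tent \<eta>)" for \<eta>
        using lipschitz_onD[OF tent_lipschitz, of "x + \<eta>" "y + \<eta>"]
        by (auto simp: norm_mult dist_norm intro!: mult_right_mono)
    qed
    also have "\<dots> = A * dist x y" by (simp add: A_def)
    finally show "dist (tent2 x) (tent2 y) \<le> A * dist x y" by (simp add: dist_norm)
  qed (simp add: A_def)
  then show "\<exists>L. L-lipschitz_on UNIV (tent2 :: 'a \<Rightarrow> complex)" by blast
  have "norm \<xi> < 2" if \<xi>: "tent2 \<xi> \<noteq> 0" for \<xi> :: 'a
  proof (rule ccontr)
    assume n: "\<not> norm \<xi> < 2"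
    have "tent (\<xi> + \<eta>) * tent \<eta> = 0" for \<eta>
    proof (rule ccontr)
      assume "tent (\<xi> + \<eta>) * tent \<eta> \<noteq> 0"
      then have "norm (\<xi> + \<eta>) < 1" "norm \<eta> < 1" using tent_support by auto
      then show False using n norm_triangle_ineq4[of "\<xi> + \<eta>" \<eta>] by simp
    qed
    then have "(\<lambda>\<eta>. tent (\<xi> + \<eta>) * tent \<eta>) = (\<lambda>_. 0)" by (rule ext)
    then show False using \<xi> unfolding tent2_def by simp
  qed
  then show "bounded {\<xi>::'a. tent2 \<xi> \<noteq> 0}" by (intro bounded_subset[OF bounded_ball[of 0 2]]) auto
qed

lemma fourier_tent2:
  fixes x :: "'a::euclidean_space"
  shows "fourier tent2 x = complex_of_real ((norm (fourier tent x))\<^sup>2)"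
proof -
  have ib: "integrable lborel (indicator (ball 0 2) :: 'a \<Rightarrow> real)"
    by (intro integrable_real_indicator emeasure_lborel_ball_finite) simp
  have nt: "integrable lborel (\<lambda>\<eta>::'a. norm (tent \<eta>))"
    by (rule integrable_norm[OF lip_cs_integrable[OF lip_cs_tent]])
  have le: "norm (tent (\<xi> + \<eta>) * tent \<eta> * cis (x \<bullet> \<xi>)) \<le> indicator (ball 0 2) \<xi> * norm (tent \<eta>)" for \<xi> \<eta>
  proof (cases "tent (\<xi> + \<eta>) * tent \<eta> = 0")
    case False
    then have "norm (\<xi> + \<eta>) < 1" "norm \<eta> < 1" using tent_support by auto
    then have "norm \<xi> < 2" using norm_triangle_ineq4[of "\<xi> + \<eta>" \<eta>] by simp
    then show ?thesis using tent_le_one[of "\<xi> + \<eta>"] by (simp add: norm_mult mult_left_le_one_le)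
  qed (auto simp: norm_mult)
  have "integrable (lborel \<Otimes>\<^sub>M lborel) (\<lambda>(\<xi>, \<eta>). tent (\<xi> + \<eta>) * tent \<eta> * cis (x \<bullet> \<xi>))"
    by (rule integrable_lborel_pair_bound[OF ib nt]) (use le in auto)
  note sw = lborel_pair.Fubini_integral[OF this]
  have "fourier tent2 x = (LINT \<xi>|lborel. LINT \<eta>|lborel. tent (\<xi> + \<eta>) * tent \<eta> * cis (x \<bullet> \<xi>))"
    by (simp add: fourier_def tent2_def)
  also have "\<dots> = (LINT \<eta>|lborel. LINT \<xi>|lborel. tent (\<xi> + \<eta>) * tent \<eta> * cis (x \<bullet> \<xi>))"
    using sw by simp
  also have "\<dots> = (LINT \<eta>|lborel. tent \<eta> * cis (- (x \<bullet> \<eta>)) * fourier tent x)"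
  proof (rule Bochner_Integration.integral_cong[OF refl])
    fix \<eta> :: 'a
    have "(LINT \<xi>|lborel. tent (\<xi> + \<eta>) * tent \<eta> * cis (x \<bullet> \<xi>))
      = (LINT \<xi>|lborel. tent \<eta> * cis (- (x \<bullet> \<eta>)) * (tent (\<xi> + \<eta>) * cis (x \<bullet> (\<xi> + \<eta>))))"
    proof (rule Bochner_Integration.integral_cong[OF refl])
      fix \<xi>
      have "cis (x \<bullet> \<xi>) = cis (- (x \<bullet> \<eta>)) * cis (x \<bullet> (\<xi> + \<eta>))" by (simp add: cis_mult inner_add_right)
      then show "tent (\<xi> + \<eta>) * tent \<eta> * cis (x \<bullet> \<xi>) = tent \<eta> * cis (- (x \<bullet> \<eta>)) * (tent (\<xi> + \<eta>) * cis (x \<bullet> (\<xi> + \<eta>)))"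
        by simp
    qed
    also have "\<dots> = tent \<eta> * cis (- (x \<bullet> \<eta>)) * (LINT \<xi>|lborel. tent (\<xi> + \<eta>) * cis (x \<bullet> (\<xi> + \<eta>)))"
      by (rule integral_mult_right_zero)
    also have "(LINT \<xi>|lborel. tent (\<xi> + \<eta>) * cis (x \<bullet> (\<xi> + \<eta>))) = fourier tent x"
      unfolding fourier_def by (rule lborel_integral_shift[where f = "\<lambda>\<xi>. tent \<xi> * cis (x \<bullet> \<xi>)"]) simp
    finally show "(LINT \<xi>|lborel. tent (\<xi> + \<eta>) * tent \<eta> * cis (x \<bullet> \<xi>)) = tent \<eta> * cis (- (x \<bullet> \<eta>)) * fourier tent x" .
  qed
  also have "\<dots> = (LINT \<eta>|lborel. tent \<eta> * cis (- (x \<bullet> \<eta>))) * fourier tent x"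
    by (rule integral_mult_left_zero)
  \<comment> \<open>\<open>tent\<close> is real-valued, so conjugation affects only the
    exponential.\<close>
  also have "(LINT \<eta>|lborel. tent \<eta> * cis (- (x \<bullet> \<eta>))) = cnj (fourier tent x)"
    unfolding fourier_def by (simp add: Bochner_Integration.integral_cnj[symmetric] cis_cnj tent_def)
  finally show ?thesis using complex_norm_square[of "fourier tent x"] by (simp add: mult.commute)
qed

text \<open>The analogue of the Fejer kernel, with \<open>tent\<close> in place of the indicator
  function of an interval.\<close>

definition fejer :: "'a::euclidean_space \<Rightarrow> real" where
  "fejer x = (norm (fourier tent x))\<^sup>2"

lemma fejer_nonneg: "0 \<le> fejer x"
  by (simp add: fejer_def)

lemma fejer_measurable [measurable]: "fejer \<in> borel_measurable borel"
  unfolding fejer_def[abs_def] using fourier_measurable[OF tent_measurable] by measurable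

lemma fejer_integrable: "integrable lborel (fejer :: 'a::euclidean_space \<Rightarrow> real)"
proof -
  have "ennreal ((norm (tent \<xi>))\<^sup>2) \<le> indicator (ball 0 1) \<xi>" for \<xi> :: 'a
    using tent_support[of \<xi>] power_le_one[OF norm_ge_zero tent_le_one[of \<xi>], of 2]
    by (cases "tent \<xi> = 0") (auto simp: ennreal_1[symmetric] ennreal_leI simp del: ennreal_1)
  then have "(\<integral>\<^sup>+\<xi>. ennreal ((norm (tent (\<xi>::'a)))\<^sup>2) \<partial>lborel) \<le> (\<integral>\<^sup>+\<xi>. indicator (ball (0::'a) 1) \<xi> \<partial>lborel)"
    by (rule nn_integral_mono)
  also have "\<dots> < \<infinity>" using emeasure_lborel_ball_finite[of "0::'a" 1] by simp
  finally have "(\<integral>\<^sup>+x. ennreal (fejer (x::'a)) \<partial>lborel) < \<infinity>"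
    using fourier_bessel[OF lip_cs_integrable[OF lip_cs_tent], where 'a='a]
    unfolding fejer_def by (auto simp: ennreal_mult_less_top intro: le_less_trans)
  then show ?thesis unfolding integrable_iff_bounded by (simp add: fejer_def)
qed

text \<open>At 0 the transform of \<open>tent\<close> equals its integral A > 0. For |x| < 1/2 the
  exponentials stay within 1/2 of 1 on the unit ball, so the transform has modulus at least A/2
  there.\<close>

lemma fejer_pos: "0 < (LINT x|lborel. fejer (x::'a::euclidean_space))"
proof -
  define A where "A = (LINT \<xi>|lborel. norm (tent (\<xi>::'a)))"
  have int: "integrable lborel (tent :: 'a \<Rightarrow> complex)" by (rule lip_cs_integrable[OF lip_cs_tent])
  have Apos: "0 < A"
  proof -
    have "(1 / 2) * indicator (ball 0 (1 / 2)) \<xi> \<le> norm (tent \<xi>)" for \<xi> :: 'a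
      by (auto simp: tent_def indicator_def)
    then have "(LINT \<xi>|lborel. (1 / 2) * indicator (ball (0::'a) (1 / 2)) \<xi>) \<le> A"
      unfolding A_def using int by (intro Bochner_Integration.integral_mono) (auto intro!: integrable_real_indicator emeasure_lborel_ball_finite)
    moreover have "0 < measure lborel (ball (0::'a) (1 / 2))" by (rule content_ball_pos) simp
    moreover have "(LINT \<xi>|lborel. (1 / 2) * indicator (ball (0::'a) (1 / 2)) \<xi>) = measure lborel (ball (0::'a) (1 / 2)) / 2" by simp
    ultimately show ?thesis by linarith
  qed
  have f0: "fourier tent (0::'a) = complex_of_real A"
    unfolding fourier_def A_def by (simp add: integral_complex_of_real[symmetric] tent_def del: integral_complex_of_real)
  have low: "A / 2 \<le> norm (fourier tent x)" if x: "x \<in> ball 0 (1 / 2)" for x :: 'a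
  proof -
    have "fourier tent (0::'a) - fourier tent x = (LINT \<xi>|lborel. tent \<xi> * (1 - cis (x \<bullet> \<xi>)))"
      unfolding fourier_def
      by (subst Bochner_Integration.integral_diff[symmetric]) (auto intro!: integrable_mult_cis int simp: right_diff_distrib)
    also have "norm \<dots> \<le> (LINT \<xi>|lborel. norm (tent \<xi> * (1 - cis (x \<bullet> \<xi>))))" by (rule integral_norm_bound)
    also have "\<dots> \<le> (LINT \<xi>|lborel. norm (tent (\<xi>::'a)) * (1 / 2))"
    proof (rule Bochner_Integration.integral_mono)
      show "integrable lborel (\<lambda>\<xi>. norm (tent \<xi> * (1 - cis (x \<bullet> \<xi>))))"
        using integrable_mult_cis[OF int, of x] int by (simp add: right_diff_distrib)
      show "integrable lborel (\<lambda>\<xi>::'a. norm (tent \<xi>) * (1 / 2))" using int by simp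
      show "norm (tent \<xi> * (1 - cis (x \<bullet> \<xi>))) \<le> norm (tent \<xi>) * (1 / 2)" for \<xi>
      proof (cases "tent \<xi> = 0")
        case False
        have "norm (1 - cis (x \<bullet> \<xi>)) \<le> \<bar>x \<bullet> \<xi>\<bar>" using norm_cis_diff_le[of 0 "x \<bullet> \<xi>"] by simp
        also have "\<dots> \<le> norm x * norm \<xi>" by (rule Cauchy_Schwarz_ineq2)
        also have "\<dots> \<le> (1 / 2) * 1"
          using x tent_support[OF False] by (intro mult_mono) auto
        finally show ?thesis unfolding norm_mult by (intro mult_left_mono) auto
      qed simp
    qed
    also have "\<dots> = A / 2" by (simp add: A_def)
    finally have "norm (fourier tent (0::'a) - fourier tent x) \<le> A / 2" .
    then show ?thesis using norm_triangle_ineq2[of "fourier tent (0::'a)" "fourier tent x"] Apos by (simp add: f0)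
  qed
  have "(A / 2)\<^sup>2 * indicator (ball 0 (1 / 2)) x \<le> fejer x" for x :: 'a
    using power_mono[OF low[of x], of 2] Apos by (auto simp: fejer_def indicator_def)
  then have "(LINT x|lborel. (A / 2)\<^sup>2 * indicator (ball (0::'a) (1 / 2)) x) \<le> (LINT x|lborel. fejer (x::'a))"
    using fejer_integrable[where 'a='a] by (intro Bochner_Integration.integral_mono) (auto intro!: integrable_real_indicator emeasure_lborel_ball_finite)
  moreover have "0 < measure lborel (ball (0::'a) (1 / 2))" by (rule content_ball_pos) simp
  moreover have "(LINT x|lborel. (A / 2)\<^sup>2 * indicator (ball (0::'a) (1 / 2)) x) = (A / 2)\<^sup>2 * measure lborel (ball (0::'a) (1 / 2))" by simp
  moreover have "0 < (A / 2)\<^sup>2" using Apos by simp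
  ultimately show ?thesis by (metis less_le_trans mult_pos_pos)
qed

text \<open>The dilated and modulated \<open>tent2\<close> is a test function whose transform is the
  kernel r^n fejer(r(x - a)). Pairing with it gives 0 for every r > 0, whereas for r tending to
  infinity the rescaled integral converges to f(a) times the positive mass of the kernel.\<close>

theorem slow_solution_zero:
  fixes f :: "'a::euclidean_space \<Rightarrow> complex"
  assumes f: "slow f" and cont: "continuous_on UNIV f" and bdd: "\<And>x. norm (f x) \<le> B"
    and \<theta>: "finite (supp \<theta>)" "supp \<theta> \<noteq> {}" and zero: "\<And>x. gr_act \<theta> f x = 0"
  shows "f a = 0"
proof -
  have [measurable]: "f \<in> borel_measurable borel" using f by (simp add: slow_def)
  have scaled: "(LINT y|lborel. f (a + (1 / r) *\<^sub>R y) * fejer y) = 0" if l: "0 < r" for r :: real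
  proof -
    define \<phi> where "\<phi> \<xi> = tent2 ((1 / r) *\<^sub>R \<xi>) * cis ((- a) \<bullet> \<xi>)" for \<xi> :: 'a
    have "lip_cs (\<lambda>\<xi>::'a. tent2 ((1 / r) *\<^sub>R \<xi>))"
    proof -
      obtain L where L: "L-lipschitz_on UNIV (tent2 :: 'a \<Rightarrow> complex)" using lip_cs_tent2[where 'a='a] by (auto simp: lip_cs_def)
      have "(L * (1 / r))-lipschitz_on UNIV (\<lambda>\<xi>::'a. tent2 ((1 / r) *\<^sub>R \<xi>))"
      proof (rule lipschitz_onI)
        fix x y :: 'a
        show "dist (tent2 ((1 / r) *\<^sub>R x)) (tent2 ((1 / r) *\<^sub>R y)) \<le> L * (1 / r) * dist x y"
          using lipschitz_onD[OF L, of "(1 / r) *\<^sub>R x" "(1 / r) *\<^sub>R y"] l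
          by (simp add: dist_norm scaleR_diff_right[symmetric] divide_inverse)
      qed (use lipschitz_on_nonneg[OF L] l in simp)
      moreover have "bounded {\<xi>::'a. tent2 ((1 / r) *\<^sub>R \<xi>) \<noteq> 0}"
      proof (rule bounded_subset)
        have "bounded {\<xi>::'a. tent2 \<xi> \<noteq> 0}" using lip_cs_tent2[where 'a='a] by (simp add: lip_cs_def)
        then show "bounded ((\<lambda>\<xi>. r *\<^sub>R \<xi>) ` {\<xi>::'a. tent2 \<xi> \<noteq> 0})" by (rule bounded_scaling)
        show "{\<xi>. tent2 ((1 / r) *\<^sub>R \<xi>) \<noteq> 0} \<subseteq> (\<lambda>\<xi>. r *\<^sub>R \<xi>) ` {\<xi>::'a. tent2 \<xi> \<noteq> 0}"
        proof
          fix \<xi> :: 'a assume "\<xi> \<in> {\<xi>. tent2 ((1 / r) *\<^sub>R \<xi>) \<noteq> 0}"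
          then show "\<xi> \<in> (\<lambda>\<xi>. r *\<^sub>R \<xi>) ` {\<xi>::'a. tent2 \<xi> \<noteq> 0}"
            using l by (intro image_eqI[of _ _ "(1 / r) *\<^sub>R \<xi>"]) auto
        qed
      qed
      ultimately show ?thesis by (auto simp: lip_cs_def)
    qed
    then have "lip_cs \<phi>" unfolding \<phi>_def by (rule lip_cs_cis)
    then have p0: "pairing f \<phi> = 0" by (rule pairing_zero[OF f \<theta> zero])
    have [measurable]: "(tent2 :: 'a \<Rightarrow> complex) \<in> borel_measurable borel"
      using borel_measurable_integrable[OF lip_cs_integrable[OF lip_cs_tent2[where 'a='a]]] by simp
    have four: "fourier \<phi> x = r ^ DIM('a) * fejer (r *\<^sub>R (x - a))" for x
    proof -
      have "fourier \<phi> x = fourier (\<lambda>\<xi>. tent2 ((1 / r) *\<^sub>R \<xi>)) (x - a)"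
        unfolding \<phi>_def by (subst fourier_mult_cis) simp
      also have "\<dots> = r ^ DIM('a) * (LINT \<xi>|lborel. tent2 ((1 / r) *\<^sub>R (0 + r *\<^sub>R \<xi>)) * cis ((x - a) \<bullet> (0 + r *\<^sub>R \<xi>)))"
        unfolding fourier_def
        using lborel_integral_affine[of "\<lambda>\<xi>. tent2 ((1 / r) *\<^sub>R \<xi>) * cis ((x - a) \<bullet> \<xi>)" r 0] l by simp
      also have "(LINT \<xi>|lborel. tent2 ((1 / r) *\<^sub>R (0 + r *\<^sub>R \<xi>)) * cis ((x - a) \<bullet> (0 + r *\<^sub>R \<xi>))) = fourier tent2 (r *\<^sub>R (x - a))"
        unfolding fourier_def using l by simp
      finally show ?thesis by (simp add: fourier_tent2 fejer_def)
    qed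
    have "0 = (LINT x|lborel. f x * fourier \<phi> x)" using p0 by (simp add: pairing_def)
    also have "\<dots> = r ^ DIM('a) * (LINT x|lborel. f x * fejer (r *\<^sub>R (x - a)))"
      unfolding four of_real_mult of_real_power integral_mult_right_zero[symmetric]
      by (simp only: mult.left_commute)
    also have "(LINT x|lborel. f x * fejer (r *\<^sub>R (x - a))) =
      (1 / r) ^ DIM('a) * (LINT y|lborel. f (a + (1 / r) *\<^sub>R y) * fejer (r *\<^sub>R (a + (1 / r) *\<^sub>R y - a)))"
      using lborel_integral_affine[of "\<lambda>x. f x * fejer (r *\<^sub>R (x - a))" "1 / r" a] l by simp
    finally show ?thesis using l by simp
  qed
  have lim: "(\<lambda>k. LINT y|lborel. f (a + (1 / real (Suc k)) *\<^sub>R y) * fejer y) \<longlonglongrightarrow> (LINT y|lborel. f a * fejer (y::'a))"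
  proof (rule integral_dominated_convergence[where w = "\<lambda>y. B * fejer y"])
    show "integrable lborel (\<lambda>y::'a. B * fejer y)" using fejer_integrable[where 'a='a] by simp
    show "AE y in lborel. (\<lambda>k. f (a + (1 / real (Suc k)) *\<^sub>R y) * fejer y) \<longlonglongrightarrow> f a * fejer y"
    proof (intro AE_I2 tendsto_mult tendsto_const)
      fix y :: 'a
      have "(\<lambda>k. a + (1 / real (Suc k)) *\<^sub>R y) \<longlonglongrightarrow> a + 0 *\<^sub>R y"
        by (intro tendsto_intros LIMSEQ_Suc[OF lim_const_over_n])
      then have "(\<lambda>k. a + (1 / real (Suc k)) *\<^sub>R y) \<longlonglongrightarrow> a" by simp
      then show "(\<lambda>k. f (a + (1 / real (Suc k)) *\<^sub>R y)) \<longlonglongrightarrow> f a"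
        using cont by (intro continuous_on_tendsto_compose[OF cont]) auto
    qed
    show "AE y in lborel. norm (f (a + (1 / real (Suc k)) *\<^sub>R y) * fejer y) \<le> B * fejer y" for k
      using bdd by (intro AE_I2) (auto simp: norm_mult abs_of_nonneg[OF fejer_nonneg] fejer_nonneg intro!: mult_right_mono)
  qed simp_all
  have "(\<lambda>k::nat. LINT y|lborel. f (a + (1 / real (Suc k)) *\<^sub>R y) * fejer y) = (\<lambda>k. 0)"
    by (rule ext) (rule scaled, simp)
  with lim have "(LINT y|lborel. f a * fejer (y::'a)) = 0" by (simp add: LIMSEQ_const_iff)
  then have "f a * complex_of_real (LINT y|lborel. fejer (y::'a)) = 0"
    by (simp only: integral_mult_right_zero integral_complex_of_real)
  then show ?thesis using fejer_pos[where 'a='a] by simp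
qed

section \<open>Growth and smoothing of p-integrable functions\<close>

text \<open>(1 + |x|^2)^n dominates the product of the n factors 1 + x_b^2, whose reciprocals are
  integrable on the line.\<close>

lemma nn_integral_inverse_power_finite:
  "(\<integral>\<^sup>+x. ennreal (1 / (1 + (norm x)\<^sup>2) ^ DIM('a)) \<partial>(lborel :: 'a::euclidean_space measure)) < \<infinity>"
proof -
  have "set_integrable lborel UNIV (\<lambda>x::real. inverse (1 + x\<^sup>2))"
    using integrable_inverse_1_plus_square by simp
  then have "integrable lborel (\<lambda>x::real. inverse (1 + x\<^sup>2))" by (simp add: set_integrable_def)
  then have one: "(\<integral>\<^sup>+x. ennreal (1 / (1 + x\<^sup>2)) \<partial>(lborel::real measure)) < \<infinity>"
    by (auto simp: integrable_iff_bounded divide_inverse)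
  have "ennreal (1 / (1 + (norm x)\<^sup>2) ^ DIM('a)) \<le> (\<Prod>b\<in>Basis. ennreal (1 / (1 + (x \<bullet> b)\<^sup>2)))" for x :: 'a
  proof -
    have pos: "0 < 1 + y\<^sup>2" for y :: real by (intro add_pos_nonneg) auto
    have "(\<Prod>b\<in>Basis. 1 + (x \<bullet> b)\<^sup>2) \<le> (\<Prod>b\<in>(Basis::'a set). 1 + (norm x)\<^sup>2)"
      using norm_bound_Basis_le[of _ x] Basis_le_norm[of _ x] less_imp_le[OF pos]
      by (intro prod_mono) (auto simp: abs_le_square_iff[symmetric])
    then have "1 / (1 + (norm x)\<^sup>2) ^ DIM('a) \<le> 1 / (\<Prod>b\<in>Basis. 1 + (x \<bullet> b)\<^sup>2)"
      using pos by (intro divide_left_mono) (auto intro!: mult_pos_pos prod_pos)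
    also have "\<dots> = (\<Prod>b\<in>Basis. 1 / (1 + (x \<bullet> b)\<^sup>2))" by (simp add: prod_dividef)
    finally show ?thesis by (subst prod_ennreal) (auto simp: ennreal_leI)
  qed
  then have "(\<integral>\<^sup>+x. ennreal (1 / (1 + (norm x)\<^sup>2) ^ DIM('a)) \<partial>(lborel :: 'a measure)) \<le>
     (\<integral>\<^sup>+x. (\<Prod>b\<in>Basis. ennreal (1 / (1 + (x \<bullet> b)\<^sup>2))) \<partial>(lborel :: 'a measure))"
    by (rule nn_integral_mono)
  also have "\<dots> = (\<Prod>b\<in>(Basis::'a set). (\<integral>\<^sup>+x. ennreal (1 / (1 + x\<^sup>2)) \<partial>lborel))"
    by (rule nn_integral_lborel_prod[where f = "\<lambda>b x. ennreal (1 / (1 + x\<^sup>2))"]) auto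
  also have "\<dots> < \<infinity>" using one by (simp add: power_less_top_ennreal)
  finally show ?thesis .
qed

text \<open>The measure with density \<open>u\<close> is finite, and the exteriors of balls decrease
  to the empty set.\<close>

lemma nn_integral_tail_small:
  fixes u :: "'a::euclidean_space \<Rightarrow> ennreal"
  assumes [measurable]: "u \<in> borel_measurable borel" and fin: "(\<integral>\<^sup>+x. u x \<partial>lborel) < \<infinity>" and d: "0 < d"
  shows "\<exists>R::real. (\<integral>\<^sup>+x. u x * indicator {x. R < norm x} x \<partial>lborel) < ennreal d"
proof -
  define A where "A k = {x::'a. real k < norm x}" for k :: nat
  have [measurable]: "A k \<in> sets borel" for k unfolding A_def by measurable
  have em: "emeasure (density lborel u) (A k) = (\<integral>\<^sup>+x. u x * indicator (A k) x \<partial>lborel)" for k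
    by (rule emeasure_density) auto
  have "(\<lambda>k. emeasure (density lborel u) (A k)) \<longlonglongrightarrow> emeasure (density lborel u) (\<Inter>k. A k)"
  proof (rule Lim_emeasure_decseq)
    show "decseq A" by (auto simp: decseq_def A_def)
    show "emeasure (density lborel u) (A k) \<noteq> \<infinity>" for k
    proof -
      have "emeasure (density lborel u) (A k) \<le> (\<integral>\<^sup>+x. u x \<partial>lborel)"
        unfolding em by (intro nn_integral_mono) (auto simp: indicator_def)
      then show ?thesis using fin by auto
    qed
  qed auto
  moreover have "(\<Inter>k. A k) = {}"
  proof -
    have "\<exists>k. x \<notin> A k" for x using real_arch_simple[of "norm x"] by (auto simp: A_def not_less)
    then show ?thesis by blast
  qed
  ultimately have "(\<lambda>k. emeasure (density lborel u) (A k)) \<longlonglongrightarrow> 0" by simp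
  then have "eventually (\<lambda>k. emeasure (density lborel u) (A k) < ennreal d) sequentially"
    by (rule order_tendstoD) (use d in simp)
  then obtain k where "emeasure (density lborel u) (A k) < ennreal d" by (auto simp: eventually_sequentially)
  then have "(\<integral>\<^sup>+x. u x * indicator {x. real k < norm x} x \<partial>lborel) < ennreal d"
    unfolding em unfolding A_def .
  then show ?thesis by blast
qed

text \<open>If a^2 \<le> \<delta>z^(n-1), the second term suffices. Otherwise a^(2-p) is at most
  (\<delta>z^(n-1))^((2-p)/2), and what remains is z^(1-e) \<le> 1 with e = (n-1)(p-2)/2. Here e
  \<le> 1 is equivalent to n(p-2) \<le> p, which is how the upper bound on p enters the
  proof.\<close>

lemma young_pointwise:
  fixes a z \<delta> p :: real
  assumes a: "0 \<le> a" and z: "0 < z" "z \<le> 1" and \<delta>: "0 < \<delta>" and p: "2 \<le> p" and n: "1 \<le> n" "real n * (p - 2) \<le> p"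
  shows "z * a\<^sup>2 \<le> \<delta> powr ((2 - p) / 2) * a powr p + \<delta> * z ^ n"
proof (cases "a\<^sup>2 \<le> \<delta> * z ^ (n - 1)")
  case True
  have "z * a\<^sup>2 \<le> z * (\<delta> * z ^ (n - 1))" using True z by simp
  also have "\<dots> = \<delta> * z ^ n" using n by (cases n) auto
  finally show ?thesis by (smt (verit) powr_ge_zero mult_nonneg_nonneg)
next
  case False
  then have "a \<noteq> 0" using \<delta> z by (auto simp: zero_le_mult_iff)
  then have a: "0 < a" using a by simp
  define e where "e = (real n - 1) * (p - 2) / 2"
  have e: "e \<le> 1" using n by (simp add: e_def algebra_simps)
  have "z \<le> z powr e" using powr_mono'[OF e, of z] z by simp
  then have "\<delta> powr ((p - 2) / 2) * z \<le> \<delta> powr ((p - 2) / 2) * z powr e" by (intro mult_left_mono) auto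
  also have "z powr e = (z ^ (n - 1)) powr ((p - 2) / 2)"
    using z n by (simp add: powr_realpow[symmetric] powr_powr e_def of_nat_diff)
  also have "\<delta> powr ((p - 2) / 2) * \<dots> = (\<delta> * z ^ (n - 1)) powr ((p - 2) / 2)"
    using \<delta> z by (simp add: powr_mult)
  also have "\<dots> \<le> (a\<^sup>2) powr ((p - 2) / 2)" using False \<delta> z p by (intro powr_mono2) auto
  also have "\<dots> = a powr (p - 2)" 
  proof -
    have "(a\<^sup>2) powr ((p - 2) / 2) = a powr (2 * ((p - 2) / 2))" using a by (simp only: powr_powr[symmetric]) simp
    also have "2 * ((p - 2) / 2) = p - 2" by simp
    finally show ?thesis .
  qed
  finally have "\<delta> powr ((p - 2) / 2) * z \<le> a powr (p - 2)" .
  then have "\<delta> powr ((2 - p) / 2) * (\<delta> powr ((p - 2) / 2) * z) * a\<^sup>2 \<le> \<delta> powr ((2 - p) / 2) * a powr (p - 2) * a\<^sup>2"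
    by (intro mult_right_mono mult_left_mono) auto
  moreover have "\<delta> powr ((2 - p) / 2) * (\<delta> powr ((p - 2) / 2) * z) = z"
    using \<delta> by (simp add: mult.assoc[symmetric] powr_add[symmetric] add_divide_distrib[symmetric])
  moreover have "a powr (p - 2) * a\<^sup>2 = a powr p"
  proof -
    have "a powr p = a powr (p - 2) * a powr 2" by (simp add: powr_add[symmetric] del: powr_numeral)
    then show ?thesis using a by simp
  qed
  ultimately have "z * a\<^sup>2 \<le> \<delta> powr ((2 - p) / 2) * a powr p" by (simp add: mult.assoc)
  moreover have "0 \<le> \<delta> * z ^ n" using \<delta> z by simp
  ultimately show ?thesis by linarith
qed

lemma nn_integral_lborel_scale:
  fixes f :: "'a::euclidean_space \<Rightarrow> ennreal"
  assumes [measurable]: "f \<in> borel_measurable borel" and c: "0 < c"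
  shows "ennreal (c ^ DIM('a)) * (\<integral>\<^sup>+x. f (c *\<^sub>R x) \<partial>lborel) = (\<integral>\<^sup>+x. f x \<partial>lborel)"
  by (subst (2) lborel_affine[of c 0])
     (use c in \<open>simp_all add: nn_integral_density nn_integral_distr nn_integral_cmult ennreal_power\<close>)

text \<open>Inside a fixed ball boundedness of f gives O(\<epsilon>) after multiplication by
  \<epsilon>. Outside, \<open>young_pointwise\<close> is applied with z = \<epsilon>/(1 +
  \<epsilon>^2|x|^2): the term |f|^p has a small tail, and the integral of z^n does not depend on
  \<epsilon>.\<close>

lemma Lp_bounded_imp_slow:
  fixes f :: "'a::euclidean_space \<Rightarrow> complex"
  assumes [measurable]: "f \<in> borel_measurable borel" and B: "\<And>x. norm (f x) \<le> B"
    and Lp: "(\<integral>\<^sup>+x. ennreal (norm (f x) powr p) \<partial>lborel) < \<infinity>"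
    and p: "2 \<le> p" "real DIM('a) * (p - 2) \<le> p"
  shows "slow f"
  unfolding slow_def
proof (intro conjI allI impI)
  show "f \<in> borel_measurable borel" by fact
  define n where "n = DIM('a)"
  obtain C where C: "0 \<le> C" "(\<integral>\<^sup>+x. ennreal (1 / (1 + (norm x)\<^sup>2) ^ n) \<partial>(lborel :: 'a measure)) = ennreal C"
    using nn_integral_inverse_power_finite[where 'a='a] unfolding n_def
    by (cases "\<integral>\<^sup>+x. ennreal (1 / (1 + (norm x)\<^sup>2) ^ DIM('a)) \<partial>(lborel :: 'a measure)") auto
  fix \<eta> :: real assume \<eta>: "0 < \<eta>"
  \<comment> \<open>Half of \<eta> is reserved for the ball; the exterior contributes at most
    \<delta> from the tail and \<delta>C from the power of the weight.\<close>
  define \<delta> where "\<delta> = \<eta> / 2 / (1 + C)"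
  have C1: "0 < 1 + C" using C by simp
  have "a / b * b = a" if "0 < b" for a b :: real using that by simp
  then have \<delta>: "0 < \<delta>" "\<delta> * (1 + C) = \<eta> / 2" unfolding \<delta>_def using \<eta> C1 by (simp, blast)
  \<comment> \<open>The factor \<delta>^((2-p)/2) in front of the tail turns this bound into
    \<delta>.\<close>
  obtain R where R: "(\<integral>\<^sup>+x. ennreal (norm (f x) powr p) * indicator {x. R < norm x} x \<partial>lborel) < ennreal (\<delta> powr (p / 2))"
    using nn_integral_tail_small[OF _ Lp, of "\<delta> powr (p / 2)"] \<delta> by auto
  define D where "D = B\<^sup>2 * measure lborel (cball (0::'a) R)"
  have D: "0 \<le> D" by (simp add: D_def)
  show "\<exists>\<epsilon>0>0. \<forall>\<epsilon>. 0 < \<epsilon> \<and> \<epsilon> < \<epsilon>0 \<longrightarrow>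
     (\<integral>\<^sup>+x. ennreal ((norm (f x))\<^sup>2 / (1 + \<epsilon>\<^sup>2 * (norm x)\<^sup>2)) \<partial>lborel) \<le> ennreal (\<eta> / \<epsilon>)"
  proof (intro exI[of _ "min 1 (\<eta> / (2 * (D + 1)))"] conjI allI impI)
    show "0 < min 1 (\<eta> / (2 * (D + 1)))" using \<eta> D by simp
    fix \<epsilon> assume "0 < \<epsilon> \<and> \<epsilon> < min 1 (\<eta> / (2 * (D + 1)))"
    then have \<epsilon>: "0 < \<epsilon>" "\<epsilon> \<le> 1" "\<epsilon> * (D + 1) < \<eta> / 2" using D by (auto simp: field_simps)
    have \<epsilon>D: "\<epsilon> * D \<le> \<eta> / 2" using \<epsilon> by (simp add: distrib_left)
    define w where "w x = 1 / (1 + \<epsilon>\<^sup>2 * (norm x)\<^sup>2)" for x :: 'a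
    have w: "0 < w x" "w x \<le> 1" for x
    proof -
      have "0 \<le> \<epsilon>\<^sup>2 * (norm x)\<^sup>2" by simp
      then have "1 \<le> 1 + \<epsilon>\<^sup>2 * (norm x)\<^sup>2" by linarith
      then show "0 < w x" "w x \<le> 1" unfolding w_def
        using divide_le_eq_1_pos[of "1 + \<epsilon>\<^sup>2 * (norm x)\<^sup>2" 1] zero_less_divide_1_iff[of "1 + \<epsilon>\<^sup>2 * (norm x)\<^sup>2"] by linarith+
    qed
    have [measurable]: "w \<in> borel_measurable borel" unfolding w_def by measurable
    have pt: "ennreal (\<epsilon> * ((norm (f x))\<^sup>2 * w x)) \<le> ennreal (\<epsilon> * B\<^sup>2) * indicator (cball 0 R) x +
        (ennreal (\<delta> powr ((2 - p) / 2)) * (ennreal (norm (f x) powr p) * indicator {x. R < norm x} x) + ennreal \<delta> * ennreal (\<epsilon> ^ n * w x ^ n))" for x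
    proof (cases "norm x \<le> R")
      case True
      have "\<epsilon> * ((norm (f x))\<^sup>2 * w x) \<le> \<epsilon> * (B\<^sup>2 * 1)"
        using w[of x] \<epsilon> B[of x] by (intro mult_left_mono mult_mono power_mono) auto
      then have "ennreal (\<epsilon> * ((norm (f x))\<^sup>2 * w x)) \<le> ennreal (\<epsilon> * B\<^sup>2) * indicator (cball 0 R) x"
        using True by (simp add: ennreal_leI)
      then show ?thesis by (rule order_trans) simp
    next
      case False
      have "(\<epsilon> * w x) * (norm (f x))\<^sup>2 \<le> \<delta> powr ((2 - p) / 2) * norm (f x) powr p + \<delta> * (\<epsilon> * w x) ^ n"
        by (rule young_pointwise) (use w[of x] \<epsilon> \<delta> p in \<open>auto simp: n_def mult_le_one DIM_ge_Suc0 Suc_leI\<close>)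
      then have "ennreal (\<epsilon> * ((norm (f x))\<^sup>2 * w x)) \<le> ennreal (\<delta> powr ((2 - p) / 2)) * ennreal (norm (f x) powr p) + ennreal \<delta> * ennreal (\<epsilon> ^ n * w x ^ n)"
        using \<delta> w[of x] \<epsilon>
        by (simp add: ennreal_mult[symmetric] ennreal_plus[symmetric] ennreal_leI power_mult_distrib mult_ac del: ennreal_plus)
      then show ?thesis using False by simp
    qed
    \<comment> \<open>The substitution of \<epsilon>x for x removes \<epsilon> exactly.\<close>
    have wn: "(\<integral>\<^sup>+x. ennreal (\<epsilon> ^ n * w x ^ n) \<partial>lborel) = ennreal C"
    proof -
      have "ennreal (\<epsilon> ^ n * w x ^ n) = ennreal (\<epsilon> ^ n) * ennreal (1 / (1 + (norm (\<epsilon> *\<^sub>R x))\<^sup>2) ^ n)" for x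
        using \<epsilon> by (simp add: w_def ennreal_mult[symmetric] power_mult_distrib power_divide)
      then show ?thesis
        using nn_integral_lborel_scale[of "\<lambda>x::'a. ennreal (1 / (1 + (norm x)\<^sup>2) ^ n)" \<epsilon>] \<epsilon> C(2)
        by (simp add: nn_integral_cmult n_def)
    qed
    have "ennreal \<epsilon> * (\<integral>\<^sup>+x. ennreal ((norm (f x))\<^sup>2 * w x) \<partial>lborel) = (\<integral>\<^sup>+x. ennreal (\<epsilon> * ((norm (f x))\<^sup>2 * w x)) \<partial>lborel)"
      using \<epsilon> w by (subst nn_integral_cmult[symmetric]) (auto simp: ennreal_mult')
    also have "\<dots> \<le> (\<integral>\<^sup>+x. ennreal (\<epsilon> * B\<^sup>2) * indicator (cball 0 R) x +
        (ennreal (\<delta> powr ((2 - p) / 2)) * (ennreal (norm (f x) powr p) * indicator {x. R < norm x} x) + ennreal \<delta> * ennreal (\<epsilon> ^ n * w x ^ n)) \<partial>lborel)"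
      by (intro nn_integral_mono pt)
    also have "\<dots> = ennreal (\<epsilon> * B\<^sup>2) * emeasure lborel (cball (0::'a) R) +
        (ennreal (\<delta> powr ((2 - p) / 2)) * (\<integral>\<^sup>+x. ennreal (norm (f x) powr p) * indicator {x. R < norm x} x \<partial>lborel) + ennreal \<delta> * ennreal C)"
    proof -
      have [measurable]: "{x::'a. R < norm x} \<in> sets borel" by measurable
      have [measurable]: "cball (0::'a) R \<in> sets borel" by simp
      have m1: "(\<lambda>x. ennreal (\<epsilon> * B\<^sup>2) * indicator (cball 0 R) x) \<in> borel_measurable (lborel::'a measure)" by measurable
      have m2: "(\<lambda>x. ennreal (norm (f x) powr p) * indicator {x. R < norm x} x) \<in> borel_measurable lborel" by measurable
      have m3: "(\<lambda>x. ennreal (\<epsilon> ^ n * w x ^ n)) \<in> borel_measurable lborel" by measurable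
      have split: "(\<integral>\<^sup>+x. u x + (c * v x + d * z x) \<partial>lborel) =
          (\<integral>\<^sup>+x. u x \<partial>lborel) + (c * (\<integral>\<^sup>+x. v x \<partial>lborel) + d * (\<integral>\<^sup>+x. z x \<partial>lborel))"
        if [measurable]: "u \<in> borel_measurable lborel" "v \<in> borel_measurable lborel" "z \<in> borel_measurable lborel"
        for u v z :: "'a \<Rightarrow> ennreal" and c d
        using that by (subst nn_integral_add; simp add: nn_integral_add nn_integral_cmult)
      show ?thesis unfolding split[OF m1 m2 m3] wn by (simp add: nn_integral_cmult_indicator)
    qed
    also have "\<dots> \<le> ennreal (\<epsilon> * D) + (ennreal (\<delta> powr ((2 - p) / 2)) * ennreal (\<delta> powr (p / 2)) + ennreal \<delta> * ennreal C)"
    proof (intro add_mono mult_left_mono order_refl less_imp_le[OF R])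
      have "emeasure lborel (cball (0::'a) R) = ennreal (measure lborel (cball (0::'a) R))"
        using emeasure_lborel_cball_finite[of "0::'a" R] by (intro emeasure_eq_ennreal_measure) auto
      then show "ennreal (\<epsilon> * B\<^sup>2) * emeasure lborel (cball (0::'a) R) \<le> ennreal (\<epsilon> * D)"
        using \<epsilon> by (simp add: D_def ennreal_mult[symmetric] mult.assoc)
    qed auto
    also have "\<dots> = ennreal (\<epsilon> * D + \<delta> * (1 + C))"
    proof -
      have "\<delta> powr ((2 - p) / 2) * \<delta> powr (p / 2) = \<delta>"
        using \<delta> by (simp add: powr_add[symmetric] diff_divide_distrib)
      then show ?thesis
        using \<delta> C \<epsilon> D by (simp add: ennreal_mult[symmetric] ennreal_plus[symmetric] distrib_left del: ennreal_plus)
    qed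
    also have "\<dots> \<le> ennreal \<eta>" using \<delta>(2) \<epsilon>D by (intro ennreal_leI) linarith
    finally have *: "ennreal \<epsilon> * (\<integral>\<^sup>+x. ennreal ((norm (f x))\<^sup>2 * w x) \<partial>lborel) \<le> ennreal \<eta>" .
    have "(\<integral>\<^sup>+x. ennreal ((norm (f x))\<^sup>2 * w x) \<partial>lborel) = ennreal (1 / \<epsilon>) * (ennreal \<epsilon> * (\<integral>\<^sup>+x. ennreal ((norm (f x))\<^sup>2 * w x) \<partial>lborel))"
      using \<epsilon> by (simp add: mult.assoc[symmetric] ennreal_mult[symmetric])
    also have "\<dots> \<le> ennreal (1 / \<epsilon>) * ennreal \<eta>" by (intro mult_left_mono *) simp
    also have "\<dots> = ennreal (\<eta> / \<epsilon>)" using \<epsilon> \<eta> by (simp add: ennreal_mult[symmetric])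
    finally show "(\<integral>\<^sup>+x. ennreal ((norm (f x))\<^sup>2 / (1 + \<epsilon>\<^sup>2 * (norm x)\<^sup>2)) \<partial>lborel) \<le> ennreal (\<eta> / \<epsilon>)"
      by (simp add: w_def)
  qed
qed

section \<open>Mollification of p-integrable functions\<close>

lemma powr_above_tangent:
  fixes a t p :: real
  assumes "0 \<le> a" "0 < t" "1 \<le> p"
  shows "t powr p + p * t powr (p - 1) * (a - t) \<le> a powr p"
\<comment> \<open>Convexity is used on the open half-line; at a = 0 the inequality reads (1 - p)t^p
  \<le> 0.\<close>
proof (cases "a = 0")
  case True
  have "t powr (p - 1) * t = t powr p" using assms by (simp add: powr_diff)
  then have "t powr p + p * t powr (p - 1) * (a - t) = (1 - p) * t powr p" using True by (simp add: algebra_simps)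
  also have "\<dots> \<le> 0" using assms by (intro mult_nonpos_nonneg) auto
  finally show ?thesis using True by simp
next
  case False
  have "p * t powr (p - 1) * (a - t) \<le> a powr p - t powr p"
  proof (rule convex_on_imp_above_tangent[where A = "{0<..}"])
    show "convex_on {0<..} (\<lambda>x. x powr p)" by (rule powr_convex) fact
    show "((\<lambda>x. x powr p) has_real_derivative p * t powr (p - 1)) (at t within {0<..})"
      by (rule has_field_derivative_at_within[OF has_real_derivative_powr]) (use assms in simp)
  qed (use assms False in \<open>auto simp: interior_open\<close>)
  then show ?thesis by simp
qed

text \<open>Jensen's inequality, obtained by integrating the tangent inequality at the mean value.\<close>

lemma jensen_powr:
  fixes u k :: "'a \<Rightarrow> real"
  assumes k: "integrable M k" "\<And>x. 0 \<le> k x" and u: "\<And>x. 0 \<le> u x" and p: "1 \<le> p"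
    and uk: "integrable M (\<lambda>x. u x * k x)" and upk: "integrable M (\<lambda>x. u x powr p * k x)"
    and m: "0 < (LINT x|M. k x)"
  shows "(LINT x|M. u x * k x) powr p \<le> (LINT x|M. k x) powr (p - 1) * (LINT x|M. u x powr p * k x)"
proof -
  define m where "m = (LINT x|M. k x)"
  define I where "I = (LINT x|M. u x * k x)"
  have I0: "0 \<le> I" unfolding I_def using k u by (intro Bochner_Integration.integral_nonneg) auto
  have J0: "0 \<le> (LINT x|M. u x powr p * k x)" using k u by (intro Bochner_Integration.integral_nonneg) auto
  have mpos: "0 < m" using m by (simp add: m_def)
  show ?thesis
  proof (cases "I = 0")
    case True then show ?thesis using J0 mpos by (simp add: I_def m_def)
  next
    case False
    define t where "t = I / m"
    have t: "0 < t" using False I0 mpos by (simp add: t_def)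
    have "(LINT x|M. t powr p * k x + p * t powr (p - 1) * (u x * k x - t * k x)) \<le> (LINT x|M. u x powr p * k x)"
    proof (rule Bochner_Integration.integral_mono)
      show "integrable M (\<lambda>x. t powr p * k x + p * t powr (p - 1) * (u x * k x - t * k x))" using k uk by simp
      show "integrable M (\<lambda>x. u x powr p * k x)" by fact
      show "t powr p * k x + p * t powr (p - 1) * (u x * k x - t * k x) \<le> u x powr p * k x" for x
        using mult_right_mono[OF powr_above_tangent[OF u[of x] t p] k(2)[of x]] by (simp add: algebra_simps)
    qed
    also have "(LINT x|M. t powr p * k x + p * t powr (p - 1) * (u x * k x - t * k x)) =
       t powr p * m + p * t powr (p - 1) * (I - t * m)"
      using k uk by (simp add: m_def I_def)
    also have "I - t * m = 0" using mpos by (simp add: t_def)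
    finally have "t powr p * m \<le> (LINT x|M. u x powr p * k x)" by simp
    then have "m powr (p - 1) * (t powr p * m) \<le> m powr (p - 1) * (LINT x|M. u x powr p * k x)"
      by (intro mult_left_mono) auto
    also have "m powr (p - 1) * (t powr p * m) = I powr p"
      using mpos I0 by (simp add: t_def powr_divide powr_diff)
    finally show ?thesis by (simp add: m_def I_def)
  qed
qed

text \<open>Mollification. For a non-negative Lipschitz kernel with bounded support the result is
  bounded, continuous and again p-integrable, and it satisfies the same equation at every
  point.\<close>

definition conv :: "('a::euclidean_space \<Rightarrow> complex) \<Rightarrow> ('a \<Rightarrow> real) \<Rightarrow> 'a \<Rightarrow> complex" where
  "conv f k x = (LINT y|lborel. f y * complex_of_real (k (x - y)))"

context
  fixes f :: "'a::euclidean_space \<Rightarrow> complex" and k :: "'a \<Rightarrow> real" and p L B R N :: real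
  assumes fm [measurable]: "f \<in> borel_measurable borel"
    and p: "1 \<le> p" and N: "(\<integral>\<^sup>+x. ennreal (norm (f x) powr p) \<partial>lborel) = ennreal N" "0 \<le> N"
    and kL: "L-lipschitz_on UNIV k" and k0: "\<And>x. 0 \<le> k x" and kB: "\<And>x. k x \<le> B"
    and kR: "\<And>x. k x \<noteq> 0 \<Longrightarrow> x \<in> ball 0 R"
begin

lemma k_measurable [measurable]: "k \<in> borel_measurable borel"
  by (intro borel_measurable_continuous_onI lipschitz_on_continuous_on[OF kL])

lemma Lp_integrable: "integrable lborel (\<lambda>x. norm (f x) powr p)"
  unfolding integrable_iff_bounded using N by simp

lemma Lp_integral: "(LINT x|lborel. norm (f x) powr p) = N"
  using nn_integral_eq_integral[OF Lp_integrable] N by (simp add: Bochner_Integration.integral_nonneg)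

text \<open>Yields local integrability of f for all p \<ge> 1 at once, with a bound that does not
  depend on the centre of the ball.\<close>

lemma norm_le_one_plus_powr: "norm (f y) \<le> 1 + norm (f y) powr p"
proof (cases "norm (f y) \<le> 1")
  case False
  then have "norm (f y) powr 1 \<le> norm (f y) powr p" using p by (intro powr_mono) auto
  then show ?thesis using False by simp
qed (auto intro: order_trans[OF _ le_add_same_cancel1[THEN iffD2]])

lemma integrable_indicator_ball: "integrable lborel (indicator (ball x r) :: 'a \<Rightarrow> real)"
  by (intro integrable_real_indicator emeasure_lborel_ball_finite) simp

lemma local_bound:
  "integrable lborel (\<lambda>y. norm (f y) * indicator (ball x R) y)"
  "(LINT y|lborel. norm (f y) * indicator (ball x R) y) \<le> measure lborel (ball (0::'a) R) + N"
proof -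
  have [measurable]: "ball x R \<in> sets borel" by simp
  have [measurable]: "(\<lambda>y. norm (f y) * indicator (ball x R) y) \<in> borel_measurable borel" by measurable
  have bd: "norm (f y) * indicator (ball x R) y \<le> indicator (ball x R) y + norm (f y) powr p" for y
    using norm_le_one_plus_powr[of y] by (auto simp: indicator_def)
  have int: "integrable lborel (\<lambda>y. indicator (ball x R) y + norm (f y) powr p)"
    using integrable_indicator_ball Lp_integrable by simp
  show i: "integrable lborel (\<lambda>y. norm (f y) * indicator (ball x R) y)"
    by (rule Bochner_Integration.integrable_bound[OF int]) (use bd in \<open>auto intro!: AE_I2 order_trans[OF bd]\<close>)
  have "(LINT y|lborel. norm (f y) * indicator (ball x R) y) \<le> (LINT y|lborel. indicator (ball x R) y + norm (f y) powr p)"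
    by (rule Bochner_Integration.integral_mono[OF i int bd])
  also have "\<dots> = measure lborel (ball x R) + N"
    using integrable_indicator_ball Lp_integrable Lp_integral by simp
  also have "measure lborel (ball x R) = measure lborel (ball (0::'a) R)"
  proof -
    have "{y. y + (- x) \<in> ball 0 R} = ball x R" by (auto simp: dist_norm norm_minus_commute)
    then show ?thesis using emeasure_lborel_shift[of "ball (0::'a) R" "- x"] by (simp add: measure_def)
  qed
  finally show "(LINT y|lborel. norm (f y) * indicator (ball x R) y) \<le> measure lborel (ball (0::'a) R) + N" .
qed

lemma k_ball: "k (x - y) \<noteq> 0 \<Longrightarrow> y \<in> ball x R"
  using kR[of "x - y"] by (simp add: dist_norm norm_minus_commute)

lemma B_nonneg: "0 \<le> B"
  using k0 kB by (meson order_trans)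

lemma conv_integrand_bound: "norm (f y * complex_of_real (k (x - y))) \<le> B * (norm (f y) * indicator (ball x R) y)"
proof (cases "k (x - y) = 0")
  case False
  have "norm (f y) * k (x - y) \<le> norm (f y) * B" by (intro mult_left_mono kB) auto
  then show ?thesis using k_ball[OF False] k0 by (simp add: norm_mult mult.commute)
qed (use B_nonneg in auto)

lemma conv_integrable: "integrable lborel (\<lambda>y. f y * complex_of_real (k (x - y)))"
  by (rule Bochner_Integration.integrable_bound[OF integrable_mult_right[OF local_bound(1)[of x], of B]])
     (use B_nonneg conv_integrand_bound in \<open>auto intro!: AE_I2 order_trans[OF conv_integrand_bound] simp: abs_mult\<close>)

lemma conv_bounded: "norm (conv f k x) \<le> B * (measure lborel (ball (0::'a) R) + N)"
proof -
  have "norm (conv f k x) \<le> (LINT y|lborel. norm (f y * complex_of_real (k (x - y))))"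
    unfolding conv_def by (rule integral_norm_bound)
  also have "\<dots> \<le> (LINT y|lborel. B * (norm (f y) * indicator (ball x R) y))"
    by (intro Bochner_Integration.integral_mono integrable_norm conv_integrable conv_integrand_bound
        integrable_mult_right local_bound(1))
  also have "\<dots> \<le> B * (measure lborel (ball (0::'a) R) + N)"
    using local_bound(2)[of x] B_nonneg by (simp add: mult_left_mono)
  finally show ?thesis .
qed

text \<open>The kernel is Lipschitz and \<open>local_bound\<close> is uniform in the centre, so the
  convolution is even Lipschitz.\<close>

lemma conv_continuous: "continuous_on UNIV (conv f k)"
proof -
  define D where "D = L * (2 * (measure lborel (ball (0::'a) R) + N))"
  have L0: "0 \<le> L" using kL by (rule lipschitz_on_nonneg)
  have "D-lipschitz_on UNIV (conv f k)"
  proof (rule lipschitz_onI)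
    fix x x' :: 'a
    define w where "w y = norm (f y) * indicator (ball x R) y + norm (f y) * indicator (ball x' R) y" for y
    have w: "integrable lborel w" unfolding w_def by (intro Bochner_Integration.integrable_add local_bound)
    have wi: "(LINT y|lborel. w y) \<le> 2 * (measure lborel (ball (0::'a) R) + N)"
      unfolding w_def using local_bound[of x] local_bound[of x'] by simp
    have bd: "norm (f y * complex_of_real (k (x - y)) - f y * complex_of_real (k (x' - y))) \<le> (L * dist x x') * w y" for y
    proof (cases "y \<in> ball x R \<or> y \<in> ball x' R")
      case True
      have "norm (f y * complex_of_real (k (x - y)) - f y * complex_of_real (k (x' - y))) = norm (f y) * \<bar>k (x - y) - k (x' - y)\<bar>"
        by (simp only: right_diff_distrib[symmetric] of_real_diff[symmetric] norm_mult norm_of_real)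
      also have "\<dots> \<le> norm (f y) * (L * dist x x')"
        using lipschitz_onD[OF kL, of "x - y" "x' - y"] by (intro mult_left_mono) (auto simp: dist_norm)
      also have "\<dots> \<le> w y * (L * dist x x')"
        using True L0 by (intro mult_right_mono) (auto simp: w_def)
      finally show ?thesis by (simp only: mult.commute)
    next
      case False
      then have "k (x - y) = 0" "k (x' - y) = 0" using k_ball by blast+
      then show ?thesis using L0 by (simp add: w_def)
    qed
    have "dist (conv f k x) (conv f k x') = norm (LINT y|lborel. f y * complex_of_real (k (x - y)) - f y * complex_of_real (k (x' - y)))"
      unfolding conv_def dist_norm by (simp add: Bochner_Integration.integral_diff[OF conv_integrable conv_integrable])
    also have "\<dots> \<le> (LINT y|lborel. norm (f y * complex_of_real (k (x - y)) - f y * complex_of_real (k (x' - y))))"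
      by (rule integral_norm_bound)
    also have "\<dots> \<le> (LINT y|lborel. (L * dist x x') * w y)"
      by (intro Bochner_Integration.integral_mono integrable_norm Bochner_Integration.integrable_diff conv_integrable bd integrable_mult_right w)
    also have "\<dots> = (L * dist x x') * (LINT y|lborel. w y)" by simp
    also have "\<dots> \<le> (L * dist x x') * (2 * (measure lborel (ball (0::'a) R) + N))"
      using wi L0 by (intro mult_left_mono) auto
    finally show "dist (conv f k x) (conv f k x') \<le> D * dist x x'" by (simp add: D_def mult_ac)
  qed (use L0 N in \<open>simp add: D_def\<close>)
  then show ?thesis by (rule lipschitz_on_continuous_on)
qed

text \<open>Convolution commutes with translations; the integral ignores null sets, so an equation
  valid almost everywhere becomes valid everywhere.\<close>

lemma conv_gr_act:
  assumes \<theta>: "finite (supp \<theta>)" and zero: "AE y in lborel. gr_act \<theta> f y = 0"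
  shows "gr_act \<theta> (conv f k) x = 0"
proof -
  have shift: "conv f k (x - h) = (LINT y|lborel. f (y - h) * complex_of_real (k (x - y)))"
    "integrable lborel (\<lambda>y. f (y - h) * complex_of_real (k (x - y)))" for h
  proof -
    have e: "x - h - (y + - h) = x - y" for y by simp
    show "conv f k (x - h) = (LINT y|lborel. f (y - h) * complex_of_real (k (x - y)))"
      using lborel_integral_shift[of "\<lambda>y. f y * complex_of_real (k (x - h - y))" "- h"]
      unfolding conv_def e by simp
    show "integrable lborel (\<lambda>y. f (y - h) * complex_of_real (k (x - y)))"
      using lborel_integrable_shift[OF conv_integrable[of "x - h"], of "- h"] unfolding e by simp
  qed
  have "gr_act \<theta> (conv f k) x = (\<Sum>h\<in>supp \<theta>. LINT y|lborel. \<theta> h * (f (y - h) * complex_of_real (k (x - y))))"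
    by (simp add: gr_act_def shift)
  also have "\<dots> = (LINT y|lborel. (\<Sum>h\<in>supp \<theta>. \<theta> h * (f (y - h) * complex_of_real (k (x - y)))))"
    by (intro Bochner_Integration.integral_sum[symmetric] integrable_mult_right shift)
  also have "\<dots> = (LINT y|lborel. gr_act \<theta> f y * complex_of_real (k (x - y)))"
    by (simp add: gr_act_def sum_distrib_right mult.assoc)
  also have "\<dots> = 0" by (rule integral_eq_zero_AE) (use zero in auto)
  finally show ?thesis .
qed

text \<open>Young's convolution inequality with a kernel in L^1: Jensen's inequality for the measure
  with density k(x - y), then Fubini.\<close>

lemma conv_Lp: "(\<integral>\<^sup>+x. ennreal (norm (conv f k x) powr p) \<partial>lborel) < \<infinity>"
proof -
  define m where "m = (LINT y|lborel. k y)"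
  have kb: "norm (k y) \<le> norm (B * indicator (ball 0 R) y)" for y
    using kR[of y] k0[of y] kB[of y] B_nonneg by (cases "k y = 0") auto
  have kint: "integrable lborel k"
    by (rule Bochner_Integration.integrable_bound[OF integrable_mult_right[OF integrable_indicator_ball[of 0 R], of B]])
       (use kb in auto)
  have refl: "(\<integral>\<^sup>+y. ennreal (k (x - y)) \<partial>lborel) = (\<integral>\<^sup>+y. ennreal (k y) \<partial>lborel)" for x
    by (rule nn_integral_lborel_reflect[where f = "\<lambda>y. ennreal (k y)"]) simp
  have nk: "(\<integral>\<^sup>+y. ennreal (k y) \<partial>lborel) = ennreal m"
    unfolding m_def by (rule nn_integral_eq_integral[OF kint]) (use k0 in auto)
  have m0: "0 \<le> m" unfolding m_def using k0 by (intro Bochner_Integration.integral_nonneg) auto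
  have kxint: "integrable lborel (\<lambda>y. k (x - y))" for x
    unfolding integrable_iff_bounded using refl[of x] nk k0 by simp
  have kxm: "(LINT y|lborel. k (x - y)) = m" for x
    using nn_integral_eq_integral[OF kxint[of x]] refl[of x] nk k0 m0 by (simp add: Bochner_Integration.integral_nonneg)
  have le: "ennreal (norm (conv f k x) powr p) \<le> ennreal (m powr (p - 1)) * (\<integral>\<^sup>+y. ennreal (norm (f y) powr p) * ennreal (k (x - y)) \<partial>lborel)" for x
  proof -
    have i1: "integrable lborel (\<lambda>y. norm (f y) * k (x - y))"
      using integrable_norm[OF conv_integrable[of x]] k0 by (simp add: norm_mult)
    have i2: "integrable lborel (\<lambda>y. norm (f y) powr p * k (x - y))"
      by (rule Bochner_Integration.integrable_bound[OF integrable_mult_right[OF Lp_integrable, of B]])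
         (use k0 kB B_nonneg in \<open>auto simp: abs_mult mult.commute intro!: AE_I2 mult_right_mono\<close>)
    have nc: "norm (conv f k x) \<le> (LINT y|lborel. norm (f y) * k (x - y))"
      unfolding conv_def by (rule order_trans[OF integral_norm_bound]) (use k0 in \<open>simp add: norm_mult\<close>)
    have "norm (conv f k x) powr p \<le> m powr (p - 1) * (LINT y|lborel. norm (f y) powr p * k (x - y))"
    \<comment> \<open>Jensen's inequality needs positive mass; without mass the kernel vanishes
      almost everywhere and so does the convolution.\<close>
    proof (cases "m = 0")
      case True
      then have "AE y in lborel. k (x - y) = 0"
        using integral_nonneg_eq_0_iff_AE[OF kxint[of x]] k0 kxm by auto
      then have "(LINT y|lborel. norm (f y) * k (x - y)) = 0" by (intro integral_eq_zero_AE) auto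
      then have "norm (conv f k x) = 0" using nc by simp
      then show ?thesis using True p by simp
    next
      case False
      have "norm (conv f k x) powr p \<le> (LINT y|lborel. norm (f y) * k (x - y)) powr p"
        using nc p by (intro powr_mono2) auto
      also have "\<dots> \<le> (LINT y|lborel. k (x - y)) powr (p - 1) * (LINT y|lborel. norm (f y) powr p * k (x - y))"
        using m0 False by (intro jensen_powr i1 i2 kxint k0 p) (auto simp: kxm)
      finally show ?thesis by (simp add: kxm)
    qed
    then have "ennreal (norm (conv f k x) powr p) \<le> ennreal (m powr (p - 1)) * ennreal (LINT y|lborel. norm (f y) powr p * k (x - y))"
      using k0 by (simp add: ennreal_mult[symmetric] ennreal_leI Bochner_Integration.integral_nonneg)
    also have "ennreal (LINT y|lborel. norm (f y) powr p * k (x - y)) = (\<integral>\<^sup>+y. ennreal (norm (f y) powr p) * ennreal (k (x - y)) \<partial>lborel)"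
      using nn_integral_eq_integral[OF i2] k0 by (simp add: ennreal_mult)
    finally show ?thesis .
  qed
  have "(\<integral>\<^sup>+x. ennreal (norm (conv f k x) powr p) \<partial>lborel) \<le>
    (\<integral>\<^sup>+x. ennreal (m powr (p - 1)) * (\<integral>\<^sup>+y. ennreal (norm (f y) powr p) * ennreal (k (x - y)) \<partial>lborel) \<partial>lborel)"
    by (rule nn_integral_mono) (rule le)
  also have "\<dots> = ennreal (m powr (p - 1)) * (\<integral>\<^sup>+x. \<integral>\<^sup>+y. ennreal (norm (f y) powr p) * ennreal (k (x - y)) \<partial>lborel \<partial>lborel)"
    by (rule nn_integral_cmult) simp
  also have "(\<integral>\<^sup>+x. \<integral>\<^sup>+y. ennreal (norm (f y) powr p) * ennreal (k (x - y)) \<partial>lborel \<partial>lborel) =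
     (\<integral>\<^sup>+y. \<integral>\<^sup>+x. ennreal (norm (f y) powr p) * ennreal (k (x - y)) \<partial>lborel \<partial>lborel)"
    by (rule lborel_pair.Fubini'[symmetric]) simp
  also have "\<dots> = (\<integral>\<^sup>+y. ennreal (norm (f y) powr p) * ennreal m \<partial>lborel)"
    using nn_integral_lborel_shift[of "\<lambda>x. ennreal (k x)" "- y" for y] nk by (simp add: nn_integral_cmult)
  also have "\<dots> = ennreal N * ennreal m" using N by (simp add: nn_integral_multc)
  finally show ?thesis by (auto simp: ennreal_mult[symmetric] m0 N intro: le_less_trans)
qed

text \<open>For p < 2 the convolution, being bounded and p-integrable, is also square-integrable,
  and the exponent 2 satisfies the growth condition in every dimension.\<close>

lemma conv_zero:
  assumes n: "DIM('a) = 1 \<or> p \<le> 2 * real DIM('a) / (real DIM('a) - 1)"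
    and \<theta>: "finite (supp \<theta>)" "supp \<theta> \<noteq> {}" and zero: "AE y in lborel. gr_act \<theta> f y = 0"
  shows "conv f k x = 0"
proof -
  define D where "D = B * (measure lborel (ball (0::'a) R) + N)"
  have bd: "norm (conv f k x) \<le> D" for x unfolding D_def by (rule conv_bounded)
  have m: "conv f k \<in> borel_measurable borel" by (intro borel_measurable_continuous_onI conv_continuous)
  have "slow (conv f k)"
  proof (cases "2 \<le> p")
    case True
    have "real DIM('a) * (p - 2) \<le> p"
    proof (cases "DIM('a) = 1")
      case False
      then have d: "1 < real DIM('a)" using DIM_positive[where 'a='a] by linarith
      then have "p * (real DIM('a) - 1) \<le> 2 * real DIM('a)" using n False by (simp add: pos_le_divide_eq)
      then show ?thesis by (simp add: algebra_simps)
    qed simp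
    then show ?thesis by (rule Lp_bounded_imp_slow[OF m bd conv_Lp True])
  next
    case False
    have D0: "0 \<le> D" by (rule order_trans[OF norm_ge_zero bd])
    have "norm (conv f k x) powr 2 \<le> D powr (2 - p) * norm (conv f k x) powr p" for x
    proof (cases "conv f k x = 0")
      case nz: False
      have "norm (conv f k x) powr 2 = norm (conv f k x) powr (2 - p) * norm (conv f k x) powr p"
        by (simp only: powr_add[symmetric]) simp
      also have "\<dots> \<le> D powr (2 - p) * norm (conv f k x) powr p"
        using bd[of x] False by (intro mult_right_mono powr_mono2) auto
      finally show ?thesis .
    qed simp
    then have "(\<integral>\<^sup>+x. ennreal (norm (conv f k x) powr 2) \<partial>lborel) \<le>
       (\<integral>\<^sup>+x. ennreal (D powr (2 - p)) * ennreal (norm (conv f k x) powr p) \<partial>lborel)"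
      by (intro nn_integral_mono) (simp add: ennreal_mult[symmetric] ennreal_leI del: powr_numeral)
    also have "\<dots> = ennreal (D powr (2 - p)) * (\<integral>\<^sup>+x. ennreal (norm (conv f k x) powr p) \<partial>lborel)"
      using m by (intro nn_integral_cmult) simp
    also have "\<dots> < \<infinity>" using conv_Lp by (simp add: ennreal_mult_less_top)
    finally show ?thesis by (intro Lp_bounded_imp_slow[OF m bd]) auto
  qed
  then show ?thesis by (rule slow_solution_zero[OF _ conv_continuous bd \<theta>]) (rule conv_gr_act[OF \<theta>(1) zero])
qed

end

text \<open>Open sets are stable under intersection and generate the Borel sets, so the vanishing of
  the integrals extends to all Borel sets by the pi-lambda argument.\<close>

lemma AE_zero_if_open_integrals_zero:
  fixes g :: "'a::euclidean_space \<Rightarrow> complex"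
  assumes g: "integrable lborel g" and opn: "\<And>U. open U \<Longrightarrow> (LINT x:U|lborel. g x) = 0"
  shows "AE x in lborel. g x = 0"
proof -
  have si: "set_integrable lborel A g" if "A \<in> sets borel" for A
    using integrable_mult_indicator[OF _ g, of A] that by (simp add: set_integrable_def)
  have "(LINT x:A|lborel. g x) = 0" if "A \<in> sets borel" for A
  proof -
    have "Int_stable {S::'a set. open S}" by (auto simp: Int_stable_def)
    moreover have "{S::'a set. open S} \<subseteq> Pow UNIV" by simp
    moreover have "A \<in> sigma_sets UNIV {S::'a set. open S}" using that by (simp add: sets_borel)
    ultimately show ?thesis
    proof (induction rule: sigma_sets_induct_disjoint)
      case (basic A) then show ?case using opn by simp
    next
      case empty then show ?case by (simp add: set_lebesgue_integral_def)
    next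
      case (compl A)
      then have A: "A \<in> sets borel" by (simp add: sets_borel)
      have "(LINT x:A \<union> (UNIV - A)|lborel. g x) = (LINT x:A|lborel. g x) + (LINT x:UNIV - A|lborel. g x)"
        using A by (intro set_integral_Un si) auto
      moreover have "A \<union> (UNIV - A) = UNIV" by auto
      ultimately show ?case using compl.IH opn[of UNIV] by simp
    next
      case (union A)
      then have A: "A i \<in> sets borel" for i by (auto simp: sets_borel)
      have "(LINT x:(\<Union>i. A i)|lborel. g x) = (\<Sum>i. LINT x:A i|lborel. g x)"
        using union.hyps A by (intro lebesgue_integral_countable_add si) (auto simp: disjoint_family_on_def)
      then show ?case using union.IH by simp
    qed
  qed
  then show ?thesis by (intro sigma_finite_measure.density_zero[OF sigma_finite_lborel g]) simp
qed

text \<open>The vanishing of all mollifications makes f orthogonal to every Lipschitz bump; such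
  bumps approximate the indicators of bounded open sets, which determine f almost
  everywhere.\<close>

theorem translates_independent_lborel:
  fixes f :: "'a::euclidean_space \<Rightarrow> complex"
  assumes fm: "f \<in> borel_measurable borel"
    and p: "1 \<le> p" "DIM('a) = 1 \<or> p \<le> 2 * real DIM('a) / (real DIM('a) - 1)"
    and Lp: "(\<integral>\<^sup>+x. ennreal (norm (f x) powr p) \<partial>lborel) < \<infinity>"
    and \<theta>: "finite (supp \<theta>)" "supp \<theta> \<noteq> {}" and zero: "AE y in lborel. gr_act \<theta> f y = 0"
  shows "AE x in lborel. f x = 0"
proof -
  note [measurable] = fm
  obtain N where N: "(\<integral>\<^sup>+x. ennreal (norm (f x) powr p) \<partial>lborel) = ennreal N" "0 \<le> N"
    using Lp by (cases "\<integral>\<^sup>+x. ennreal (norm (f x) powr p) \<partial>lborel") auto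
  have orth: "(LINT y|lborel. f y * complex_of_real (k y)) = 0"
    if k: "L-lipschitz_on UNIV k" "\<And>x. 0 \<le> k x" "\<And>x. k x \<le> 1" "\<And>x. k x \<noteq> 0 \<Longrightarrow> x \<in> ball 0 R" for k :: "'a \<Rightarrow> real" and L R
  proof -
    \<comment> \<open>The reflected kernel, because its convolution with f at the point 0 is the
      integral of f times \<open>k\<close>.\<close>
    have k': "L-lipschitz_on UNIV (\<lambda>x. k (- x))"
    proof (rule lipschitz_onI)
      show "dist (k (- x)) (k (- y)) \<le> L * dist x y" for x y
        using lipschitz_onD[OF k(1), of "- x" "- y"] by (simp add: dist_norm norm_minus_commute)
    qed (rule lipschitz_on_nonneg[OF k(1)])
    have "conv f (\<lambda>x. k (- x)) 0 = 0"
      by (rule conv_zero[OF fm p(1) N k' _ _ _ p(2) \<theta> zero, of 1 R]) (use k in \<open>force\<close>)+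
    then show ?thesis by (simp add: conv_def)
  qed
  have ball0: "AE x in lborel. f x * indicator (ball 0 R) x = 0" for R :: real
  proof (rule AE_zero_if_open_integrals_zero)
    have nint: "integrable lborel (\<lambda>y. norm (f y) * indicator (ball 0 R) y)"
      using local_bound(1)[OF fm p(1) N lipschitz_on_constant[of UNIV 0], of 0 R 0] by simp
    have [measurable]: "ball (0::'a) R \<in> sets borel" by simp
    have [measurable]: "(\<lambda>y. f y * indicator (ball 0 R) y) \<in> borel_measurable borel" by measurable
    show gint: "integrable lborel (\<lambda>x. f x * indicator (ball 0 R) x)"
      by (rule Bochner_Integration.integrable_bound[OF nint]) (auto simp: norm_mult indicator_def)
    fix U :: "'a set" assume U: "open U"
    define V where "V = U \<inter> ball 0 R"
    have V: "open V" "V \<subseteq> ball 0 R" using U by (auto simp: V_def)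
    show "(LINT x:U|lborel. f x * indicator (ball 0 R) x) = 0"
    \<comment> \<open>The distance to the empty set is 0 by convention, which would spoil the
      functions \<open>k j\<close>; a bounded \<open>V\<close> excludes this case.\<close>
    proof (cases "- V = {}")
      case True
      then have "ball (0::'a) R = UNIV" using V by auto
      then show ?thesis using bounded_ball[of "0::'a" R] not_bounded_UNIV by metis
    next
      case ne: False
      \<comment> \<open>These functions increase to the indicator of the open set
        \<open>V\<close>.\<close>
      define k where "k j x = min 1 (real j * infdist x (- V))" for j :: nat and x :: 'a
      have kV: "k j x = 0" if "x \<notin> V" for j x using that by (simp add: k_def)
      have k01: "0 \<le> k j x" "k j x \<le> 1" for j x by (auto simp: k_def infdist_nonneg)
      have lip: "(real j)-lipschitz_on UNIV (k j)" for j
      proof (rule lipschitz_onI)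
        fix x y
        have "\<bar>k j x - k j y\<bar> \<le> \<bar>real j * infdist x (- V) - real j * infdist y (- V)\<bar>" by (auto simp: k_def min_def)
        also have "\<dots> = real j * \<bar>infdist x (- V) - infdist y (- V)\<bar>" by (simp add: right_diff_distrib[symmetric] abs_mult)
        also have "\<dots> \<le> real j * dist x y" by (intro mult_left_mono infdist_triangle_abs) simp
        finally show "dist (k j x) (k j y) \<le> real j * dist x y" by (simp add: dist_real_def)
      qed simp
      have z: "(LINT y|lborel. f y * complex_of_real (k j y)) = 0" for j
        by (rule orth[OF lip[of j] k01(1)[of j] k01(2)[of j], where R = R]) (use kV V in blast)
      have lim: "(\<lambda>j. k j x) \<longlonglongrightarrow> indicator V x" for x
      proof (cases "x \<in> V")
        case True
        have "closed (- V)" using V(1) by (simp add: closed_def)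
        then have pos: "0 < infdist x (- V)" using infdist_pos_not_in_closed[of "- V" x] ne True by simp
        obtain j0 :: nat where j0: "1 / infdist x (- V) \<le> real j0" using real_arch_simple by blast
        have "k j x = 1" if "j0 \<le> j" for j
        proof -
          have "1 / infdist x (- V) \<le> real j" using j0 that by linarith
          then have "1 \<le> real j * infdist x (- V)" using pos by (simp add: divide_le_eq)
          then show ?thesis by (simp add: k_def)
        qed
        then have "eventually (\<lambda>j. k j x = 1) sequentially" by (auto simp: eventually_sequentially)
        then show ?thesis using True by (simp add: tendsto_eventually)
      qed (simp add: kV)
      have [measurable]: "V \<in> sets borel" using V by simp
      have km: "k j \<in> borel_measurable borel" for j
        by (intro borel_measurable_continuous_onI lipschitz_on_continuous_on[OF lip])
      have "(\<lambda>j. LINT y|lborel. f y * complex_of_real (k j y)) \<longlonglongrightarrow> (LINT y|lborel. f y * complex_of_real (indicator V y))"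
      proof (rule integral_dominated_convergence[OF _ _ nint])
        show "(\<lambda>y. f y * complex_of_real (indicator V y)) \<in> borel_measurable lborel" by measurable
        show "(\<lambda>y. f y * complex_of_real (k j y)) \<in> borel_measurable lborel" for j
          unfolding measurable_lborel2 by (rule borel_measurable_times[OF fm measurable_compose[OF km borel_measurable_of_real]])
        show "AE y in lborel. (\<lambda>j. f y * complex_of_real (k j y)) \<longlonglongrightarrow> f y * complex_of_real (indicator V y)"
          by (intro AE_I2 tendsto_intros lim)
        show "AE y in lborel. norm (f y * complex_of_real (k j y)) \<le> norm (f y) * indicator (ball 0 R) y" for j
        proof (rule AE_I2)
          fix y
          show "norm (f y * complex_of_real (k j y)) \<le> norm (f y) * indicator (ball 0 R) y"
          proof (cases "y \<in> V")
            case True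
            then have "y \<in> ball 0 R" using V by blast
            then show ?thesis using k01[of j y] by (simp add: norm_mult mult_left_le)
          qed (simp add: kV)
        qed
      qed
      then have "(LINT y|lborel. f y * complex_of_real (indicator V y)) = 0" by (simp add: z LIMSEQ_const_iff)
      moreover have "indicator U x *\<^sub>R (f x * indicator (ball 0 R) x) = f x * complex_of_real (indicator V x)" for x
        by (auto simp: V_def indicator_def)
      ultimately show ?thesis by (simp add: set_lebesgue_integral_def)
    qed
  qed
  have "AE x in lborel. \<forall>R::nat. f x * indicator (ball 0 (real R)) x = 0"
    unfolding AE_all_countable using ball0 by blast
  then show ?thesis
  proof eventually_elim
    case (elim x)
    obtain R :: nat where "norm x < real R" using reals_Archimedean2 by blast
    then show ?case using elim[rule_format, of R] by simp
  qed
qed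

section \<open>Transfer from the group to Euclidean space\<close>

lemma haar_measureD:
  assumes "is_haar_measure M"
  shows haar_sets: "sets M = sets borel" and haar_space: "space M = UNIV"
    and haar_compact: "compact C \<Longrightarrow> emeasure M C < \<infinity>"
    and haar_shift: "A \<in> sets borel \<Longrightarrow> emeasure M ((+) g ` A) = emeasure M A"
    and haar_nonzero: "emeasure M UNIV \<noteq> 0"
proof -
  note h = assms[unfolded is_haar_measure_def]
  show "sets M = sets borel" using h by (elim conjE)
  show "space M = UNIV" using h by (elim conjE)
  show "emeasure M UNIV \<noteq> 0" using h by (elim conjE)
  have "\<forall>C. compact C \<longrightarrow> emeasure M C < \<infinity>" using h by (elim conjE)
  then show "compact C \<Longrightarrow> emeasure M C < \<infinity>" by blast
  have "\<forall>g. \<forall>A\<in>sets borel. emeasure M ((+) g ` A) = emeasure M A" using h by (elim conjE)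
  then show "A \<in> sets borel \<Longrightarrow> emeasure M ((+) g ` A) = emeasure M A" by blast
qed

lemma borel_translate:
  fixes A :: "'g::topological_ab_group_add set"
  assumes "A \<in> sets borel"
  shows "(+) g ` A \<in> sets borel"
proof -
  have "(\<lambda>x. x - g) \<in> borel_measurable borel" by (intro borel_measurable_continuous_onI continuous_intros)
  from measurable_sets[OF this assms] have "(\<lambda>x. x - g) -` A \<in> sets borel" by simp
  moreover have "(\<lambda>x. x - g) -` A = (+) g ` A" by (force simp: algebra_simps image_iff)
  ultimately show ?thesis by simp
qed

lemma haar_AE_shift:
  assumes M: "is_haar_measure M" and AE: "AE x in M. P x"
  shows "AE x in M. P (x - s)"
proof -
  obtain N where N: "{x \<in> space M. \<not> P x} \<subseteq> N" "emeasure M N = 0" "N \<in> sets M"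
    using AE by (rule AE_E)
  have "(+) s ` N \<in> null_sets M"
    using N haar_shift[OF M, of N s] borel_translate[of N s] by (auto simp: null_sets_def haar_sets[OF M])
  moreover have "{x \<in> space M. \<not> P (x - s)} \<subseteq> (+) s ` N"
  proof
    fix x assume "x \<in> {x \<in> space M. \<not> P (x - s)}"
    then have "x - s \<in> N" using N by (auto simp: haar_space[OF M])
    then show "x \<in> (+) s ` N" by (intro image_eqI[of _ _ "x - s"]) auto
  qed
  ultimately show ?thesis by (rule AE_I')
qed

text \<open>Otherwise the whole group, a finite union of translates of \<open>K\<close>, would be a
  null set.\<close>

lemma haar_subgroup_nonzero:
  fixes M :: "'g::{topological_ab_group_add, t2_space} measure"
  assumes M: "is_haar_measure M" and K: "closed K" "finite_index K" "add_subgroup K"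
  shows "emeasure M K \<noteq> 0"
proof
  assume z: "emeasure M K = 0"
  have Kb: "K \<in> sets borel" using K by simp
  have "\<Union>(range (\<lambda>g. (+) g ` K)) \<in> null_sets M"
  proof (rule null_sets_UN'[where N = id, simplified])
    show "countable (range (\<lambda>g. (+) g ` K))" using K by (simp add: finite_index_def countable_finite)
    show "C \<in> null_sets M" if C: "C \<in> range (\<lambda>g. (+) g ` K)" for C
      using C z haar_shift[OF M Kb] borel_translate[OF Kb] by (auto simp: null_sets_def haar_sets[OF M])
  qed
  moreover have "\<Union>(range (\<lambda>g. (+) g ` K)) = UNIV"
  proof -
    have "x \<in> (+) x ` K" for x using K(3) by (intro image_eqI[of _ _ 0]) (auto simp: add_subgroup_def)
    then show ?thesis by blast
  qed
  ultimately show False using haar_nonzero[OF M] by (simp add: null_sets_def)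
qed

text \<open>Uniqueness of Haar measure on \<open>\<real>\<^sup>n\<close>: evaluate the integral of
  \<open>1\<^sub>Q(y) 1\<^sub>B(x + y)\<close> for the unit cube \<open>Q\<close> in both orders.\<close>

lemma translation_invariant_eq_lborel:
  fixes \<mu> :: "'a::euclidean_space measure"
  assumes "sigma_finite_measure \<mu>" and s[measurable_cong]: "sets \<mu> = sets borel"
    and inv: "\<And>B t. B \<in> sets borel \<Longrightarrow> emeasure \<mu> {x. x + t \<in> B} = emeasure \<mu> B" and B: "B \<in> sets borel"
  shows "emeasure \<mu> B = emeasure \<mu> (box (- One) 0) * emeasure lborel B"
proof -
  interpret sigma_finite_measure \<mu> by fact
  interpret P: pair_sigma_finite \<mu> lborel ..
  have [measurable]: "B \<in> sets borel" by fact
  define Q where "Q = box (0::'a) One"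
  have [measurable]: "Q \<in> sets borel" by (simp add: Q_def)
  have sp: "space \<mu> = UNIV" using sets_eq_imp_space_eq[OF s] by simp
  have Q1: "emeasure lborel Q = 1" by (simp add: Q_def)
  have invn: "(\<integral>\<^sup>+x. indicator B (x + y) \<partial>\<mu>) = emeasure \<mu> B" for y
  proof -
    have "(\<integral>\<^sup>+x. indicator B (x + y) \<partial>\<mu>) = (\<integral>\<^sup>+x. indicator {x. x + y \<in> B} x \<partial>\<mu>)"
      by (intro nn_integral_cong) (auto simp: indicator_def)
    also have "\<dots> = emeasure \<mu> {x. x + y \<in> B}" by (rule nn_integral_indicator) measurable
    finally show ?thesis using inv[OF B] by simp
  qed
  \<comment> \<open>y - x lies in \<open>Q\<close> exactly if x - y lies in -Q; the constant is
    therefore the measure of the reflected cube.\<close>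
  have Qinv: "(\<integral>\<^sup>+x. indicator Q (y - x) \<partial>\<mu>) = emeasure \<mu> (box (- One) 0)" for y
  proof -
    have "(\<integral>\<^sup>+x. indicator Q (y - x) \<partial>\<mu>) = (\<integral>\<^sup>+x. indicator {x. x + - y \<in> box (- One) 0} x \<partial>\<mu>)"
      by (intro nn_integral_cong) (auto simp: indicator_def Q_def mem_box inner_diff_left algebra_simps)
    also have "\<dots> = emeasure \<mu> {x. x + - y \<in> box (- One) 0}" by (rule nn_integral_indicator) measurable
    finally show ?thesis using inv[of "box (- One) 0" "- y"] by simp
  qed
  have "emeasure \<mu> B = (\<integral>\<^sup>+y. indicator Q y * emeasure \<mu> B \<partial>lborel)"
    by (simp add: nn_integral_multc Q1)
  also have "\<dots> = (\<integral>\<^sup>+y. (\<integral>\<^sup>+x. indicator Q y * indicator B (x + y) \<partial>\<mu>) \<partial>lborel)"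
    by (simp add: nn_integral_cmult invn)
  also have "\<dots> = (\<integral>\<^sup>+x. (\<integral>\<^sup>+y. indicator Q y * indicator B (x + y) \<partial>lborel) \<partial>\<mu>)"
    by (rule P.Fubini') measurable
  also have "\<dots> = (\<integral>\<^sup>+x. (\<integral>\<^sup>+y. indicator Q (y - x) * indicator B y \<partial>lborel) \<partial>\<mu>)"
    using nn_integral_lborel_shift[of "\<lambda>y. indicator Q (y - x) * indicator B y" x for x] by (simp add: add.commute)
  also have "\<dots> = (\<integral>\<^sup>+y. (\<integral>\<^sup>+x. indicator Q (y - x) * indicator B y \<partial>\<mu>) \<partial>lborel)"
    by (rule P.Fubini'[symmetric]) measurable
  also have "\<dots> = (\<integral>\<^sup>+y. emeasure \<mu> (box (- One) 0) * indicator B y \<partial>lborel)"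
    by (simp add: nn_integral_multc Qinv)
  also have "\<dots> = emeasure \<mu> (box (- One) 0) * emeasure lborel B"
    by (simp add: nn_integral_cmult)
  finally show ?thesis .
qed

text \<open>\<open>T\<close> parametrises the coset \<open>Kg\<close> by \<open>\<real>\<^sup>n\<close>, so that Haar measure on \<open>Kg\<close> is \<open>c\<close> times the
  image of Lebesgue measure.\<close>

lemma vanishing_on_chart:
  fixes M :: "'g::{topological_ab_group_add, t2_space} measure" and T :: "'a::euclidean_space \<Rightarrow> 'g"
  assumes M: "is_haar_measure M" and Kg: "Kg \<in> sets borel"
    and T: "T \<in> borel_measurable borel"
    and em: "\<And>A. A \<in> sets borel \<Longrightarrow> emeasure M (A \<inter> Kg) = c * emeasure lborel (T -` A)" and c: "c \<noteq> 0"
    and sh: "\<And>x s. s \<in> supp \<alpha> \<Longrightarrow> T (x - e s) = T x - s" and inj: "inj_on e (supp \<alpha>)"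
    and p: "1 \<le> p" "DIM('a) = 1 \<or> p \<le> 2 * real DIM('a) / (real DIM('a) - 1)"
    and f: "in_Lp M p f" and \<alpha>: "finite (supp \<alpha>)" "supp \<alpha> \<noteq> {}" and zero: "AE x in M. gr_act \<alpha> f x = 0"
  shows "AE x in M. x \<in> Kg \<longrightarrow> f x = 0"
proof -
  note [measurable_cong] = haar_sets[OF M]
  note [measurable] = T Kg
  have fm[measurable]: "f \<in> borel_measurable borel"
    using f measurable_cong_sets[OF haar_sets[OF M] refl] by (auto simp: in_Lp_def)
  have nn: "c * (\<integral>\<^sup>+x. F (T x) \<partial>lborel) \<le> (\<integral>\<^sup>+x. F x \<partial>M)" if [measurable]: "F \<in> borel_measurable borel" for F
  proof -
    have "density M (indicator Kg) = scale_measure c (distr lborel borel T)"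
    proof (rule measure_eqI)
      show "sets (density M (indicator Kg)) = sets (scale_measure c (distr lborel borel T))"
        by (simp add: haar_sets[OF M])
      fix A assume "A \<in> sets (density M (indicator Kg))"
      then have A[measurable]: "A \<in> sets borel" by (simp add: haar_sets[OF M])
      have "emeasure (density M (indicator Kg)) A = (\<integral>\<^sup>+x. indicator Kg x * indicator A x \<partial>M)"
        by (rule emeasure_density) measurable
      also have "\<dots> = (\<integral>\<^sup>+x. indicator (A \<inter> Kg) x \<partial>M)" by (intro nn_integral_cong) (auto simp: indicator_def)
      also have "\<dots> = emeasure M (A \<inter> Kg)" by (rule nn_integral_indicator) measurable
      also have "\<dots> = emeasure (scale_measure c (distr lborel borel T)) A"
        by (simp add: em emeasure_distr)
      finally show "emeasure (density M (indicator Kg)) A = emeasure (scale_measure c (distr lborel borel T)) A" .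
    qed
    then have "(\<integral>\<^sup>+x. F x \<partial>density M (indicator Kg)) = (\<integral>\<^sup>+x. F x \<partial>scale_measure c (distr lborel borel T))" by simp
    also have "\<dots> = c * (\<integral>\<^sup>+x. F (T x) \<partial>lborel)"
      by (simp add: nn_integral_scale_measure nn_integral_distr)
    finally have "c * (\<integral>\<^sup>+x. F (T x) \<partial>lborel) = (\<integral>\<^sup>+x. indicator Kg x * F x \<partial>M)"
      by (simp add: nn_integral_density)
    also have "\<dots> \<le> (\<integral>\<^sup>+x. F x \<partial>M)" by (intro nn_integral_mono) (auto simp: indicator_def)
    finally show ?thesis .
  qed
  define g where "g x = f (T x)" for x
  have gm: "g \<in> borel_measurable borel" unfolding g_def by measurable
  have gLp: "(\<integral>\<^sup>+x. ennreal (norm (g x) powr p) \<partial>lborel) < \<infinity>"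
  proof -
    have "c * (\<integral>\<^sup>+x. ennreal (norm (g x) powr p) \<partial>lborel) \<le> (\<integral>\<^sup>+x. ennreal (norm (f x) powr p) \<partial>M)"
      unfolding g_def by (rule nn) measurable
    also have "\<dots> < \<infinity>" using f by (simp add: in_Lp_def)
    finally show ?thesis using c by (auto simp: ennreal_mult_less_top)
  qed
  \<comment> \<open>The coefficients of \<alpha> transported along \<open>e\<close>. By
    \<open>sh\<close>, the action of \<beta> on the composition of f with \<open>T\<close> is the
    action of \<alpha> on f followed by composition with \<open>T\<close>.\<close>
  define \<beta> where "\<beta> y = (if y \<in> e ` supp \<alpha> then \<alpha> (the_inv_into (supp \<alpha>) e y) else 0)" for y
  have \<beta>e: "\<beta> (e s) = \<alpha> s" if "s \<in> supp \<alpha>" for s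
    using that by (simp add: \<beta>_def the_inv_into_f_f[OF inj])
  have supp\<beta>: "supp \<beta> = e ` supp \<alpha>"
    using \<beta>e by (auto simp: supp_def \<beta>_def split: if_splits)
  have act: "gr_act \<beta> g x = gr_act \<alpha> f (T x)" for x
    unfolding gr_act_def supp\<beta> by (subst sum.reindex[OF inj]) (simp add: \<beta>e g_def sh)
  have null: "AE x in lborel. P (T x)" if P: "AE x in M. P x" for P
  proof -
    obtain N where N: "{x \<in> space M. \<not> P x} \<subseteq> N" "emeasure M N = 0" "N \<in> sets M" using P by (rule AE_E)
    have Nb[measurable]: "N \<in> sets borel" using N by (simp add: haar_sets[OF M])
    have "emeasure M (N \<inter> Kg) \<le> emeasure M N" by (rule emeasure_mono) (use N in auto)
    then have "c * emeasure lborel (T -` N) = 0" using em[OF Nb] N by simp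
    then have "emeasure lborel (T -` N) = 0" using c by simp
    moreover have "T -` N \<in> sets lborel" using measurable_sets[OF T Nb] by simp
    ultimately have "T -` N \<in> null_sets lborel" by (simp add: null_sets_def)
    moreover have "{x \<in> space lborel. \<not> P (T x)} \<subseteq> T -` N" using N by (auto simp: haar_space[OF M])
    ultimately show ?thesis by (rule AE_I')
  qed
  have "AE x in lborel. g x = 0"
    by (rule translates_independent_lborel[OF gm p gLp, of \<beta>])
       (use \<alpha> null[OF zero] in \<open>auto simp: supp\<beta> act\<close>)
  then have "emeasure lborel {x \<in> space lborel. g x \<noteq> 0} = 0"
    by (subst (asm) AE_iff_measurable[OF _ refl]) (use gm in auto)
  moreover have "{x \<in> space lborel. g x \<noteq> 0} = T -` {y. f y \<noteq> 0}" by (auto simp: g_def)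
  moreover have fb: "{y. f y \<noteq> 0} \<in> sets borel" using measurable_sets[OF fm, of "- {0}"] by (simp add: vimage_def)
  \<comment> \<open>Read in the other direction, \<open>em\<close> turns a null preimage under
    \<open>T\<close> into a null subset of \<open>Kg\<close>.\<close>
  ultimately have "emeasure M ({y. f y \<noteq> 0} \<inter> Kg) = 0" using em[OF fb] by simp
  then have "{y. f y \<noteq> 0} \<inter> Kg \<in> null_sets M" using fb Kg by (auto simp: null_sets_def haar_sets[OF M])
  then show ?thesis by (rule AE_I') auto
qed

text \<open>What the cases R^n and Z^n have in common: an additive injection \<open>e\<close> of
  \<open>K\<close> into R^n and, for each coset, a map \<open>T g\<close> that carries translation
  by e(s) to translation by s. The map \<open>T g\<close> may collapse whole cubes to points, as it
  does in the discrete case.\<close>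

lemma linear_independence_of_charts:
  fixes M :: "'g::{topological_ab_group_add, t2_space} measure" and T :: "'g \<Rightarrow> 'a::euclidean_space \<Rightarrow> 'g"
  assumes M: "is_haar_measure M" and K: "closed K" "add_subgroup K" "finite_index K"
    and T: "\<And>g. T g \<in> borel_measurable borel"
    and em: "\<And>g A. A \<in> sets borel \<Longrightarrow> emeasure M (A \<inter> (+) g ` K) = c * emeasure lborel (T g -` A)"
    and sh: "\<And>g x s. s \<in> K \<Longrightarrow> T g (x - e s) = T g x - s"
    and inj: "inj_on e K" and add: "\<And>x y. x \<in> K \<Longrightarrow> y \<in> K \<Longrightarrow> e (x + y) = e x + e y"
    and p: "1 \<le> p" "DIM('a) = 1 \<or> p \<le> 2 * real DIM('a) / (real DIM('a) - 1)"
    and H: "add_subgroup H" and \<theta>: "\<theta> \<in> group_ring H"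
    and f: "in_Lp M p f" "\<not> (AE x in M. f x = 0)"
    and nzd: "non_zerodivisor H \<theta> \<or> torsion_free H \<and> \<theta> \<noteq> (\<lambda>_. 0)"
  shows "\<not> (AE x in M. gr_act \<theta> f x = 0)"
proof
  assume zero: "AE x in M. gr_act \<theta> f x = 0"
  have cosets: "x \<in> (+) x ` K" for x using K(2) by (intro image_eqI[of _ _ 0]) (auto simp: add_subgroup_def)
  have Kg: "(+) g ` K \<in> sets borel" for g using borel_translate[of K g] K(1) by simp
  \<comment> \<open>With c = 0 the formula \<open>em\<close> for the full set and g = 0 would make
    \<open>K\<close> a null set.\<close>
  have c: "c \<noteq> 0"
  proof
    assume "c = 0"
    then have "emeasure M (UNIV \<inter> (+) 0 ` K) = 0" using em[of UNIV 0] by simp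
    then show False using haar_subgroup_nonzero[OF M K(1,3,2)] by simp
  qed
  have nz: "non_zerodivisor H \<theta>"
  proof (cases "non_zerodivisor H \<theta>")
    case False
    then have tf: "torsion_free H" "\<theta> \<noteq> (\<lambda>_. 0)" using nzd by auto
    obtain N where N: "0 < N" "\<And>x. ((+) x ^^ N) 0 \<in> K" using finite_index_multiple_in[OF K(2,3)] by blast
    show ?thesis
    \<comment> \<open>Multiplication by \<open>N\<close> maps the group into \<open>K\<close>, and
      it is injective on the torsion-free group \<open>H\<close>.\<close>
    proof (rule non_zerodivisor_if_embeds[OF H \<theta> tf(2), where \<kappa> = "\<lambda>x. e (((+) x ^^ N) 0)"])
      show "e (((+) (x + y) ^^ N) 0) = e (((+) x ^^ N) 0) + e (((+) y ^^ N) 0)" for x y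
        unfolding funpow_add_distrib by (rule add[OF N(2) N(2)])
      show "inj_on (\<lambda>x. e (((+) x ^^ N) 0)) H"
      proof (rule inj_onI)
        fix x y assume xy: "x \<in> H" "y \<in> H" "e (((+) x ^^ N) 0) = e (((+) y ^^ N) 0)"
        have "((+) x ^^ N) 0 = ((+) y ^^ N) 0" by (rule inj_onD[OF inj xy(3) N(2) N(2)])
        moreover have "((+) x ^^ N) 0 = ((+) (x - y) ^^ N) 0 + ((+) y ^^ N) 0"
          unfolding funpow_add_distrib[symmetric] by simp
        ultimately have "((+) (x - y) ^^ N) 0 = 0" by simp
        then have "x - y = 0" using tf(1) N(1) add_subgroup_diff[OF H xy(1,2)] unfolding torsion_free_def by blast
        then show "x = y" by simp
      qed
    qed
  qed
  obtain \<beta> where \<beta>: "\<beta> \<in> group_ring H" "gr_mult \<theta> \<beta> \<noteq> (\<lambda>_. 0)" "supp (gr_mult \<theta> \<beta>) \<subseteq> K"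
    using non_zerodivisor_multiple_supported_in[OF H K(2,3) \<theta> nz] by blast
  have fin: "finite (supp \<theta>)" "finite (supp \<beta>)" using \<theta> \<beta> by (auto simp: group_ring_def)
  define \<alpha> where "\<alpha> = gr_mult \<theta> \<beta>"
  have \<alpha>: "finite (supp \<alpha>)" "supp \<alpha> \<noteq> {}" "supp \<alpha> \<subseteq> K"
    using finite_subset[OF supp_gr_mult[of \<theta> \<beta>]] fin \<beta> by (auto simp: \<alpha>_def supp_def)
  \<comment> \<open>Finitely many translates of a null set are involved, one for each element of the
    support of \<beta>.\<close>
  have "AE x in M. \<forall>s\<in>supp \<beta>. gr_act \<theta> f (x - s) = 0"
    by (rule AE_finite_allI[OF fin(2)]) (rule haar_AE_shift[OF M zero])
  then have zero\<alpha>: "AE x in M. gr_act \<alpha> f x = 0"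
    by eventually_elim (simp add: \<alpha>_def gr_act_gr_mult[OF fin])
  have "AE x in M. x \<in> (+) g ` K \<longrightarrow> f x = 0" for g
    by (rule vanishing_on_chart[OF M Kg T em c _ _ p f(1) \<alpha>(1,2) zero\<alpha>, where e = e])
       (use \<alpha>(3) sh inj in \<open>auto intro: inj_on_subset\<close>)
  then have "AE x in M. \<forall>C\<in>range (\<lambda>g. (+) g ` K). x \<in> C \<longrightarrow> f x = 0"
    using K(3) by (intro AE_finite_allI) (auto simp: finite_index_def)
  then have "AE x in M. f x = 0" by eventually_elim (use cosets in blast)
  then show False using f(2) by simp
qed

text \<open>The pullback of \<open>M\<close> along \<phi> is a translation-invariant \<sigma>-finite
  measure on R^n, hence a multiple of Lebesgue measure. Invariance of \<open>M\<close> makes the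
  constant the same for all cosets.\<close>

lemma real_chart_measure:
  fixes M :: "'g::{topological_ab_group_add, t2_space} measure" and \<phi> :: "'a::euclidean_space \<Rightarrow> 'g"
  assumes M: "is_haar_measure M" and K: "closed K"
    and add: "additive_map \<phi>" and hom: "homeomorphism UNIV K \<phi> \<psi>"
  shows "\<exists>c. \<forall>g. \<forall>A\<in>sets borel. emeasure M (A \<inter> (+) g ` K) = c * emeasure lborel ((\<lambda>x. g + \<phi> x) -` A)"
proof -
  have \<phi>: "\<And>x. \<psi> (\<phi> x) = x" "\<And>y. y \<in> K \<Longrightarrow> \<phi> (\<psi> y) = y" "range \<phi> = K" "continuous_on UNIV \<phi>" "continuous_on K \<psi>"
    using hom by (auto simp: homeomorphism_def)
  have inj: "inj \<phi>" using \<phi>(1) by (metis injI)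
  have Kb[measurable]: "K \<in> sets borel" using K by simp
  \<comment> \<open>\<psi> is known to be continuous on \<open>K\<close> only; its extension by 0 is
    Borel measurable on the whole group.\<close>
  define \<psi>' where "\<psi>' x = indicator K x *\<^sub>R \<psi> x" for x
  have \<psi>'m[measurable]: "\<psi>' \<in> borel_measurable borel"
    unfolding \<psi>'_def by (rule borel_measurable_continuous_on_indicator[OF Kb \<phi>(5)])
  have image: "\<phi> ` B = K \<inter> \<psi>' -` B" for B
  proof (intro equalityI subsetI)
    fix y assume "y \<in> \<phi> ` B" then show "y \<in> K \<inter> \<psi>' -` B" using \<phi> by (auto simp: \<psi>'_def)
  next
    fix y assume "y \<in> K \<inter> \<psi>' -` B"
    then show "y \<in> \<phi> ` B" using \<phi>(2)[of y] by (intro image_eqI[of _ _ "\<psi> y"]) (auto simp: \<psi>'_def)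
  qed
  have img_b: "\<phi> ` B \<in> sets borel" if "B \<in> sets borel" for B
    unfolding image using measurable_sets[OF \<psi>'m that] by auto
  note [measurable_cong] = haar_sets[OF M]
  define \<mu> where "\<mu> = distr (density M (indicator K)) borel \<psi>'"
  have \<mu>s: "sets \<mu> = sets borel" by (simp add: \<mu>_def)
  have \<mu>: "emeasure \<mu> B = emeasure M (\<phi> ` B)" if B[measurable]: "B \<in> sets borel" for B
  proof -
    have "emeasure \<mu> B = emeasure (density M (indicator K)) (\<psi>' -` B)"
      unfolding \<mu>_def by (subst emeasure_distr) (auto simp: haar_space[OF M])
    also have "\<dots> = (\<integral>\<^sup>+x. indicator K x * indicator (\<psi>' -` B) x \<partial>M)"
      using measurable_sets[OF \<psi>'m B] by (intro emeasure_density) (auto simp: haar_sets[OF M])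
    also have "\<dots> = (\<integral>\<^sup>+x. indicator (\<phi> ` B) x \<partial>M)"
      unfolding image by (intro nn_integral_cong) (auto simp: indicator_def)
    also have "\<dots> = emeasure M (\<phi> ` B)" by (rule nn_integral_indicator) (use img_b[OF B] in \<open>simp add: haar_sets[OF M]\<close>)
    finally show ?thesis .
  qed
  have fin: "emeasure \<mu> C < \<infinity>" if "compact C" for C
    using haar_compact[OF M compact_continuous_image[OF continuous_on_subset[OF \<phi>(4)] that]] \<mu>[of C] that
    by (simp add: borel_compact)
  \<comment> \<open>The images of closed balls under \<phi> are compact, and Haar measure is finite
    on compact sets.\<close>
  have "sigma_finite_measure \<mu>"
  proof
    show "\<exists>A. countable A \<and> A \<subseteq> sets \<mu> \<and> \<Union>A = space \<mu> \<and> (\<forall>a\<in>A. emeasure \<mu> a \<noteq> \<infinity>)"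
    proof (intro exI[of _ "range (\<lambda>n::nat. cball (0::'a) (real n))"] conjI ballI)
      show "range (\<lambda>n::nat. cball (0::'a) (real n)) \<subseteq> sets \<mu>" by (auto simp: \<mu>s)
      show "\<Union>(range (\<lambda>n::nat. cball (0::'a) (real n))) = space \<mu>"
        using real_arch_simple by (auto simp: \<mu>_def)
      fix a assume "a \<in> range (\<lambda>n::nat. cball (0::'a) (real n))"
      then have "compact a" by auto
      from fin[OF this] show "emeasure \<mu> a \<noteq> \<infinity>" by simp
    qed simp
  qed
  moreover have "emeasure \<mu> {x. x + t \<in> B} = emeasure \<mu> B" if B[measurable]: "B \<in> sets borel" for B t
  proof -
    have [measurable]: "{x. x + t \<in> B} \<in> sets borel" by measurable
    have "(+) (\<phi> t) ` \<phi> ` {x. x + t \<in> B} = \<phi> ` B"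
    proof -
      have e: "\<phi> t + \<phi> x = \<phi> (x + t)" for x using add by (simp add: additive_map_def add.commute)
      have "(\<lambda>x. x + t) ` {x. x + t \<in> B} = B"
        by (auto intro!: image_eqI[where x = "x - t" for x])
      then show ?thesis unfolding image_image e using image_image[of \<phi> "\<lambda>x. x + t" "{x. x + t \<in> B}"] by simp
    qed
    then show ?thesis
      using haar_shift[OF M img_b, of "{x. x + t \<in> B}" "\<phi> t"] by (simp add: \<mu>)
  qed
  ultimately have lb: "emeasure \<mu> B = emeasure \<mu> (box (- One) 0) * emeasure lborel B" if "B \<in> sets borel" for B
    using translation_invariant_eq_lborel[OF _ \<mu>s _ that] by blast
  show ?thesis
  proof (intro exI[of _ "emeasure \<mu> (box (- One) 0)"] allI ballI)
    fix g and A :: "'g set" assume A: "A \<in> sets borel"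
    define B where "B = (\<lambda>x. g + \<phi> x) -` A"
    have "(\<lambda>x. g + \<phi> x) \<in> borel_measurable borel"
      by (intro borel_measurable_continuous_onI continuous_intros \<phi>(4))
    from measurable_sets[OF this A] have B: "B \<in> sets borel" by (simp add: B_def)
    have "A \<inter> (+) g ` K = (+) g ` \<phi> ` B" unfolding \<phi>(3)[symmetric] by (auto simp: B_def)
    then have "emeasure M (A \<inter> (+) g ` K) = emeasure \<mu> B" using haar_shift[OF M img_b[OF B], of g] \<mu>[OF B] by simp
    then show "emeasure M (A \<inter> (+) g ` K) = emeasure \<mu> (box (- One) 0) * emeasure lborel ((\<lambda>x. g + \<phi> x) -` A)"
      using lb[OF B] by (simp add: B_def)
  qed
qed

section \<open>Charts of the discrete case by integer parts\<close>

definition vec_floor :: "real ^ 'n \<Rightarrow> int ^ 'n" where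
  "vec_floor x = (\<chi> i. \<lfloor>x $ i\<rfloor>)"

definition vec_real :: "int ^ 'n \<Rightarrow> real ^ 'n" where
  "vec_real v = (\<chi> i. real_of_int (v $ i))"

lemma vec_floor_diff: "vec_floor (x - vec_real v) = vec_floor x - v"
  by (simp add: vec_floor_def vec_real_def vec_eq_iff)

text \<open>The cell is a half-open unit cube, caught between an open and a closed box of measure
  1.\<close>

lemma floor_cell:
  fixes v :: "int ^ 'n"
  shows "vec_floor -` {v} \<in> sets borel" and "emeasure lborel (vec_floor -` {v}) = 1"
proof -
  have eq: "vec_floor -` {v} = {x. \<forall>i. \<lfloor>x $ i\<rfloor> = v $ i}" by (auto simp: vec_floor_def vec_eq_iff)
  also have "\<dots> = (\<Inter>i\<in>UNIV. {x. real_of_int (v $ i) \<le> x $ i} \<inter> {x. x $ i < real_of_int (v $ i) + 1})"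
    by (auto simp: floor_eq_iff)
  finally have cell: "vec_floor -` {v} = (\<Inter>i\<in>UNIV. {x. real_of_int (v $ i) \<le> x $ i} \<inter> {x. x $ i < real_of_int (v $ i) + 1})" .
  have "closed {x::real^'n. real_of_int (v $ i) \<le> x $ i}" "open {x::real^'n. x $ i < real_of_int (v $ i) + 1}" for i
    by (intro closed_Collect_le open_Collect_less continuous_intros)+
  then show m: "vec_floor -` {v} \<in> sets borel"
    unfolding cell by (intro sets.finite_INT sets.Int) auto
  define l where "l = vec_real v"
  define u where "u = l + One"
  have li: "u $ i = real_of_int (v $ i) + 1" for i :: 'n
  proof -
    have "(One :: real ^ 'n) $ i = (One :: real ^ 'n) \<bullet> axis i 1" by (simp add: inner_axis)
    also have "\<dots> = 1" using inner_sum_left_Basis[of "axis i 1 :: real ^ 'n" "\<lambda>_. 1"] by (simp add: axis_in_Basis_iff)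
    finally show ?thesis by (simp add: u_def l_def vec_real_def)
  qed
  have "emeasure lborel (box l u) \<le> emeasure lborel (vec_floor -` {v})"
    by (rule emeasure_mono) (use m in \<open>auto simp: cell mem_box_cart li l_def vec_real_def less_imp_le\<close>)
  moreover have "emeasure lborel (vec_floor -` {v}) \<le> emeasure lborel (cbox l u)"
    by (rule emeasure_mono) (auto simp: cell mem_box_cart li l_def vec_real_def less_imp_le)
  ultimately show "emeasure lborel (vec_floor -` {v}) = 1"
    by (simp add: emeasure_lborel_cbox_eq emeasure_lborel_box_eq inner_add_left u_def)
qed

text \<open>All points of the group have the same mass, and each point of the countable coset
  corresponds to one cell of measure 1, so both sides count the elements v with g + \<phi>(v) in
  \<open>A\<close>.\<close>

lemma int_chart_measure:
  fixes M :: "'g::{topological_ab_group_add, t2_space} measure" and \<phi> :: "int ^ 'n \<Rightarrow> 'g"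
  assumes M: "is_haar_measure M" and K: "K = range \<phi>" and inj: "inj \<phi>"
  defines "T \<equiv> \<lambda>g x. g + \<phi> (vec_floor x)"
  shows "T g \<in> borel_measurable borel"
    and "A \<in> sets borel \<Longrightarrow> emeasure M (A \<inter> (+) g ` K) = emeasure M {0} * emeasure lborel (T g -` A)"
proof -
  have pre: "T g -` A = (\<Union>v\<in>{v. g + \<phi> v \<in> A}. vec_floor -` {v})" for A by (auto simp: T_def)
  show "T g \<in> borel_measurable borel"
    by (rule measurableI) (auto simp: pre intro!: sets.countable_UN' floor_cell)
  assume A: "A \<in> sets borel"
  define V where "V = {v. g + \<phi> v \<in> A}"
  have cnt: "countable V" by (rule countableI_type)
  have single: "emeasure M {x} = emeasure M {0}" for x
    using haar_shift[OF M, of "{0}" x] by simp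
  have "A \<inter> (+) g ` K = (\<lambda>v. g + \<phi> v) ` V" by (auto simp: K V_def)
  moreover have "inj_on (\<lambda>v. g + \<phi> v) V" using inj by (auto simp: inj_on_def)
  ultimately have "emeasure M (A \<inter> (+) g ` K) = (\<integral>\<^sup>+v. emeasure M {g + \<phi> v} \<partial>count_space V)"
    using emeasure_UN_countable[of V "\<lambda>v. {g + \<phi> v}" M] cnt
    by (auto simp: haar_sets[OF M] disjoint_family_on_def inj_on_def UNION_singleton_eq_range)
  also have "\<dots> = emeasure M {0} * (\<integral>\<^sup>+v. 1 \<partial>count_space V)" by (simp add: single[of "g + _"])
  also have "(\<integral>\<^sup>+v. 1 \<partial>count_space V) = (\<integral>\<^sup>+v. emeasure lborel (vec_floor -` {v} :: (real ^ 'n) set) \<partial>count_space V)"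
    by (simp add: floor_cell)
  also have "\<dots> = emeasure lborel (T g -` A)"
    unfolding pre V_def[symmetric] using cnt
    by (intro emeasure_UN_countable[symmetric]) (auto simp: floor_cell disjoint_family_on_def)
  finally show "emeasure M (A \<inter> (+) g ` K) = emeasure M {0} * emeasure lborel (T g -` A)" .
qed

theorem theorem8p3:
  fixes M :: "'g::{topological_ab_group_add, t2_space} measure"
    and p :: real
    and H :: "'g set"
    and \<theta> :: "'g \<Rightarrow> complex"
    and f :: "'g \<Rightarrow> complex"
  assumes lc: "locally_compact_space (euclidean :: 'g topology)"
    and haar: "is_haar_measure M"
    and p1: "1 \<le> p"
    and pn: "CARD('n::finite) = 1 \<or> p \<le> 2 * real CARD('n) / (real CARD('n) - 1)"
    and sub: "finite_index_copy TYPE(real ^ 'n) (undefined :: 'g) \<or>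
              finite_index_copy TYPE(int ^ 'n) (undefined :: 'g)"
    and H: "add_subgroup H"
    and \<theta>: "\<theta> \<in> group_ring H"
    and fLp: "in_Lp M p f"
    and fnz: "\<not> (AE x in M. f x = 0)"
  shows "(non_zerodivisor H \<theta> \<longrightarrow> \<not> (AE x in M. gr_act \<theta> f x = 0)) \<and>
         (torsion_free H \<and> \<theta> \<noteq> (\<lambda>_. 0) \<longrightarrow> \<not> (AE x in M. gr_act \<theta> f x = 0))"
proof -
  have pd: "DIM(real ^ 'n) = 1 \<or> p \<le> 2 * real DIM(real ^ 'n) / (real DIM(real ^ 'n) - 1)"
    using pn by simp
  have "\<not> (AE x in M. gr_act \<theta> f x = 0)" if nzd: "non_zerodivisor H \<theta> \<or> torsion_free H \<and> \<theta> \<noteq> (\<lambda>_. 0)"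
    using sub
  proof
    assume "finite_index_copy TYPE(real ^ 'n) (undefined :: 'g)"
    then obtain K and \<phi> :: "real ^ 'n \<Rightarrow> 'g" and \<psi> where K: "closed K" "add_subgroup K" "finite_index K"
      and add: "additive_map \<phi>" and hom: "homeomorphism UNIV K \<phi> \<psi>"
      unfolding finite_index_copy_def by blast
    have \<phi>: "\<And>x. \<psi> (\<phi> x) = x" "\<And>y. y \<in> K \<Longrightarrow> \<phi> (\<psi> y) = y" "continuous_on UNIV \<phi>"
      using hom by (auto simp: homeomorphism_def)
    have add': "\<phi> (x + y) = \<phi> x + \<phi> y" for x y using add by (simp add: additive_map_def)
    have diff: "\<phi> (x - y) = \<phi> x - \<phi> y" for x y using add'[of "x - y" y] by simp
    obtain c where c: "\<And>g A. A \<in> sets borel \<Longrightarrow> emeasure M (A \<inter> (+) g ` K) = c * emeasure lborel ((\<lambda>x. g + \<phi> x) -` A)"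
      using real_chart_measure[OF haar K(1) add hom] by blast
    show ?thesis
    proof (rule linear_independence_of_charts[OF haar K _ c _ _ _ p1 pd H \<theta> fLp fnz nzd, where e = \<psi>])
      show "(\<lambda>x. g + \<phi> x) \<in> borel_measurable borel" for g
        by (intro borel_measurable_continuous_onI continuous_intros \<phi>(3))
      show "g + \<phi> (x - \<psi> s) = g + \<phi> x - s" if "s \<in> K" for g x s using \<phi>(2)[OF that] by (simp add: diff)
      show "inj_on \<psi> K" using \<phi>(2) by (metis inj_onI)
      show "\<psi> (x + y) = \<psi> x + \<psi> y" if "x \<in> K" "y \<in> K" for x y
        using \<phi>(1)[of "\<psi> x + \<psi> y"] \<phi>(2) that by (simp add: add')
    qed
  next
    assume "finite_index_copy TYPE(int ^ 'n) (undefined :: 'g)"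
    then obtain K and \<phi> :: "int ^ 'n \<Rightarrow> 'g" and \<psi> where K: "closed K" "add_subgroup K" "finite_index K"
      and add: "additive_map \<phi>" and hom: "homeomorphism UNIV K \<phi> \<psi>"
      unfolding finite_index_copy_def by blast
    have \<phi>: "\<And>x. \<psi> (\<phi> x) = x" "\<And>y. y \<in> K \<Longrightarrow> \<phi> (\<psi> y) = y" "K = range \<phi>"
      using hom by (auto simp: homeomorphism_def)
    have inj: "inj \<phi>" using \<phi>(1) by (metis injI)
    have add': "\<phi> (x + y) = \<phi> x + \<phi> y" for x y using add by (simp add: additive_map_def)
    have diff: "\<phi> (x - y) = \<phi> x - \<phi> y" for x y using add'[of "x - y" y] by simp
    note chart = int_chart_measure[OF haar \<phi>(3) inj]
    show ?thesis
    \<comment> \<open>Here \<open>e\<close> includes Z^n into R^n; subtracting an integer vector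
      from x subtracts it from the integer part of x.\<close>
    proof (rule linear_independence_of_charts[OF haar K chart _ _ _ p1 pd H \<theta> fLp fnz nzd, where e = "\<lambda>s. vec_real (\<psi> s)"])
      show "g + \<phi> (vec_floor (x - vec_real (\<psi> s))) = g + \<phi> (vec_floor x) - s" if "s \<in> K" for g x s
        using \<phi>(2)[OF that] by (simp add: vec_floor_diff diff)
      show "inj_on (\<lambda>s. vec_real (\<psi> s)) K"
      proof (rule inj_onI)
        fix x y assume xy: "x \<in> K" "y \<in> K" "vec_real (\<psi> x) = vec_real (\<psi> y)"
        then have "\<psi> x = \<psi> y" by (simp add: vec_real_def vec_eq_iff)
        then show "x = y" using \<phi>(2) xy by metis
      qed
      show "vec_real (\<psi> (x + y)) = vec_real (\<psi> x) + vec_real (\<psi> y)" if "x \<in> K" "y \<in> K" for x y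
      proof -
        have "\<psi> (x + y) = \<psi> x + \<psi> y" using \<phi>(1)[of "\<psi> x + \<psi> y"] \<phi>(2) that by (simp add: add')
        then show ?thesis by (simp add: vec_real_def vec_eq_iff)
      qed
    qed
  qed
  then show ?thesis by blast
qed

end
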